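(* Let $2\le n<\infty$. The operator system $E_n'=\operatorname{span}\{I_{n+1},E_{i0},E_{0i}:1\le i\le n\}\subseteq M_{n+1}$ is $C^*$-nuclear, i.e. $E_n'\otimes_{\min}\mathcal{A}=E_n'\otimes_{\max}\mathcal{A}$ for every unital $C^*$-algebra $\mathcal{A}$.
   Context: $E_{ij}$, $0\le i,j\le n$, are the matrix units of $M_{n+1}$, and $E_n'$ has the operator system structure inherited from $M_{n+1}$. For operator systems $\mathcal{S},\mathcal{T}$, the tensor products $\mathcal{S}\otimes_{\min}\mathcal{T}$ and $\mathcal{S}\otimes_{\max}\mathcal{T}$ are the algebraic tensor product with order unit $1_{\mathcal S}\otimes 1_{\mathcal T}$ and the following matrix cones. Min: $u\in M_p(\mathcal{S}\otimes_{\min}\mathcal{T})^+$ iff $(\varphi\otimes\psi)^{(p)}(u)\ge 0$ for all unital completely positive $\varphi:\mathcal{S}\to M_k$, $\psi:\mathcal{T}\to M_m$, all $k,m$. Max: $u\in M_p(\mathcal{S}\otimes_{\max}\mathcal{T})^+$ iff for every $\epsilon>0$ there are $k,m$, $P\in M_k(\mathcal{S})^+$, $Q\in M_m(\mathcal{T})^+$ and a scalar $p\times km$ matrix $X$ with $\epsilon\, (I_p\otimes 1_{\mathcal{S}}\otimes 1_{\mathcal{T}})+u=X(P\otimes Q)X^*$. Equality of the two means that the identity map is a complete order isomorphism. *)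

theory Defs
  imports
    "Jordan_Normal_Form.Matrix"
    "HOL-Analysis.Analysis"
    "HOL-Library.Poly_Mapping"
    "HOL-Library.Complex_Order"
begin

no_notation Matrix.vec_index (infixl \<open>$\<close> 100)
hide_const (open) Finite_Cartesian_Product.mat

section \<open>Complex vector spaces and unital C*-algebras\<close>

class complex_vector = ab_group_add +
  fixes scaleC :: "complex \<Rightarrow> 'a \<Rightarrow> 'a"
  assumes scaleC_add_right: "scaleC c (x + y) = scaleC c x + scaleC c y"
    and scaleC_add_left: "scaleC (c + d) x = scaleC c x + scaleC d x"
    and scaleC_scaleC: "scaleC c (scaleC d x) = scaleC (c * d) x"
    and scaleC_one: "scaleC 1 x = x"

text \<open>The superclasses provide completeness, submultiplicativity of the norm and
  \<open>norm 1 = 1\<close>; in particular a unital C*-algebra is nonzero.\<close>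

class unital_cstar_algebra = complex_vector + real_normed_algebra_1 + banach +
  fixes star :: "'a \<Rightarrow> 'a"
  assumes scaleR_scaleC: "scaleR r x = scaleC (complex_of_real r) x"
    and scaleC_mult_left: "scaleC c x * y = scaleC c (x * y)"
    and scaleC_mult_right: "x * scaleC c y = scaleC c (x * y)"
    and norm_scaleC: "norm (scaleC c x) = cmod c * norm x"
    and star_star: "star (star x) = x"
    and star_add: "star (x + y) = star x + star y"
    and star_scaleC: "star (scaleC c x) = scaleC (cnj c) (star x)"
    and star_mult: "star (x * y) = star y * star x"
    and cstar_identity: "norm (star x * x) = (norm x)\<^sup>2"


section \<open>Algebraic tensor products\<close>

text \<open>The free complex vector space on \<open>V \<times> W\<close> modulo the span of the bilinearity relators.\<close>

definition free_scale :: "complex \<Rightarrow> ('b \<Rightarrow>\<^sub>0 complex) \<Rightarrow> ('b \<Rightarrow>\<^sub>0 complex)" where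
  "free_scale c f = Poly_Mapping.map (\<lambda>z. c * z) f"

lemma lookup_free_scale [simp]: "Poly_Mapping.lookup (free_scale c f) x = c * Poly_Mapping.lookup f x"
  unfolding free_scale_def by transfer (simp add: when_def)

lemma module_free_scale: "Modules.module free_scale"
  by unfold_locales (auto intro!: poly_mapping_eqI simp: lookup_add algebra_simps)

definition bilinear_relators ::
    "('v::complex_vector \<times> 'w::complex_vector \<Rightarrow>\<^sub>0 complex) set" where
  "bilinear_relators =
     {Poly_Mapping.single (v + v', w) 1 - Poly_Mapping.single (v, w) 1
        - Poly_Mapping.single (v', w) 1 | v v' w. True}
   \<union> {Poly_Mapping.single (v, w + w') 1 - Poly_Mapping.single (v, w) 1
        - Poly_Mapping.single (v, w') 1 | v w w'. True}
   \<union> {Poly_Mapping.single (scaleC c v, w) 1 - Poly_Mapping.single (v, w) c | c v w. True}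
   \<union> {Poly_Mapping.single (v, scaleC c w) 1 - Poly_Mapping.single (v, w) c | c v w. True}"

definition tensor_rel ::
    "('v::complex_vector \<times> 'w::complex_vector \<Rightarrow>\<^sub>0 complex) \<Rightarrow> ('v \<times> 'w \<Rightarrow>\<^sub>0 complex) \<Rightarrow> bool" where
  "tensor_rel f g \<longleftrightarrow> f - g \<in> Modules.module.span free_scale bilinear_relators"

lemma equivp_tensor_rel: "equivp tensor_rel"
proof (intro equivpI reflpI sympI transpI)
  fix f g h :: "'a::complex_vector \<times> 'b::complex_vector \<Rightarrow>\<^sub>0 complex"
  note span = Modules.module.span_zero Modules.module.span_neg Modules.module.span_add
  note span = span[OF module_free_scale, where S = bilinear_relators]
  show "tensor_rel f f" by (simp add: tensor_rel_def span)
  show "tensor_rel g f" if "tensor_rel f g"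
    using span(2)[where x = "f - g"] that by (simp add: tensor_rel_def)
  show "tensor_rel f h" if "tensor_rel f g" "tensor_rel g h"
    using span(3)[where x = "f - g" and y = "g - h"] that by (simp add: tensor_rel_def)
qed

quotient_type (overloaded) ('v, 'w) tensor =
    "('v::complex_vector \<times> 'w::complex_vector) \<Rightarrow>\<^sub>0 complex" / tensor_rel
  by (rule equivp_tensor_rel)

instantiation tensor :: (complex_vector, complex_vector) complex_vector
begin

lift_definition zero_tensor :: "('a, 'b) tensor" is 0 .

lift_definition plus_tensor :: "('a, 'b) tensor \<Rightarrow> ('a, 'b) tensor \<Rightarrow> ('a, 'b) tensor" is "(+)"
proof -
  fix f f' g g' :: "'a \<times> 'b \<Rightarrow>\<^sub>0 complex"
  assume "tensor_rel f f'" "tensor_rel g g'"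
  then have "(f - f') + (g - g') \<in> Modules.module.span free_scale bilinear_relators"
    unfolding tensor_rel_def by (rule Modules.module.span_add[OF module_free_scale])
  then show "tensor_rel (f + g) (f' + g')" by (simp add: tensor_rel_def algebra_simps)
qed

lift_definition uminus_tensor :: "('a, 'b) tensor \<Rightarrow> ('a, 'b) tensor" is uminus
  unfolding tensor_rel_def
  by (metis minus_diff_minus Modules.module.span_neg[OF module_free_scale])

lift_definition minus_tensor :: "('a, 'b) tensor \<Rightarrow> ('a, 'b) tensor \<Rightarrow> ('a, 'b) tensor" is "(-)"
proof -
  fix f f' g g' :: "'a \<times> 'b \<Rightarrow>\<^sub>0 complex"
  assume "tensor_rel f f'" "tensor_rel g g'"
  then have "(f - f') - (g - g') \<in> Modules.module.span free_scale bilinear_relators"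
    unfolding tensor_rel_def by (rule Modules.module.span_diff[OF module_free_scale])
  then show "tensor_rel (f - g) (f' - g')" by (simp add: tensor_rel_def algebra_simps)
qed

lift_definition scaleC_tensor :: "complex \<Rightarrow> ('a, 'b) tensor \<Rightarrow> ('a, 'b) tensor" is free_scale
  unfolding tensor_rel_def
  by (metis Modules.module.scale_right_diff_distrib[OF module_free_scale]
      Modules.module.span_scale[OF module_free_scale])

instance
proof
  interpret Modules.module "free_scale :: complex \<Rightarrow> ('a \<times> 'b \<Rightarrow>\<^sub>0 complex) \<Rightarrow> _"
    by (rule module_free_scale)
  note tr = reflpD[OF equivp_reflp_symp_transp[THEN iffD1, OF equivp_tensor_rel, THEN conjunct1]]
  fix x y z :: "('a, 'b) tensor" and c d :: complex
  show "x + y + z = x + (y + z)" by transfer (simp add: add.assoc tr)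
  show "x + y = y + x" by transfer (simp add: add.commute tr)
  show "0 + x = x" by transfer (simp add: tr)
  show "- x + x = 0" by transfer (simp add: tr)
  show "x - y = x + - y" by transfer (simp add: tr)
  show "scaleC c (x + y) = scaleC c x + scaleC c y" by transfer (simp add: scale_right_distrib tr)
  show "scaleC (c + d) x = scaleC c x + scaleC d x" by transfer (simp add: scale_left_distrib tr)
  show "scaleC c (scaleC d x) = scaleC (c * d) x" by transfer (simp add: tr)
  show "scaleC 1 x = x" by transfer (simp add: tr)
qed

end

lift_definition pure_tensor :: "'v::complex_vector \<Rightarrow> 'w::complex_vector \<Rightarrow> ('v, 'w) tensor"
    (infixl \<open>\<otimes>\<^sub>t\<close> 70)
  is "\<lambda>v w. Poly_Mapping.single (v, w) 1" .

lemma pure_tensor_add_left: "(v + v') \<otimes>\<^sub>t w = v \<otimes>\<^sub>t w + v' \<otimes>\<^sub>t w"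
  apply transfer
  unfolding tensor_rel_def diff_diff_eq[symmetric]
  by (rule Modules.module.span_base[OF module_free_scale]) (unfold bilinear_relators_def, blast)

lemma pure_tensor_add_right: "v \<otimes>\<^sub>t (w + w') = v \<otimes>\<^sub>t w + v \<otimes>\<^sub>t w'"
  apply transfer
  unfolding tensor_rel_def diff_diff_eq[symmetric]
  by (rule Modules.module.span_base[OF module_free_scale]) (unfold bilinear_relators_def, blast)

lemma free_scale_single [simp]:
  "free_scale c (Poly_Mapping.single x d) = Poly_Mapping.single x (c * d)"
  by (rule poly_mapping_eqI) (simp add: lookup_single when_def)

lemma pure_tensor_scaleC_left: "scaleC c v \<otimes>\<^sub>t w = scaleC c (v \<otimes>\<^sub>t w)"
  apply transfer
  unfolding tensor_rel_def free_scale_single mult_1_right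
  by (rule Modules.module.span_base[OF module_free_scale]) (unfold bilinear_relators_def, blast)

lemma pure_tensor_scaleC_right: "v \<otimes>\<^sub>t scaleC c w = scaleC c (v \<otimes>\<^sub>t w)"
  apply transfer
  unfolding tensor_rel_def free_scale_single mult_1_right
  by (rule Modules.module.span_base[OF module_free_scale]) (unfold bilinear_relators_def, blast)

text \<open>The linear functional induced by a bilinear form, evaluated on a chosen representative.
  The lemmas below show that the choice is irrelevant.\<close>

definition free_lift :: "('v \<Rightarrow> 'w \<Rightarrow> complex) \<Rightarrow> ('v \<times> 'w \<Rightarrow>\<^sub>0 complex) \<Rightarrow> complex" where
  "free_lift B f = (\<Sum>(v, w) \<in> Poly_Mapping.keys f. Poly_Mapping.lookup f (v, w) * B v w)"

definition tensor_lift ::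
    "('v::complex_vector \<Rightarrow> 'w::complex_vector \<Rightarrow> complex) \<Rightarrow> ('v, 'w) tensor \<Rightarrow> complex" where
  "tensor_lift B u = free_lift B (rep_tensor u)"

definition bilinear_form :: "('v::complex_vector \<Rightarrow> 'w::complex_vector \<Rightarrow> complex) \<Rightarrow> bool" where
  "bilinear_form B \<longleftrightarrow>
     (\<forall>v v' w. B (v + v') w = B v w + B v' w) \<and> (\<forall>v w w'. B v (w + w') = B v w + B v w') \<and>
     (\<forall>c v w. B (scaleC c v) w = c * B v w) \<and> (\<forall>c v w. B v (scaleC c w) = c * B v w)"

lemma free_lift_superset:
  assumes "finite I" "Poly_Mapping.keys f \<subseteq> I"
  shows "free_lift B f = (\<Sum>x \<in> I. Poly_Mapping.lookup f x * B (fst x) (snd x))"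
  unfolding free_lift_def case_prod_unfold prod.collapse
  by (rule sum.mono_neutral_left) (use assms in \<open>auto simp: in_keys_iff\<close>)

lemma free_lift_add: "free_lift B (f + g) = free_lift B f + free_lift B g"
proof -
  let ?I = "Poly_Mapping.keys f \<union> Poly_Mapping.keys g"
  have "Poly_Mapping.keys (f + g) \<subseteq> ?I" by (rule Poly_Mapping.keys_add)
  then show ?thesis
    by (simp add: free_lift_superset[of ?I] lookup_add distrib_right sum.distrib)
qed

lemma free_lift_scale: "free_lift B (free_scale c f) = c * free_lift B f"
proof -
  have "Poly_Mapping.keys (free_scale c f) \<subseteq> Poly_Mapping.keys f" by (auto simp: in_keys_iff)
  then show ?thesis
    by (simp add: free_lift_superset[of "Poly_Mapping.keys f"] sum_distrib_left mult.assoc)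
qed

lemma free_lift_single [simp]: "free_lift B (Poly_Mapping.single (v, w) c) = c * B v w"
  by (simp add: free_lift_superset[of "{(v, w)}"])

lemma free_lift_diff: "free_lift B (f - g) = free_lift B f - free_lift B g"
  using free_lift_add[of B "f - g" g] by simp

lemma free_lift_cong:
  assumes "bilinear_form B" "tensor_rel f g"
  shows "free_lift B f = free_lift B g"
proof -
  interpret Modules.module "free_scale :: complex \<Rightarrow> ('a \<times> 'b \<Rightarrow>\<^sub>0 complex) \<Rightarrow> _"
    by (rule module_free_scale)
  have sub: "subspace {h. free_lift B h = 0}"
    by (rule subspaceI) (auto simp: free_lift_add free_lift_scale, simp add: free_lift_def)
  have "span bilinear_relators \<subseteq> {h. free_lift B h = 0}"
    by (rule span_minimal[OF _ sub])
      (use assms(1) in \<open>auto simp: bilinear_relators_def free_lift_diff bilinear_form_def\<close>)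
  with assms(2) show ?thesis by (auto simp: tensor_rel_def free_lift_diff)
qed

lemma tensor_lift_abs:
  assumes "bilinear_form B"
  shows "tensor_lift B (abs_tensor f) = free_lift B f"
  unfolding tensor_lift_def
  by (rule free_lift_cong[OF assms])
    (metis Quotient_tensor Quotient_rep_abs equivp_reflp equivp_tensor_rel)

lemma tensor_lift_pure:
  assumes "bilinear_form B"
  shows "tensor_lift B (v \<otimes>\<^sub>t w) = B v w"
  by (simp add: pure_tensor.abs_eq tensor_lift_abs[OF assms])

lemma tensor_lift_add:
  assumes "bilinear_form B"
  shows "tensor_lift B (x + y) = tensor_lift B x + tensor_lift B y"
  by (induction x, induction y)
    (simp add: plus_tensor.abs_eq tensor_lift_abs[OF assms] free_lift_add)

lemma tensor_lift_scaleC: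
  assumes "bilinear_form B"
  shows "tensor_lift B (scaleC c x) = c * tensor_lift B x"
  by (induction x) (simp add: scaleC_tensor.abs_eq tensor_lift_abs[OF assms] free_lift_scale)


section \<open>Matrix cones and completely positive maps\<close>

text \<open>The data of an operator system: order unit and the cones \<open>M\<^sub>p(V)\<^sup>+\<close>.
  The involution is not recorded separately, as it is determined by the cones
  (the cone at level 1 consists of selfadjoint elements and spans the space).\<close>

record 'v opsys =
  os_unit :: 'v
  os_cone :: "nat \<Rightarrow> 'v Matrix.mat set"

definition psd_on :: "'i set \<Rightarrow> ('i \<Rightarrow> 'i \<Rightarrow> complex) \<Rightarrow> bool" where
  "psd_on I A \<longleftrightarrow> (\<forall>x. 0 \<le> (\<Sum>i\<in>I. \<Sum>j\<in>I. cnj (x i) * A i j * x j))"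

text \<open>\<open>M\<^sub>p(M\<^sub>k)\<^sup>+\<close>; a \<open>p\<close>-by-\<open>p\<close> matrix over \<open>M\<^sub>k\<close> acts on \<open>\<complex>\<^sup>p \<otimes> \<complex>\<^sup>k\<close>.\<close>

definition matrix_cone :: "nat \<Rightarrow> nat \<Rightarrow> complex Matrix.mat Matrix.mat set" where
  "matrix_cone k p = {U \<in> carrier_mat p p. (\<forall>i<p. \<forall>j<p. U $$ (i, j) \<in> carrier_mat k k) \<and>
     psd_on ({..<p} \<times> {..<k}) (\<lambda>(i, a) (j, b). U $$ (i, j) $$ (a, b))}"

text \<open>Unital completely positive maps into \<open>M\<^sub>k\<close>.\<close>

definition ucp :: "'v::complex_vector opsys \<Rightarrow> nat \<Rightarrow> ('v \<Rightarrow> complex Matrix.mat) \<Rightarrow> bool" where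
  "ucp S k \<phi> \<longleftrightarrow>
     (\<forall>v. \<phi> v \<in> carrier_mat k k) \<and>
     (\<forall>v w. \<phi> (v + w) = \<phi> v + \<phi> w) \<and> (\<forall>c v. \<phi> (scaleC c v) = c \<cdot>\<^sub>m \<phi> v) \<and>
     \<phi> (os_unit S) = 1\<^sub>m k \<and>
     (\<forall>p. \<forall>P \<in> os_cone S p. map_mat \<phi> P \<in> matrix_cone k p)"

definition complete_order_iso ::
    "'v::complex_vector opsys \<Rightarrow> 'w::complex_vector opsys \<Rightarrow> ('v \<Rightarrow> 'w) \<Rightarrow> bool" where
  "complete_order_iso S T f \<longleftrightarrow>
     bij f \<and> (\<forall>v w. f (v + w) = f v + f w) \<and> (\<forall>c v. f (scaleC c v) = scaleC c (f v)) \<and>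
     f (os_unit S) = os_unit T \<and>
     (\<forall>p. \<forall>U \<in> carrier_mat p p. U \<in> os_cone S p \<longleftrightarrow> map_mat f U \<in> os_cone T p)"


section \<open>Minimal and maximal tensor products\<close>

text \<open>Kronecker product, entrywise with respect to the product \<open>m\<close>.\<close>

definition kron :: "('a \<Rightarrow> 'b \<Rightarrow> 'c) \<Rightarrow> 'a Matrix.mat \<Rightarrow> 'b Matrix.mat \<Rightarrow> 'c Matrix.mat" where
  "kron m P Q = Matrix.mat (dim_row P * dim_row Q) (dim_col P * dim_col Q)
     (\<lambda>(i, j). m (P $$ (i div dim_row Q, j div dim_col Q)) (Q $$ (i mod dim_row Q, j mod dim_col Q)))"

text \<open>\<open>\<phi> \<otimes> \<psi>\<close>, with \<open>M\<^sub>k \<otimes> M\<^sub>m\<close> identified with \<open>M\<^bsub>km\<^esub>\<close> by the Kronecker product.\<close>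

definition tensor_map :: "nat \<Rightarrow> nat \<Rightarrow> ('v::complex_vector \<Rightarrow> complex Matrix.mat) \<Rightarrow>
    ('w::complex_vector \<Rightarrow> complex Matrix.mat) \<Rightarrow> ('v, 'w) tensor \<Rightarrow> complex Matrix.mat" where
  "tensor_map k m \<phi> \<psi> u = Matrix.mat (k * m) (k * m)
     (\<lambda>ij. tensor_lift (\<lambda>v w. kron (*) (\<phi> v) (\<psi> w) $$ ij) u)"

definition min_tensor ::
    "'v::complex_vector opsys \<Rightarrow> 'w::complex_vector opsys \<Rightarrow> ('v, 'w) tensor opsys" where
  "min_tensor S T = \<lparr>os_unit = os_unit S \<otimes>\<^sub>t os_unit T,
     os_cone = (\<lambda>p. {u \<in> carrier_mat p p. \<forall>k m \<phi> \<psi>. ucp S k \<phi> \<and> ucp T m \<psi> \<longrightarrow>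
       map_mat (tensor_map k m \<phi> \<psi>) u \<in> matrix_cone (k * m) p})\<rparr>"

text \<open>\<open>X W X\<^sup>*\<close> for a scalar matrix \<open>X\<close> and a square matrix \<open>W\<close> over a complex vector space.\<close>

definition compress :: "complex Matrix.mat \<Rightarrow> 'v::complex_vector Matrix.mat \<Rightarrow> 'v Matrix.mat" where
  "compress X W = Matrix.mat (dim_row X) (dim_row X)
     (\<lambda>(i, j). \<Sum>a<dim_col X. \<Sum>b<dim_col X. scaleC (X $$ (i, a) * cnj (X $$ (j, b))) (W $$ (a, b)))"

definition max_tensor ::
    "'v::complex_vector opsys \<Rightarrow> 'w::complex_vector opsys \<Rightarrow> ('v, 'w) tensor opsys" where
  "max_tensor S T = \<lparr>os_unit = os_unit S \<otimes>\<^sub>t os_unit T,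
     os_cone = (\<lambda>p. {u \<in> carrier_mat p p. \<forall>\<epsilon>::real. \<epsilon> > 0 \<longrightarrow>
       (\<exists>k m. \<exists>P \<in> os_cone S k. \<exists>Q \<in> os_cone T m. \<exists>X \<in> carrier_mat p (k * m).
          Matrix.mat p p (\<lambda>(i, j).
            if i = j then scaleC (complex_of_real \<epsilon>) (os_unit S \<otimes>\<^sub>t os_unit T) else 0) + u
          = compress X (kron (\<otimes>\<^sub>t) P Q))})\<rparr>"


section \<open>Unital C*-algebras as operator systems\<close>

definition star_mat :: "'a::unital_cstar_algebra Matrix.mat \<Rightarrow> 'a Matrix.mat" where
  "star_mat Y = map_mat star (Y\<^sup>T)"

text \<open>\<open>M\<^sub>p(A)\<^sup>+\<close> is the set of positive elements \<open>Y\<^sup>* Y\<close> of the C*-algebra \<open>M\<^sub>p(A)\<close>.\<close>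

definition cstar_opsys :: "'a::unital_cstar_algebra opsys" where
  "cstar_opsys = \<lparr>os_unit = 1, os_cone = (\<lambda>p. {star_mat Y * Y | Y. Y \<in> carrier_mat p p})\<rparr>"


section \<open>The operator system \<open>E\<^sub>n'\<close>\<close>

text \<open>With \<open>n = CARD('n)\<close>, the matrices of \<open>M\<^bsub>n+1\<^esub>\<close> are indexed by \<open>'n option\<close>: the index 0 is
  \<^const>\<open>None\<close> and the indices \<open>1, \<dots>, n\<close> are the \<open>Some i\<close>.\<close>

definition matrix_scale :: "complex \<Rightarrow> complex^'m^'m \<Rightarrow> complex^'m^'m" where
  "matrix_scale c A = (\<chi> i j. c * A $ i $ j)"

lemma module_matrix_scale: "Modules.module matrix_scale"
  by unfold_locales (simp_all add: matrix_scale_def vec_eq_iff algebra_simps)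

definition matrix_unit :: "'m \<Rightarrow> 'm \<Rightarrow> complex^'m^'m" where
  "matrix_unit i j = (\<chi> a b. if a = i \<and> b = j then 1 else 0)"

typedef 'n eprime = "Modules.module.span matrix_scale
    ({Finite_Cartesian_Product.mat 1}
      \<union> (\<Union>i. {matrix_unit (Some i) None, matrix_unit None (Some i)}))
    :: (complex^('n::finite option)^('n option)) set"
  by (rule exI, rule Modules.module.span_zero[OF module_matrix_scale])

setup_lifting type_definition_eprime

instantiation eprime :: (finite) complex_vector
begin

lift_definition zero_eprime :: "'a eprime" is 0
  by (rule Modules.module.span_zero[OF module_matrix_scale])

lift_definition plus_eprime :: "'a eprime \<Rightarrow> 'a eprime \<Rightarrow> 'a eprime" is "(+)"
  by (rule Modules.module.span_add[OF module_matrix_scale])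

lift_definition uminus_eprime :: "'a eprime \<Rightarrow> 'a eprime" is uminus
  by (rule Modules.module.span_neg[OF module_matrix_scale])

lift_definition minus_eprime :: "'a eprime \<Rightarrow> 'a eprime \<Rightarrow> 'a eprime" is "(-)"
  by (rule Modules.module.span_diff[OF module_matrix_scale])

lift_definition scaleC_eprime :: "complex \<Rightarrow> 'a eprime \<Rightarrow> 'a eprime" is matrix_scale
  by (rule Modules.module.span_scale[OF module_matrix_scale])

instance
  by standard (transfer; simp add: matrix_scale_def vec_eq_iff algebra_simps)+

end

lift_definition one_eprime :: "'n::finite eprime" is "Finite_Cartesian_Product.mat 1"
  by (rule Modules.module.span_base[OF module_matrix_scale]) simp

text \<open>A matrix over \<open>E\<^sub>n'\<close> is positive iff it is positive in \<open>M\<^sub>p(M\<^bsub>n+1\<^esub>)\<close>.\<close>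

definition eprime_opsys :: "'n::finite eprime opsys" where
  "eprime_opsys = \<lparr>os_unit = one_eprime,
     os_cone = (\<lambda>p. {P \<in> carrier_mat p p.
       psd_on ({..<p} \<times> UNIV) (\<lambda>(i, a) (j, b). Rep_eprime (P $$ (i, j)) $ a $ b)})\<rparr>"

end

theory Submission
  imports Defs
begin

text \<open>An element of \<open>M\<^sub>p(E\<^sub>n' \<otimes> A)\<close> has the form
  \<open>I \<otimes> c + \<Sum>\<^sub>i (E\<^bsub>i0\<^esub> \<otimes> a\<^sub>i + E\<^bsub>0i\<^esub> \<otimes> b\<^sub>i)\<close> with \<open>c, a\<^sub>i, b\<^sub>i \<in> M\<^sub>p(A)\<close>. If it is
  positive in the minimal tensor product, then the arrow matrix with \<open>c\<close> on the diagonal, the \<open>a\<^sub>i\<close>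
  in column 0 and the \<open>b\<^sub>i\<close> in row 0 is, up to \<open>\<epsilon>\<close>, of the form \<open>Y\<^sup>* Y\<close>: a functional separating it
  from the cone of these squares would induce a unital completely positive map from \<open>A\<close> into
  matrices that detects the failure.

  For a positive arrow matrix the Schur complement gives \<open>\<Sum>\<^sub>i d\<^sub>i\<^sup>* c d\<^sub>i \<le> c\<close> with
  \<open>d\<^sub>i = c\<inverse> a\<^sub>i\<close>. Iterating this inequality along words in the letters \<open>1, \<dots>, n\<close> produces columns
  \<open>q\<^sub>j\<close> such that the element is approximated by compressions of \<open>P \<otimes> Q\<close>, where \<open>Q\<close> is the Gram
  matrix of the \<open>q\<^sub>j\<close> and \<open>P\<close> has \<open>I\<close> on the diagonal and the \<open>E\<^bsub>i0\<^esub>\<close>, \<open>E\<^bsub>0i\<^esub>\<close> along the edges of the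
  forest of words. Since \<open>c\<close> need not be invertible, \<open>c\<inverse>\<close> is replaced by a partial sum of its
  Neumann series.\<close>

section \<open>Positivity in C*-algebras\<close>

text \<open>Why words: in the construction an edge labelled \<open>i\<close> leaves a column
  \<open>q\<close> and ends in \<open>q * d_i\<close>, so that \<open>c * d_i = a_i\<close> produces
  the right coefficient. A level of columns with total mass \<open>c\<close> thus calls for a next
  level of mass \<open>\<Sum> star d_i * c * d_i\<close>, and that level for another one. The Schur
  inequality says exactly that the next level fits into mass \<open>c\<close> again. Cutting off
  leaves \<open>N + 1\<close> masses \<open>c\<close> against \<open>N\<close> copies of
  \<open>a_i\<close>; after averaging the discrepancy is of order \<open>1/N\<close>, and the
  multiple of the unit allowed in the maximal cone absorbs it. No norm on matrices over the algebra
  is introduced: positivity there means being a Gram matrix. The deepest fact about the algebra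
  itself, that \<open>star x * x\<close> has nonnegative spectrum, enters through one question only.
  The minimal cone speaks about ucp maps, so hermitian symmetry of the coefficients must be
  recovered from the fact that ucp maps separate points, and that rests on positivity of
  \<open>star x * x\<close>.\<close>

lemma scaleC_0_left [simp]: "scaleC 0 (x::'a::complex_vector) = 0"
  using scaleC_add_left[of 0 0 x] by simp

lemma scaleC_0_right [simp]: "scaleC c (0::'a::complex_vector) = 0"
  using scaleC_add_right[of c 0 "0::'a"] by simp

lemma scaleC_minus_right: "scaleC c (- x::'a::complex_vector) = - scaleC c x"
  using scaleC_add_right[of c x "- x"] by (simp add: eq_neg_iff_add_eq_0 add.commute)

lemma scaleC_minus_left: "scaleC (- c) (x::'a::complex_vector) = - scaleC c x"
  using scaleC_add_left[of c "- c" x] by (simp add: eq_neg_iff_add_eq_0 add.commute)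

lemma scaleC_diff_right: "scaleC c (x - y::'a::complex_vector) = scaleC c x - scaleC c y"
  using scaleC_add_right[of c x "- y"] by (simp add: scaleC_minus_right)

declare scaleC_one [simp]

context
  fixes dummy :: "'a::unital_cstar_algebra"
begin

lemma star_0 [simp]: "star (0::'a) = 0"
  using star_add[of "0::'a" 0] by simp

lemma star_minus: "star (- x::'a) = - star x"
  using star_add[of x "- x"] by (simp add: eq_neg_iff_add_eq_0 add.commute)

lemma star_diff: "star (x - y::'a) = star x - star y"
  using star_add[of x "- y"] by (simp add: star_minus)

lemma star_1 [simp]: "star (1::'a) = 1"
proof -
  have "star (star (1::'a) * 1) = star 1 * star (star 1)" by (rule star_mult)
  then show ?thesis by (simp add: star_star)
qed

lemma star_scaleR: "star (r *\<^sub>R x::'a) = r *\<^sub>R star x"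
  by (simp add: scaleR_scaleC star_scaleC)

lemma star_of_real [simp]: "star (of_real r::'a) = of_real r"
  by (simp add: of_real_def star_scaleR)

lemma star_sum: "star (sum f A::'a) = (\<Sum>i\<in>A. star (f i))"
  by (induction A rule: infinite_finite_induct) (simp_all add: star_add)

lemma star_power: "star (x ^ n::'a) = star x ^ n"
  by (induction n) (simp_all add: star_mult power_commutes)

lemma norm_star: "norm (star x::'a) = norm x"
proof -
  have le: "norm y \<le> norm (star y)" for y :: 'a
  proof (cases "y = 0")
    case False
    have "norm y * norm y \<le> norm (star y) * norm y"
      using cstar_identity[of y] norm_mult_ineq[of "star y" y] by (simp add: power2_eq_square)
    with False show ?thesis by simp
  next
    case True
    then have "norm y = 0" by simp
    then show ?thesis by (metis norm_ge_zero)
  qed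
  from le[of x] le[of "star x"] show ?thesis by (simp add: star_star)
qed

lemma bounded_linear_star: "bounded_linear (star :: 'a \<Rightarrow> 'a)"
  by (rule bounded_linear_intro[where K = 1]) (simp_all add: star_add star_scaleR norm_star)

lemma norm_square_selfadjoint: "star (x::'a) = x \<Longrightarrow> norm (x * x) = (norm x)\<^sup>2"
  using cstar_identity[of x] by simp

end

section \<open>Square roots and norm estimates without functional calculus\<close>

lemma abs_gbinomial_half_le_1: "\<bar>(1/2::real) gchoose n\<bar> \<le> 1"
proof (induction n)
  case (Suc n)
  have "real (Suc n) * ((1/2::real) gchoose Suc n) = (1/2 - real n) * ((1/2) gchoose n)"
    using gbinomial_mult_1[of "1/2::real" n] by (simp add: algebra_simps)
  then have "real (Suc n) * \<bar>(1/2::real) gchoose Suc n\<bar> = \<bar>1/2 - real n\<bar> * \<bar>(1/2) gchoose n\<bar>"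
    by (metis abs_mult abs_of_nat)
  also have "\<dots> \<le> real (Suc n) * 1"
    by (rule mult_mono) (use Suc in auto)
  finally show ?case by (simp del: of_nat_Suc)
qed simp

text \<open>\<open>k\<close> is the binomial series of \<open>1 - z\<close> for the exponent
  \<open>1/2\<close>. Its coefficients are at most 1 in absolute value, so the geometric series
  dominates it, and the Vandermonde convolution squares it to \<open>1 - z\<close>. The commutation
  clause replaces the statement that functional calculus stays in the closed algebra generated by
  \<open>z\<close>.\<close>

lemma sqrt_one_minus:
  fixes z :: "'a::unital_cstar_algebra"
  assumes z: "star z = z" "norm z < 1"
  obtains k where "star k = k" "k * k = 1 - z" "\<And>w. w * z = z * w \<Longrightarrow> w * k = k * w"
proof -
  define c where "c n = ((1/2::real) gchoose n) * (-1) ^ n" for n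
  define f where "f n = c n *\<^sub>R z ^ n" for n
  have c1: "\<bar>c n\<bar> \<le> 1" for n
    by (simp add: c_def abs_mult abs_gbinomial_half_le_1)
  have sn: "summable (\<lambda>n. norm (f n))"
  proof (rule summable_comparison_test'[where N = 0])
    show "summable (\<lambda>n. norm z ^ n)" using z(2) by (simp add: summable_geometric)
    show "norm (norm (f n)) \<le> norm z ^ n" for n
    proof -
      have "norm (f n) = \<bar>c n\<bar> * norm (z ^ n)" by (simp add: f_def)
      also have "\<dots> \<le> 1 * norm z ^ n"
        by (rule mult_mono[OF c1 norm_power_ineq]) auto
      finally show ?thesis by simp
    qed
  qed
  then have s: "summable f" by (rule summable_norm_cancel)
  define k where "k = suminf f"
  have vd: "(\<Sum>i\<le>n. c i * c (n - i)) = (if n = 0 then 1 else if n = 1 then -1 else 0)" for n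
  proof -
    have "(\<Sum>i\<le>n. c i * c (n - i)) = (-1) ^ n * (\<Sum>i=0..n. (1/2 gchoose i) * (1/2 gchoose (n - i)))"
      unfolding sum_distrib_left atLeast0AtMost
      by (rule sum.cong) (auto simp: c_def power_add[symmetric])
    also have "(\<Sum>i=0..n. (1/2 gchoose i) * ((1/2::real) gchoose (n - i))) = 1 gchoose n"
      by (subst gbinomial_Vandermonde) simp
    also have "(1 gchoose n :: real) = of_nat (1 choose n)"
      by (simp add: binomial_gbinomial)
    finally show ?thesis by (cases n) (auto simp: binomial_eq_0)
  qed
  have A: "(\<lambda>n. \<Sum>i\<le>n. f i * f (n - i)) sums (k * k)"
    unfolding k_def by (rule Cauchy_product_sums[OF sn sn])
  have B: "(\<Sum>i\<le>n. f i * f (n - i)) = (if n = 0 then 1 else if n = 1 then - z else 0)" for n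
  proof -
    have "(\<Sum>i\<le>n. f i * f (n - i)) = (\<Sum>i\<le>n. c i * c (n - i)) *\<^sub>R z ^ n"
      unfolding scaleR_sum_left
      by (rule sum.cong) (auto simp: f_def power_add[symmetric])
    then show ?thesis by (simp add: vd)
  qed
  have C: "(\<lambda>n. if n = 0 then 1 else if n = 1 then - z else 0) sums (1 - z)"
  proof -
    have "(\<lambda>n. if n = 0 then 1 else if n = 1 then - z else 0) sums
        (\<Sum>n\<in>{0,1::nat}. if n = 0 then 1 else if n = 1 then - z else 0)"
      by (rule sums_finite) auto
    then show ?thesis by simp
  qed
  have kk: "k * k = 1 - z" by (rule sums_unique2[OF A[unfolded B] C])
  have "star k = k"
  proof -
    have "star k = suminf (\<lambda>n. star (f n))"
      unfolding k_def by (rule bounded_linear.suminf[OF bounded_linear_star s])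
    also have "(\<lambda>n. star (f n)) = f" by (simp add: f_def fun_eq_iff star_scaleR star_power z(1))
    finally show ?thesis by (simp add: k_def)
  qed
  moreover have "w * k = k * w" if w: "w * z = z * w" for w
  proof -
    have "w * f n = f n * w" for n
      unfolding f_def by (simp add: power_commuting_commutes[OF w[symmetric]])
    then show ?thesis unfolding k_def by (simp add: suminf_mult[OF s, symmetric] suminf_mult2[OF s])
  qed
  ultimately show ?thesis using kk that by blast
qed

text \<open>For commuting selfadjoint elements, \<open>e + i d\<close> is normal with real part
  \<open>e\<close>, and the C*-identity gives the bound. It stands in for monotonicity of the norm
  on positive elements.\<close>

lemma norm_square_le_norm_sum_squares:
  fixes e d :: "'a::unital_cstar_algebra"
  assumes sa: "star e = e" "star d = d" and comm: "e * d = d * e"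
  shows "(norm e)\<^sup>2 \<le> norm (e * e + d * d)"
proof -
  define N where "N = e + scaleC \<i> d"
  have sN: "star N = e - scaleC \<i> d"
    by (simp add: N_def star_add star_scaleC sa scaleC_minus_left)
  have NN: "star N * N = e * e + d * d"
    unfolding sN unfolding N_def
    by (simp add: algebra_simps scaleC_mult_left scaleC_mult_right scaleC_scaleC scaleC_minus_left scaleC_add_right
        scaleC_diff_right comm)
  have "2 *\<^sub>R e = N + star N" unfolding sN by (simp add: N_def scaleR_2)
  then have "2 * norm e \<le> norm N + norm (star N)"
    by (metis norm_scaleR abs_numeral norm_triangle_ineq)
  then have "norm e \<le> norm N" by (simp add: norm_star)
  then have "(norm e)\<^sup>2 \<le> (norm N)\<^sup>2" by (simp add: power_mono)
  then show ?thesis by (simp add: cstar_identity[symmetric] NN)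
qed

section \<open>Positive elements through the norm\<close>

text \<open>For selfadjoint \<open>h\<close> this says that the spectrum is nonnegative.\<close>

definition spectral_pos :: "'a::unital_cstar_algebra \<Rightarrow> bool" where
  "spectral_pos h \<longleftrightarrow> star h = h \<and> (\<exists>l. norm (of_real l - h) \<le> l)"

lemma spectral_pos_mono:
  fixes h :: "'a::unital_cstar_algebra"
  assumes "norm (of_real l - h) \<le> l" "l \<le> m"
  shows "norm (of_real m - h) \<le> m"
proof -
  have "of_real m - h = (of_real l - h) + of_real (m - l)" by simp
  then have "norm (of_real m - h) \<le> norm (of_real l - h) + norm (of_real (m - l) :: 'a)"
    by (metis norm_triangle_ineq)
  with assms show ?thesis by (simp del: of_real_diff)
qed

text \<open>The norm form of \<open>spectral_pos\<close> reduces this to the triangle inequality; in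
  terms of spectra it would be a theorem of its own.\<close>

lemma spectral_pos_add: "spectral_pos g \<Longrightarrow> spectral_pos h \<Longrightarrow> spectral_pos (g + h)"
proof -
  assume "spectral_pos g" "spectral_pos h"
  then obtain l m where *: "norm (of_real l - g) \<le> l" "norm (of_real m - h) \<le> m"
      "star g = g" "star h = h"
    by (auto simp: spectral_pos_def)
  have "norm ((of_real l - g) + (of_real m - h)) \<le> l + m"
    using norm_triangle_mono[OF *(1,2)] .
  then have "norm (of_real (l + m) - (g + h)) \<le> l + m" by (simp add: algebra_simps)
  with * show ?thesis unfolding spectral_pos_def by (metis star_add)
qed

lemma spectral_pos_scaleR: "0 \<le> r \<Longrightarrow> spectral_pos h \<Longrightarrow> spectral_pos (r *\<^sub>R h)"
proof -
  assume r: "0 \<le> r" and "spectral_pos h"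
  then obtain l where *: "norm (of_real l - h) \<le> l" "star h = h"
    by (auto simp: spectral_pos_def)
  have "norm (of_real (r * l) - r *\<^sub>R h) = norm (r *\<^sub>R (of_real l - h))"
    by (simp add: algebra_simps of_real_def)
  also have "\<dots> \<le> r * l" using * r by (simp add: mult_left_mono)
  finally show ?thesis using * unfolding spectral_pos_def by (metis star_scaleR)
qed

lemma spectral_pos_of_real: "0 \<le> r \<Longrightarrow> spectral_pos (of_real r)"
  unfolding spectral_pos_def by (auto intro: exI[of _ r])

lemma spectral_pos_sum: "(\<And>i. i \<in> A \<Longrightarrow> spectral_pos (f i)) \<Longrightarrow> spectral_pos (sum f A)"
  using spectral_pos_of_real[of 0]
  by (induction A rule: infinite_finite_induct) (auto intro: spectral_pos_add)

text \<open>After scaling \<open>k\<close> to \<open>k'\<close> with norm below 1, let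
  \<open>j\<close> be the root of \<open>1 - k' * k'\<close>. It commutes with \<open>k'\<close>,
  hence \<open>norm (1 - k' * k') = (norm j) ^ 2 \<le> norm (j * j + k' * k') = 1\<close>.\<close>

lemma spectral_pos_square:
  fixes k :: "'a::unital_cstar_algebra"
  assumes k: "star k = k"
  shows "spectral_pos (k * k)"
proof -
  define l where "l = (norm k)\<^sup>2 + 1"
  have l: "l > 0" unfolding l_def by (rule add_nonneg_pos) auto
  define k' where "k' = (1 / sqrt l) *\<^sub>R k"
  have k': "star k' = k'" by (simp add: k'_def star_scaleR k)
  have kk': "k' * k' = (1 / l) *\<^sub>R (k * k)" using l by (simp add: k'_def)
  have "norm (k' * k') < 1"
    using l by (simp add: kk' norm_square_selfadjoint[OF k]) (simp add: l_def)
  then obtain j where j: "star j = j" "j * j = 1 - k' * k'"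
      and comm: "\<And>w. w * (k' * k') = (k' * k') * w \<Longrightarrow> w * j = j * w"
    using sqrt_one_minus[of "k' * k'"] by (metis star_mult k')
  have "(norm j)\<^sup>2 \<le> norm (j * j + k' * k')"
    by (rule norm_square_le_norm_sum_squares[OF j(1) k']) (metis comm mult.assoc)
  then have "norm (1 - k' * k') \<le> 1"
    using norm_square_selfadjoint[OF j(1)] by (simp add: j(2))
  moreover have "of_real l - k * k = l *\<^sub>R (1 - k' * k')"
    using l by (simp add: kk' algebra_simps of_real_def)
  ultimately have "norm (of_real l - k * k) \<le> l" using l by simp
  then show ?thesis by (auto simp: spectral_pos_def star_mult k)
qed

text \<open>Writing \<open>h + \<delta>\<close> as \<open>(l + \<delta>) * (1 - z)\<close> pushes
  the norm of \<open>z\<close> strictly below 1, where \<open>sqrt_one_minus\<close>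
  applies.\<close>

lemma spectral_pos_sqrt:
  fixes h :: "'a::unital_cstar_algebra"
  assumes "spectral_pos h" "\<delta> > 0"
  obtains k where "star k = k" "k * k = h + of_real \<delta>" "\<And>w. w * h = h * w \<Longrightarrow> w * k = k * w"
proof -
  from assms obtain l where l: "norm (of_real l - h) \<le> l" "star h = h"
    by (auto simp: spectral_pos_def)
  have l0: "l \<ge> 0" using l(1) norm_ge_zero order_trans by blast
  define z where "z = (1 / (l + \<delta>)) *\<^sub>R (of_real l - h)"
  have "star z = z" by (simp add: z_def star_scaleR star_diff l)
  moreover have "norm z < 1" using l l0 \<open>\<delta> > 0\<close> by (simp add: z_def divide_simps)
  ultimately obtain k where k: "star k = k" "k * k = 1 - z" "\<And>w. w * z = z * w \<Longrightarrow> w * k = k * w"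
    using sqrt_one_minus by metis
  show ?thesis
  proof
    let ?k = "sqrt (l + \<delta>) *\<^sub>R k"
    show "star ?k = ?k" by (simp add: star_scaleR k)
    have "?k * ?k = (l + \<delta>) *\<^sub>R (1 - z)" using l0 \<open>\<delta> > 0\<close> by (simp add: k)
    also have "\<dots> = h + of_real \<delta>"
      using l0 \<open>\<delta> > 0\<close> by (simp add: z_def scaleR_diff_right) (simp add: of_real_def algebra_simps)
    finally show "?k * ?k = h + of_real \<delta>" .
    show "w * ?k = ?k * w" if "w * h = h * w" for w
    proof -
      have "w * z = z * w"
        by (simp add: z_def algebra_simps that of_real_def)
      from k(3)[OF this] show ?thesis by simp
    qed
  qed
qed

text \<open>Iterates the C*-identity; it plays the role of the spectral radius formula in
  \<open>spectral_pos_swap\<close>.\<close>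

lemma norm_power_pow2:
  fixes w :: "'a::unital_cstar_algebra"
  assumes "star w = w"
  shows "norm (w ^ (2 ^ j)) = norm w ^ (2 ^ j)"
proof (induction j)
  case (Suc j)
  have "star (w ^ (2 ^ j)) = w ^ (2 ^ j)" by (simp add: star_power assms)
  from norm_square_selfadjoint[OF this] show ?case
    by (simp add: power2_eq_square[symmetric] Suc power_mult[symmetric] mult.commute)
qed simp

text \<open>For \<open>x > 1\<close> the left side would grow exponentially in \<open>2 ^ j\<close>,
  the right side only linearly.\<close>

lemma le_1_if_powers_linear:
  fixes x C :: real
  assumes "0 \<le> x" "\<And>j::nat. x ^ (2 ^ j) \<le> 1 + C * 2 ^ j"
  shows "x \<le> 1"
proof (rule ccontr)
  assume "\<not> x \<le> 1"
  define d where "d = x - 1"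
  have d: "d > 0" using \<open>\<not> x \<le> 1\<close> by (simp add: d_def)
  obtain j :: nat where j: "2 * C / d\<^sup>2 < 2 ^ j" using real_arch_pow[of 2 "2 * C / d\<^sup>2"] by auto
  define M where "M = (2::nat) ^ j"
  \<comment> \<open>Bernoulli's bound is linear in \<open>M\<close>; squaring it, which passes from
    \<open>j\<close> to the next exponent, makes it quadratic and so beats the right side.\<close>
  have "1 + real M * d \<le> (1 + d) ^ M" using d Bernoulli_inequality[of d M] by simp
  then have "(1 + real M * d)\<^sup>2 \<le> (x ^ M)\<^sup>2" using d by (intro power_mono) (auto simp: d_def)
  also have "(x ^ M)\<^sup>2 = x ^ (2 ^ Suc j)" by (simp add: M_def power_mult[symmetric] mult.commute)
  also have "\<dots> \<le> 1 + real M * (2 * C)" using assms(2)[of "Suc j"] by (simp add: M_def mult_ac)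
  finally have "1 + 2 * (real M * d) + (real M * d)\<^sup>2 \<le> 1 + real M * (2 * C)"
    by (simp add: power2_sum)
  moreover have "0 \<le> real M * d" using d by simp
  ultimately have "(real M * d)\<^sup>2 \<le> real M * (2 * C)" by linarith
  then have "real M * (real M * d\<^sup>2) \<le> real M * (2 * C)"
    by (simp add: power_mult_distrib power2_eq_square mult_ac)
  moreover have "M > 0" by (simp add: M_def)
  ultimately have "real M * d\<^sup>2 \<le> 2 * C" by simp
  moreover have "2 * C < real M * d\<^sup>2" using j d by (simp add: M_def field_simps)
  ultimately show False by simp
qed

text \<open>This replaces the fact that \<open>x y\<close> and \<open>y x\<close> have the same nonzero spectrum.\<close>

lemma spectral_pos_swap:
  fixes y :: "'a::unital_cstar_algebra"
  assumes "spectral_pos (y * star y + of_real \<kappa>)" "\<kappa> \<ge> 0"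
  shows "spectral_pos (star y * y + of_real \<kappa>)"
proof -
  define g where "g = star y * y"
  define g' where "g' = y * star y"
  from assms(1) obtain l0 where l0: "norm (of_real l0 - (g' + of_real \<kappa>)) \<le> l0"
    by (auto simp: spectral_pos_def g'_def)
  \<comment> \<open>Large enough that \<open>\<mu> = l - \<kappa>\<close> lies between 0 and
    \<open>l\<close> and that division by \<open>l\<close> is possible.\<close>
  define l where "l = \<bar>l0\<bar> + \<kappa> + 1"
  have l: "norm (of_real l - (g' + of_real \<kappa>)) \<le> l" "l > 0" "\<kappa> \<le> l"
    using spectral_pos_mono[OF l0, of l] assms(2) by (auto simp: l_def)
  define \<mu> where "\<mu> = l - \<kappa>"
  have \<mu>: "0 \<le> \<mu>" "\<mu> \<le> l" using l assms(2) by (auto simp: \<mu>_def)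
  have g': "norm (of_real \<mu> - g') \<le> l" using l(1) by (simp add: \<mu>_def algebra_simps)
  \<comment> \<open>Since \<open>y * g = g' * y\<close>, factors \<open>\<mu> - g\<close> can be
    moved past \<open>y\<close>, where they become factors \<open>\<mu> - g'\<close> of norm at most
    \<open>l\<close>. Apart from the scalar term the powers therefore grow like \<open>l ^ M\<close>
    up to a factor linear in \<open>M\<close>, which \<open>le_1_if_powers_linear\<close>
    removes.\<close>
  have ex: "\<exists>f. (of_real \<mu> - g) ^ M = of_real (\<mu> ^ M) - star y * f * y \<and> norm f * l \<le> real M * l ^ M" for M
  proof (induction M)
    case 0
    show ?case by (rule exI[of _ 0]) simp
  next
    case (Suc M)
    then obtain f where f: "(of_real \<mu> - g) ^ M = of_real (\<mu> ^ M) - star y * f * y"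
      "norm f * l \<le> real M * l ^ M" by blast
    let ?f = "of_real (\<mu> ^ M) + f * (of_real \<mu> - g')"
    have comm: "of_real r * a = a * of_real r" for r and a :: 'a
      by (simp add: of_real_def)
    have "(of_real \<mu> - g) ^ Suc M = (of_real (\<mu> ^ M) - star y * f * y) * (of_real \<mu> - g)"
      by (simp only: power_Suc2 f(1))
    also have "\<dots> = of_real (\<mu> ^ Suc M) - star y * ?f * y"
      by (simp add: algebra_simps g_def g'_def comm) (simp add: of_real_def algebra_simps)
    finally have 1: "(of_real \<mu> - g) ^ Suc M = of_real (\<mu> ^ Suc M) - star y * ?f * y" .
    have "norm ?f \<le> \<mu> ^ M + norm f * l"
    proof -
      have "norm ?f \<le> norm (of_real (\<mu> ^ M) :: 'a) + norm (f * (of_real \<mu> - g'))"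
        by (rule norm_triangle_ineq)
      also have "norm (of_real (\<mu> ^ M) :: 'a) = \<mu> ^ M" using \<mu> by (simp del: of_real_power)
      also have "norm (f * (of_real \<mu> - g')) \<le> norm f * l"
        by (rule order_trans[OF norm_mult_ineq]) (simp add: g' mult_left_mono)
      finally show ?thesis by simp
    qed
    also have "\<dots> \<le> l ^ M + real M * l ^ M"
      using f(2) power_mono[OF \<mu>(2,1), of M] by linarith
    finally have "norm ?f * l \<le> (l ^ M + real M * l ^ M) * l" using l by simp
    then have "norm ?f * l \<le> real (Suc M) * l ^ Suc M" by (simp add: algebra_simps)
    with 1 show ?case by blast
  qed
  define w where "w = of_real \<mu> - g"
  have w: "star w = w" by (simp add: w_def g_def star_diff star_mult star_star)
  define C where "C = norm y * norm y / l"
  have "(norm w / l) ^ (2 ^ j) \<le> 1 + C * 2 ^ j" for j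
  proof -
    define M where "M = (2::nat) ^ j"
    obtain f where f: "w ^ M = of_real (\<mu> ^ M) - star y * f * y" "norm f * l \<le> real M * l ^ M"
      using ex[of M] by (auto simp: w_def)
    have "norm w ^ M = norm (w ^ M)" using norm_power_pow2[OF w, of j] by (simp add: M_def)
    also have "\<dots> \<le> norm (of_real (\<mu> ^ M) :: 'a) + norm (star y * f * y)"
      unfolding f(1) by (rule norm_triangle_ineq4)
    also have "norm (of_real (\<mu> ^ M) :: 'a) = \<mu> ^ M" using \<mu> by (simp del: of_real_power)
    also have "norm (star y * f * y) \<le> norm y * norm f * norm y"
      by (metis norm_mult_ineq norm_star mult_right_mono norm_ge_zero order_trans)
    also have "\<mu> ^ M \<le> l ^ M" using \<mu> by (simp add: power_mono)
    also have "norm y * norm f * norm y \<le> norm y * norm y * (real M * l ^ M / l)"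
    proof -
      have "norm f \<le> real M * l ^ M / l" using f(2) l by (simp add: pos_le_divide_eq)
      from mult_left_mono[OF this, of "norm y * norm y"] show ?thesis by (simp add: mult_ac)
    qed
    finally have "norm w ^ M \<le> l ^ M * (1 + C * M)" by (simp add: C_def algebra_simps)
    then show ?thesis using l by (simp add: M_def power_divide field_simps)
  qed
  then have "norm w / l \<le> 1" using l by (intro le_1_if_powers_linear[of _ C]) auto
  then have "norm w \<le> l" using l by simp
  then have "norm (of_real l - (g + of_real \<kappa>)) \<le> l" by (simp add: w_def \<mu>_def algebra_simps)
  then show ?thesis by (auto simp: spectral_pos_def g_def star_add star_mult star_star)
qed

lemma geometric_telescope: "(1 - v) * (\<Sum>i<L. v ^ i) = 1 - (v::'b::ring_1) ^ L"
proof (induction L)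
  case (Suc L)
  have "(1 - v) * (\<Sum>i<Suc L. v ^ i) = (1 - v) * (\<Sum>i<L. v ^ i) + (1 - v) * v ^ L"
    by (simp add: distrib_left)
  also have "\<dots> = 1 - v ^ Suc L" unfolding Suc by (simp add: left_diff_distrib)
  finally show ?case .
qed simp

text \<open>An algebraic certificate of the scalar bound
  \<open>(L + 1) * v ^ L * (1 - v) \<le> 1\<close> on the unit interval: the right side is visibly
  positive once the powers of \<open>v\<close> are. It serves both the C*-algebra and the matrix
  ring introduced later.\<close>

lemma weighted_power_identity:
  fixes v :: "'b::real_algebra_1"
  shows "1 - real (Suc L) *\<^sub>R (v ^ L * (1 - v)) =
    v ^ Suc L + (\<Sum>i<L. real (Suc i) *\<^sub>R ((1 - v) * v ^ i * (1 - v)))"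
proof (induction L)
  case (Suc L)
  have c: "v ^ L * v = v * v ^ L" "v ^ L * (v * x) = v * (v ^ L * x)" for x
    by (simp_all add: power_commutes mult.assoc[symmetric])
  have "1 - real (Suc (Suc L)) *\<^sub>R (v ^ Suc L * (1 - v)) =
    (1 - real (Suc L) *\<^sub>R (v ^ L * (1 - v))) - v ^ Suc L + v ^ Suc (Suc L)
      + real (Suc L) *\<^sub>R ((1 - v) * v ^ L * (1 - v))"
    by (simp add: algebra_simps c scaleR_2)
  then show ?case unfolding Suc by simp
qed simp

text \<open>Scale to \<open>norm x < 1\<close> and let \<open>v = 1 - x\<^sup>* x\<close> and \<open>y = x v\<^sup>M\<close>. Then \<open>y\<^sup>* y = v\<^bsup>2M\<^esup> (1 - v)\<close> is at most a small \<open>\<tau>\<close>, and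
  \<open>y y\<^sup>* + y\<^sup>* y\<close> is a sum of selfadjoint squares, so that \<open>y y\<^sup>* + \<tau>\<close> is positive. Hence so is
  \<open>y\<^sup>* y + \<tau>\<close>, which differs from \<open>x\<^sup>* x + \<tau>\<close> by the positive elements \<open>(1 - v) v\<^sup>i (1 - v)\<close>.\<close>

lemma spectral_pos_star_mult_self:
  fixes x :: "'a::unital_cstar_algebra"
  assumes "\<kappa> > 0"
  shows "spectral_pos (star x * x + of_real \<kappa>)"
proof -
  have small: "spectral_pos (star x * x + of_real \<kappa>)" if x: "norm x < 1" and \<kappa>: "\<kappa> > 0"
    for x :: 'a and \<kappa> :: real
  proof -
    obtain L0 :: nat where L0: "1 / \<kappa> < real L0" using reals_Archimedean2 by blast
    define M where "M = L0"
    \<comment> \<open>Even, so that \<open>y = x * v ^ M\<close> carries half of the power;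
      \<open>weighted_power_identity\<close> then bounds \<open>star y * y\<close> by
      \<open>\<tau> = 1 / (L + 1)\<close>.\<close>
    define L where "L = 2 * M"
    define \<tau> where "\<tau> = 1 / real (Suc L)"
    have \<tau>: "\<tau> > 0" "\<tau> \<le> \<kappa>" using L0 \<kappa> by (auto simp: \<tau>_def L_def M_def field_simps)
    define b where "b = star x * x"
    have b: "star b = b" "norm b < 1"
      using x by (simp_all add: b_def star_mult star_star cstar_identity power_less_one_iff abs_square_less_1)
    define v where "v = 1 - b"
    obtain k where k: "star k = k" "k * k = v" "\<And>w. w * b = b * w \<Longrightarrow> w * k = k * w"
      using sqrt_one_minus[OF b] unfolding v_def by metis
    have v: "star v = v" by (simp add: v_def star_diff b)
    have vk: "(1 - v) * k = k * (1 - v)" using k(3)[of b] by (simp add: v_def)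
    have vi: "v ^ i = k ^ i * k ^ i" for i
      by (simp add: k(2)[symmetric] power2_eq_square[symmetric] power_mult[symmetric] mult.commute)
    have pw: "spectral_pos (v ^ i)" for i
      unfolding vi by (rule spectral_pos_square) (simp add: star_power k)
    have pq: "spectral_pos ((1 - v) * v ^ i * (1 - v))" for i
    proof -
      have c: "(1 - v) * k ^ i = k ^ i * (1 - v)" using power_commuting_commutes[OF vk[symmetric]] by simp
      have "(1 - v) * v ^ i * (1 - v) = ((1 - v) * k ^ i) * ((1 - v) * k ^ i)"
        unfolding vi by (simp add: mult.assoc) (simp add: mult.assoc[symmetric] c)
      then show ?thesis
        by (simp add: spectral_pos_square star_mult star_power star_diff v k c)
    qed
    define y where "y = x * v ^ M"
    have yy: "star y * y = v ^ L * (1 - v)"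
    proof -
      have "star y * y = v ^ M * (1 - v) * v ^ M"
        by (simp add: y_def star_mult star_power v mult.assoc) (simp add: v_def b_def mult.assoc)
      also have "(1 - v) * v ^ M = v ^ M * (1 - v)" by (simp add: algebra_simps power_commutes)
      then have "v ^ M * (1 - v) * v ^ M = v ^ L * (1 - v)"
        by (simp add: mult.assoc L_def mult_2 power_add)
      finally show ?thesis .
    qed
    have "spectral_pos (1 - real (Suc L) *\<^sub>R (v ^ L * (1 - v)))"
      unfolding weighted_power_identity
      by (intro spectral_pos_add pw spectral_pos_sum spectral_pos_scaleR pq) auto
    from spectral_pos_scaleR[OF less_imp_le[OF \<tau>(1)] this]
    have p1: "spectral_pos (of_real \<tau> - star y * y)"
      unfolding yy by (simp add: \<tau>_def scaleR_diff_right of_real_def del: of_nat_Suc)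
    \<comment> \<open>Real and imaginary parts: \<open>y = e + i d\<close>, and the mixed terms
      cancel in \<open>y * star y + star y * y\<close>.\<close>
    define e where "e = (1/2) *\<^sub>R (y + star y)"
    define d where "d = scaleC (\<i>/2) (star y - y)"
    have e: "star e = e" by (simp add: e_def star_scaleR star_add star_star add.commute)
    have d: "star d = d"
      by (simp add: d_def star_scaleC star_diff star_star)
        (metis minus_diff_eq scaleC_minus_left scaleC_minus_right)
    have "2 *\<^sub>R (e * e) + 2 *\<^sub>R (d * d) = y * star y + star y * y"
    proof -
      have i4: "\<i> / 2 * (\<i> / 2) = - 1 / 4" by (simp add: complex_eq_iff)
      have "d * d = (-1/4) *\<^sub>R ((star y - y) * (star y - y))"
        by (simp add: d_def scaleC_mult_left scaleC_mult_right scaleC_scaleC i4 scaleR_scaleC)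
      moreover have "e * e = (1/4) *\<^sub>R ((y + star y) * (y + star y))" by (simp add: e_def)
      ultimately have "2 *\<^sub>R (e * e) + 2 *\<^sub>R (d * d) = (1/2) *\<^sub>R (((y + star y) * (y + star y)) - ((star y - y) * (star y - y)))"
        by (simp add: scaleR_diff_right)
      also have "\<dots> = (1/2) *\<^sub>R (2 *\<^sub>R (y * star y + star y * y))"
        by (simp add: algebra_simps scaleR_2)
      finally show ?thesis by simp
    qed
    then have "y * star y + of_real \<tau> = 2 *\<^sub>R (e * e) + 2 *\<^sub>R (d * d) + (of_real \<tau> - star y * y)"
      by simp
    moreover have "spectral_pos \<dots>"
      by (intro spectral_pos_add spectral_pos_scaleR spectral_pos_square e d p1) auto
    ultimately have "spectral_pos (y * star y + of_real \<tau>)" by (simp only:)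
    then have p2: "spectral_pos (v ^ L * (1 - v) + of_real \<tau>)"
      using spectral_pos_swap[of y \<tau>] \<tau> by (simp add: yy)
    have "(1 - v ^ L) * (1 - v) = (\<Sum>i<L. (1 - v) * v ^ i * (1 - v))"
      by (simp add: geometric_telescope[symmetric] sum_distrib_left sum_distrib_right mult.assoc)
    then have "b + of_real \<kappa> = (v ^ L * (1 - v) + of_real \<tau>) + (\<Sum>i<L. (1 - v) * v ^ i * (1 - v)) + of_real (\<kappa> - \<tau>)"
      by (simp add: algebra_simps) (simp add: v_def algebra_simps)
    moreover have "spectral_pos \<dots>"
      by (intro spectral_pos_add spectral_pos_sum p2 pq spectral_pos_of_real) (use \<tau> in auto)
    ultimately show ?thesis by (simp add: b_def)
  qed
  define s where "s = norm x + 1"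
  have s: "s > 0" unfolding s_def by (rule add_nonneg_pos) auto
  have "spectral_pos (star ((1/s) *\<^sub>R x) * ((1/s) *\<^sub>R x) + of_real (\<kappa> / s\<^sup>2))"
    by (rule small) (use s assms in \<open>auto simp: s_def divide_simps\<close>)
  from spectral_pos_scaleR[OF zero_le_power2[of s] this] s show ?thesis
    by (simp add: star_scaleR scaleR_add_right power2_eq_square of_real_def)
qed

text \<open>The shape in which a diagonal entry of a Gram matrix \<open>adj y * y\<close> presents
  itself, as in \<open>pos_mk_sum_of_squares\<close>.\<close>

definition sum_of_squares :: "'a::unital_cstar_algebra \<Rightarrow> bool" where
  "sum_of_squares h \<longleftrightarrow> (\<exists>(r::nat) x. h = (\<Sum>l<r. star (x l) * x l))"

lemma spectral_pos_sum_of_squares: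
  assumes "sum_of_squares h" "\<kappa> > 0"
  shows "spectral_pos (h + of_real \<kappa>)"
proof -
  from assms obtain r :: nat and x where h: "h = (\<Sum>l<r. star (x l) * x l)"
    by (auto simp: sum_of_squares_def)
  \<comment> \<open>\<open>\<kappa>\<close> is split into \<open>r + 1\<close> equal shares, one for
    each square and a spare one that covers \<open>r = 0\<close>.\<close>
  have "h + of_real \<kappa> = (\<Sum>l<r. star (x l) * x l + of_real (\<kappa> / Suc r)) + of_real (\<kappa> / Suc r)"
  proof -
    have "(\<Sum>l<r. of_real (\<kappa> / Suc r)) + of_real (\<kappa> / Suc r) = (of_real (real r * (\<kappa> / Suc r) + \<kappa> / Suc r) :: 'a)"
      by (simp only: sum_constant card_lessThan of_real_add of_real_mult of_real_of_nat_eq)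
    also have "real r * (\<kappa> / Suc r) + \<kappa> / Suc r = real (Suc r) * (\<kappa> / Suc r)"
      by (simp only: of_nat_Suc distrib_right mult_1 add.commute)
    also have "\<dots> = \<kappa>" by simp
    finally show ?thesis by (simp add: h sum.distrib)
  qed
  moreover have "spectral_pos \<dots>"
    by (intro spectral_pos_add spectral_pos_sum spectral_pos_star_mult_self spectral_pos_of_real)
      (use assms in auto)
  ultimately show ?thesis by simp
qed

text \<open>Sandwiching shows that \<open>2 * (1 - g * g) = (1 + g) * (1 - g) * (1 + g) + (1 - g) *
  (1 + g) * (1 - g)\<close> is made of sums of squares. A square root \<open>k\<close> of
  \<open>1 - g * g + e\<close> then exists and commutes with \<open>g\<close>, so
  \<open>norm_square_le_norm_sum_squares\<close> bounds \<open>(norm g) ^ 2\<close> by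
  \<open>1 + e\<close>.\<close>

lemma norm_le_1_if_sums_of_squares:
  fixes g :: "'a::unital_cstar_algebra"
  assumes g: "star g = g" and s: "sum_of_squares (1 - g)" "sum_of_squares (1 + g)"
  shows "norm g \<le> 1"
proof -
  obtain r :: nat and x where x: "1 - g = (\<Sum>l<r. star (x l) * x l)"
    using s(1) by (auto simp: sum_of_squares_def)
  obtain r' :: nat and x' where x': "1 + g = (\<Sum>l<r'. star (x' l) * x' l)"
    using s(2) by (auto simp: sum_of_squares_def)
  have "sum_of_squares ((1 + g) * (1 - g) * (1 + g))"
    unfolding sum_of_squares_def
    by (rule exI[of _ r], rule exI[of _ "\<lambda>l. x l * (1 + g)"])
      (simp add: x sum_distrib_left sum_distrib_right star_mult star_add g mult.assoc)
  moreover have "sum_of_squares ((1 - g) * (1 + g) * (1 - g))"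
    unfolding sum_of_squares_def
    by (rule exI[of _ r'], rule exI[of _ "\<lambda>l. x' l * (1 - g)"])
      (simp add: x' sum_distrib_left sum_distrib_right star_mult star_diff g mult.assoc)
  ultimately have sp: "spectral_pos ((1 - g * g) + of_real \<kappa>)" if "\<kappa> > 0" for \<kappa>
  proof -
    assume s2: "sum_of_squares ((1 + g) * (1 - g) * (1 + g))" "sum_of_squares ((1 - g) * (1 + g) * (1 - g))"
    have "(1 - g * g) + of_real \<kappa> =
        (1/2) *\<^sub>R (((1 + g) * (1 - g) * (1 + g) + of_real \<kappa>) + ((1 - g) * (1 + g) * (1 - g) + of_real \<kappa>))"
      by (simp add: algebra_simps) (simp add: scaleR_2[symmetric] algebra_simps of_real_def)
    also have "spectral_pos \<dots>"
      by (intro spectral_pos_scaleR spectral_pos_add spectral_pos_sum_of_squares s2 that) simp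
    finally show ?thesis .
  qed
  have "(norm g)\<^sup>2 \<le> 1 + e" if e: "e > 0" for e :: real
  proof -
    from e have e2: "e/2 > 0" by simp
    obtain k where k: "star k = k" "k * k = ((1 - g * g) + of_real (e/2)) + of_real (e/2)"
        "\<And>w. w * ((1 - g * g) + of_real (e/2)) = ((1 - g * g) + of_real (e/2)) * w \<Longrightarrow> w * k = k * w"
      by (rule spectral_pos_sqrt[OF sp[OF e2] e2]) blast
    have "g * k = k * g" by (rule k(3)) (simp add: algebra_simps of_real_def)
    from norm_square_le_norm_sum_squares[OF g k(1) this]
    have "(norm g)\<^sup>2 \<le> norm (g * g + k * k)" .
    also have "g * g + k * k = of_real 1 + (of_real (e/2) + of_real (e/2))"
      by (simp only: k(2) of_real_1) (simp add: algebra_simps)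
    also have "\<dots> = of_real (1 + (e/2 + e/2))" by (simp only: of_real_add)
    finally have "(norm g)\<^sup>2 \<le> \<bar>1 + e\<bar>" unfolding norm_of_real by simp
    then show ?thesis using e by simp
  qed
  then have "(norm g)\<^sup>2 \<le> 1" by (rule field_le_epsilon)
  then show ?thesis by (simp add: abs_square_le_1)
qed

section \<open>Row- and column-finite matrices\<close>

text \<open>One unital ring containing all the algebras \<open>M\<^sub>p(A)\<close> as corners, so that computations with
  matrices of varying size can be carried out by ring simplification.\<close>

definition rcfun :: "(nat \<Rightarrow> nat \<Rightarrow> 'a::zero) \<Rightarrow> bool" where
  "rcfun f \<longleftrightarrow> (\<forall>n. \<exists>N. \<forall>i<n. \<forall>j\<ge>N. f i j = 0 \<and> f j i = 0)"

lemma rcfun_combine: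
  assumes "rcfun f" "rcfun g" "\<And>i j. f i j = 0 \<Longrightarrow> g i j = 0 \<Longrightarrow> h i j = 0"
  shows "rcfun h"
  unfolding rcfun_def
proof
  fix n
  from assms obtain N N' where "\<forall>i<n. \<forall>j\<ge>N. f i j = 0 \<and> f j i = 0" "\<forall>i<n. \<forall>j\<ge>N'. g i j = 0 \<and> g j i = 0"
    unfolding rcfun_def by metis
  then show "\<exists>N. \<forall>i<n. \<forall>j\<ge>N. h i j = 0 \<and> h j i = 0"
    by (intro exI[of _ "max N N'"]) (simp add: assms(3))
qed

lemma rcfun_mult:
  fixes f g :: "nat \<Rightarrow> nat \<Rightarrow> 'a::semiring_0"
  assumes *: "rcfun f" "rcfun g"
  shows "rcfun (\<lambda>i j. \<Sum>k | f i k \<noteq> 0. f i k * g k j)"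
  unfolding rcfun_def
proof
  fix n
  from * obtain N1 N2 where 1: "\<forall>i<n. \<forall>j\<ge>N1. f i j = 0" "\<forall>i<n. \<forall>j\<ge>N2. g j i = 0"
    unfolding rcfun_def by metis
  from * obtain N3 N4 where 2: "\<forall>i<N1. \<forall>j\<ge>N3. g i j = 0" "\<forall>i<N2. \<forall>j\<ge>N4. f j i = 0"
    unfolding rcfun_def by metis
  have a: "f i k * g k j = 0" if "i < n" "j \<ge> max N3 N4" for i j k
    using 1(1)[rule_format, of i k] 2(1)[rule_format, of k j] that by (cases "k < N1") auto
  have b: "f j k * g k i = 0" if "i < n" "j \<ge> max N3 N4" for i j k
    using 1(2)[rule_format, of i k] 2(2)[rule_format, of k j] that by (cases "k < N2") auto
  show "\<exists>N. \<forall>i<n. \<forall>j\<ge>N. (\<Sum>k | f i k \<noteq> 0. f i k * g k j) = 0 \<and> (\<Sum>k | f j k \<noteq> 0. f j k * g k i) = 0"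
    by (intro exI[of _ "max N3 N4"]) (simp add: a b)
qed

text \<open>The factor \<open>r\<close> is there for \<open>stretch\<close>, whose support lies on a
  line of slope 2.\<close>

lemma rcfun_if_bounded: "(\<And>i j. f i j \<noteq> 0 \<Longrightarrow> i \<le> r * j + s \<and> j \<le> r * i + s) \<Longrightarrow> rcfun f"
  unfolding rcfun_def
proof
  fix n
  assume *: "\<And>i j. f i j \<noteq> 0 \<Longrightarrow> i \<le> r * j + s \<and> j \<le> r * i + s"
  have "f i j = 0 \<and> f j i = 0" if "i < n" "j \<ge> Suc (r * n + s)" for i j
  proof -
    have "r * i \<le> r * n" using that by simp
    then have "r * i + s < j" using that by linarith
    then show ?thesis using *[of i j] *[of j i] by force
  qed
  then show "\<exists>N. \<forall>i<n. \<forall>j\<ge>N. f i j = 0 \<and> f j i = 0" by blast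
qed

typedef (overloaded) ('a::unital_cstar_algebra) rcf = "{f :: nat \<Rightarrow> nat \<Rightarrow> 'a. rcfun f}"
  morphisms ent Abs_rcf
  by (rule exI[of _ "\<lambda>i j. 0"]) (simp add: rcfun_def)

setup_lifting type_definition_rcf

lemma rcf_eqI: "(\<And>i j. ent f i j = ent g i j) \<Longrightarrow> f = g"
  by (simp add: ent_inject[symmetric] fun_eq_iff)

lemma ent_bound: "\<exists>N. \<forall>i<n. \<forall>j\<ge>N. ent f i j = 0 \<and> ent f j i = 0"
  using ent[of f] by (simp add: rcfun_def)

lemma ent_row_bound: "\<exists>N. \<forall>j\<ge>N. ent f i j = 0"
  using ent_bound[of "Suc i" f] by blast

lemma ent_col_bound: "\<exists>N. \<forall>i\<ge>N. ent f i j = 0"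
  using ent_bound[of "Suc j" f] by blast

instantiation rcf :: (unital_cstar_algebra) real_algebra_1
begin

lift_definition zero_rcf :: "'a rcf" is "\<lambda>i j. 0" by (simp add: rcfun_def)

lift_definition one_rcf :: "'a rcf" is "\<lambda>i j. if i = j then 1 else 0"
  by (rule rcfun_if_bounded[of _ 1 0]) (auto split: if_splits)

lift_definition plus_rcf :: "'a rcf \<Rightarrow> 'a rcf \<Rightarrow> 'a rcf" is "\<lambda>f g i j. f i j + g i j"
  by (erule (1) rcfun_combine) simp

lift_definition uminus_rcf :: "'a rcf \<Rightarrow> 'a rcf" is "\<lambda>f i j. - f i j"
  by (simp add: rcfun_def)

lift_definition minus_rcf :: "'a rcf \<Rightarrow> 'a rcf \<Rightarrow> 'a rcf" is "\<lambda>f g i j. f i j - g i j"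
  by (erule (1) rcfun_combine) simp

lift_definition scaleR_rcf :: "real \<Rightarrow> 'a rcf \<Rightarrow> 'a rcf" is "\<lambda>r f i j. r *\<^sub>R f i j"
  by (rule rcfun_combine) auto

text \<open>Row-finiteness makes the index set finite; \<open>ent_mult\<close> later replaces it by
  any sufficiently long initial segment.\<close>

lift_definition times_rcf :: "'a rcf \<Rightarrow> 'a rcf \<Rightarrow> 'a rcf" is
  "\<lambda>f g i j. \<Sum>k | f i k \<noteq> 0. f i k * g k j"
  by (rule rcfun_mult)

lemma ent_mult:
  assumes "\<And>k. k \<ge> N \<Longrightarrow> ent f i k = 0 \<or> ent g k j = 0"
  shows "ent (f * g) i j = (\<Sum>k<N. ent f i k * ent g k j)"
proof -
  obtain N' where N': "\<And>k. k \<ge> N' \<Longrightarrow> ent f i k = 0" using ent_row_bound by blast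
  have "k < N'" if "ent f i k \<noteq> 0" for k
    using N'[of k] that by (cases "k < N'") auto
  then have fin: "finite {k. ent f i k \<noteq> 0}"
    by (auto intro: finite_subset[of _ "{..<N'}", OF _ finite_lessThan])
  have z: "ent f i k * ent g k j = 0" if "\<not> k < N" for k
    using assms[of k] that by auto
  have "ent (f * g) i j = (\<Sum>k | ent f i k \<noteq> 0. ent f i k * ent g k j)"
    by (rule times_rcf.rep_eq[THEN fun_cong, THEN fun_cong])
  also have "\<dots> = (\<Sum>k\<in>{k. ent f i k \<noteq> 0} \<union> {..<N}. ent f i k * ent g k j)"
    by (rule sum.mono_neutral_left) (use fin in auto)
  also have "\<dots> = (\<Sum>k<N. ent f i k * ent g k j)"
    by (rule sum.mono_neutral_right) (use fin z in auto)
  finally show ?thesis .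
qed

instance
proof
  fix a b c :: "'a rcf" and r s :: real
  show "a + b + c = a + (b + c)" by transfer (simp add: add.assoc)
  show "a + b = b + a" by transfer (simp add: add.commute)
  show "0 + a = a" by transfer simp
  show "- a + a = 0" by transfer simp
  show "a - b = a + - b" by transfer simp
  show "r *\<^sub>R (a + b) = r *\<^sub>R a + r *\<^sub>R b" by transfer (simp add: scaleR_add_right)
  show "(r + s) *\<^sub>R a = r *\<^sub>R a + s *\<^sub>R a" by transfer (simp add: scaleR_add_left)
  show "r *\<^sub>R s *\<^sub>R a = (r * s) *\<^sub>R a" by transfer simp
  show "1 *\<^sub>R a = a" by transfer simp
  show "(0 :: 'a rcf) \<noteq> 1" by transfer (auto simp: fun_eq_iff)
  show "a * b * c = a * (b * c)"
  proof (rule rcf_eqI)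
    fix i j
    obtain N1 where N1: "\<And>k. k \<ge> N1 \<Longrightarrow> ent a i k = 0" using ent_row_bound by blast
    obtain N2 where N2: "\<And>k. k \<ge> N2 \<Longrightarrow> ent c k j = 0" using ent_col_bound by blast
    have "ent (a * b * c) i j = (\<Sum>l<N2. ent (a * b) i l * ent c l j)"
      by (rule ent_mult) (simp add: N2)
    also have "\<dots> = (\<Sum>l<N2. (\<Sum>k<N1. ent a i k * ent b k l) * ent c l j)"
      by (simp add: ent_mult[of N1 a] N1)
    also have "\<dots> = (\<Sum>k<N1. ent a i k * (\<Sum>l<N2. ent b k l * ent c l j))"
      by (simp add: sum_distrib_left sum_distrib_right mult.assoc) (rule sum.swap)
    also have "\<dots> = (\<Sum>k<N1. ent a i k * ent (b * c) k j)"
      by (simp add: ent_mult[of N2 b] N2)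
    also have "\<dots> = ent (a * (b * c)) i j"
      by (rule ent_mult[symmetric]) (simp add: N1)
    finally show "ent (a * b * c) i j = ent (a * (b * c)) i j" .
  qed
  show "1 * a = a"
  proof (rule rcf_eqI)
    fix i j
    show "ent (1 * a) i j = ent a i j"
      by (subst ent_mult[of "Suc i"]) (auto simp: one_rcf.rep_eq)
  qed
  show "a * 1 = a"
  proof (rule rcf_eqI)
    fix i j
    show "ent (a * 1) i j = ent a i j"
      by (subst ent_mult[of "Suc j"]) (auto simp: one_rcf.rep_eq)
  qed
  show "(a + b) * c = a * c + b * c"
  proof (rule rcf_eqI)
    fix i j
    obtain N where N: "\<And>k. k \<ge> N \<Longrightarrow> ent c k j = 0" using ent_col_bound by blast
    show "ent ((a + b) * c) i j = ent (a * c + b * c) i j"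
      by (simp add: plus_rcf.rep_eq ent_mult[of N] N sum.distrib distrib_right)
  qed
  show "a * (b + c) = a * b + a * c"
  proof (rule rcf_eqI)
    fix i j
    obtain N where N: "\<And>k. k \<ge> N \<Longrightarrow> ent a i k = 0" using ent_row_bound by blast
    show "ent (a * (b + c)) i j = ent (a * b + a * c) i j"
      by (simp add: plus_rcf.rep_eq ent_mult[of N] N sum.distrib distrib_left)
  qed
  show "r *\<^sub>R a * b = r *\<^sub>R (a * b)"
  proof (rule rcf_eqI)
    fix i j
    obtain N where N: "\<And>k. k \<ge> N \<Longrightarrow> ent a i k = 0" using ent_row_bound by blast
    show "ent (r *\<^sub>R a * b) i j = ent (r *\<^sub>R (a * b)) i j"
      by (simp add: scaleR_rcf.rep_eq ent_mult[of N] N scaleR_sum_right)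
  qed
  show "a * r *\<^sub>R b = r *\<^sub>R (a * b)"
  proof (rule rcf_eqI)
    fix i j
    obtain N where N: "\<And>k. k \<ge> N \<Longrightarrow> ent a i k = 0" using ent_row_bound by blast
    show "ent (a * r *\<^sub>R b) i j = ent (r *\<^sub>R (a * b)) i j"
      by (simp add: scaleR_rcf.rep_eq ent_mult[of N] N scaleR_sum_right)
  qed
qed

end

lemmas ent_simps [simp] = zero_rcf.rep_eq one_rcf.rep_eq plus_rcf.rep_eq uminus_rcf.rep_eq
  minus_rcf.rep_eq scaleR_rcf.rep_eq

lemma ent_sum: "ent (sum f A) i j = (\<Sum>a\<in>A. ent (f a) i j)"
  by (induction A rule: infinite_finite_induct) simp_all

section \<open>Adjoints, corners and Gram positivity\<close>

context
  fixes dummy :: "'a::unital_cstar_algebra"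
begin

lift_definition adj :: "'a rcf \<Rightarrow> 'a rcf" is "\<lambda>f i j. star (f j i)"
  unfolding rcfun_def by (metis star_0)

lift_definition mk :: "nat \<Rightarrow> nat \<Rightarrow> 'a \<Rightarrow> 'a rcf" is "\<lambda>i j a k l. if k = i \<and> l = j then a else 0"
proof -
  fix i j :: nat and a :: 'a
  show "rcfun (\<lambda>k l. if k = i \<and> l = j then a else 0)"
    by (rule rcfun_if_bounded[of _ 0 "max i j"]) (auto split: if_splits)
qed

lift_definition block :: "nat \<Rightarrow> (nat \<Rightarrow> nat \<Rightarrow> 'a) \<Rightarrow> 'a rcf" is
  "\<lambda>N f i j. if i < N \<and> j < N then f i j else 0"
proof -
  fix N :: nat and f :: "nat \<Rightarrow> nat \<Rightarrow> 'a"
  show "rcfun (\<lambda>i j. if i < N \<and> j < N then f i j else 0)"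
    by (rule rcfun_if_bounded[of _ 0 N]) (auto split: if_splits)
qed

lift_definition corner :: "nat \<Rightarrow> 'a rcf" is "\<lambda>N i j. if i = j \<and> i < N then 1 else 0"
  by (rule rcfun_if_bounded[of _ 1 0]) (auto split: if_splits)

text \<open>For \<open>r = 0\<close> and \<open>r = 1\<close> these are the isometries onto the even
  and the odd coordinates.\<close>

lift_definition stretch :: "nat \<Rightarrow> 'a rcf" is "\<lambda>r i j. if i = 2 * j + r then 1 else 0"
proof -
  fix r :: nat
  show "rcfun (\<lambda>i j. if i = 2 * j + r then 1 else (0::'a))"
    by (rule rcfun_if_bounded[of _ 2 r]) (auto split: if_splits)
qed

text \<open>\<open>y\<close> may have rows beyond any given corner, so a positive element of a
  corner is a Gram matrix of columns of arbitrary finite length. This is what makes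
  \<open>pos\<close> closed under sums.\<close>

definition pos :: "'a rcf \<Rightarrow> bool" where
  "pos h \<longleftrightarrow> (\<exists>y. h = adj y * y)"

end

lemmas ent_simps' [simp] = adj.rep_eq mk.rep_eq block.rep_eq corner.rep_eq stretch.rep_eq

lemma adj_adj [simp]: "adj (adj f) = f"
  by (rule rcf_eqI) (simp add: star_star)

lemma adj_0 [simp]: "adj 0 = 0"
  by (rule rcf_eqI) simp

lemma adj_1 [simp]: "adj 1 = 1"
  by (rule rcf_eqI) simp

lemma adj_add: "adj (f + g) = adj f + adj g"
  by (rule rcf_eqI) (simp add: star_add)

lemma adj_minus: "adj (- f) = - adj f"
  by (rule rcf_eqI) (simp add: star_minus)

lemma adj_diff: "adj (f - g) = adj f - adj g"
  by (rule rcf_eqI) (simp add: star_diff)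

lemma adj_scaleR: "adj (r *\<^sub>R f) = r *\<^sub>R adj f"
  by (rule rcf_eqI) (simp add: star_scaleR)

lemma adj_sum: "adj (sum f A) = (\<Sum>a\<in>A. adj (f a))"
  by (induction A rule: infinite_finite_induct) (simp_all add: adj_add)

lemma adj_mult: "adj (f * g) = adj g * adj f"
proof (rule rcf_eqI)
  fix i j
  obtain N where N: "\<And>k. k \<ge> N \<Longrightarrow> ent f j k = 0" using ent_row_bound by blast
  show "ent (adj (f * g)) i j = ent (adj g * adj f) i j"
    by (simp add: ent_mult[of N] N star_sum star_mult)
qed

lemma adj_power: "adj (f ^ n) = adj f ^ n"
  by (induction n) (simp_all add: adj_mult power_commutes)

lemma adj_mk [simp]: "adj (mk i j a) = mk j i (star a)"
  by (rule rcf_eqI) auto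

lemma adj_corner [simp]: "adj (corner N) = corner N"
  by (rule rcf_eqI) auto

lemma ent_corner_mult [simp]: "ent (corner N * f) i j = (if i < N then ent f i j else 0)"
  by (subst ent_mult[of "Suc i"]) (auto intro!: sum.neutral)

lemma ent_mult_corner [simp]: "ent (f * corner N) i j = (if j < N then ent f i j else 0)"
  by (subst ent_mult[of "Suc j"]) (auto intro!: sum.neutral)

lemma corner_mult_self [simp]: "corner N * corner N = corner N"
  by (rule rcf_eqI) auto

lemma mk_mult_mk: "mk i j a * mk k l b = (if j = k then mk i l (a * b) else 0)"
proof (rule rcf_eqI)
  fix x y
  show "ent (mk i j a * mk k l b) x y = ent (if j = k then mk i l (a * b) else 0) x y"
    by (subst ent_mult[of "Suc j"]) (auto intro!: sum.neutral)
qed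

lemma mk_add: "mk i j (a + b) = mk i j a + mk i j b"
  by (rule rcf_eqI) simp

lemma mk_diff: "mk i j (a - b) = mk i j a - mk i j b"
  by (rule rcf_eqI) simp

lemma mk_scaleR: "mk i j (r *\<^sub>R a) = r *\<^sub>R mk i j a"
  by (rule rcf_eqI) simp

lemma corner_eq_sum: "corner N = (\<Sum>i<N. mk i i 1)"
  by (rule rcf_eqI) (auto simp: ent_sum intro!: sum.neutral)

lemma corner_compress_eq_sum: "corner N * v * corner N = (\<Sum>i<N. \<Sum>j<N. mk i j (ent v i j))"
proof (rule rcf_eqI)
  fix a b
  have "(\<Sum>i<N. \<Sum>j<N. if a = i \<and> b = j then ent v i j else 0)
      = (\<Sum>i<N. if a = i then (if b < N then ent v i b else 0) else 0)"
    by (rule sum.cong) (auto intro!: sum.neutral)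
  also have "\<dots> = (if a < N \<and> b < N then ent v a b else 0)" by simp
  finally show "ent (corner N * v * corner N) a b = ent (\<Sum>i<N. \<Sum>j<N. mk i j (ent v i j)) a b"
    by (simp add: ent_sum)
qed

lemma adj_stretch_mult_stretch:
  assumes "r < 2" "s < 2"
  shows "adj (stretch r) * stretch s = (if r = s then 1 else 0)"
proof (rule rcf_eqI)
  fix i j
  show "ent (adj (stretch r) * stretch s) i j = ent (if r = s then 1 else 0 :: 'a rcf) i j"
  proof (subst ent_mult[of "Suc (2 * i + r)"])
    show "ent (adj (stretch r :: 'a rcf)) i k = 0 \<or> ent (stretch s :: 'a rcf) k j = 0" if "Suc (2 * i + r) \<le> k" for k
      using that by auto
    have "2 * i + r = 2 * j + s \<longleftrightarrow> i = j \<and> r = s" using assms by presburger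
    moreover have "(\<Sum>k<Suc (2 * i + r). ent (adj (stretch r :: 'a rcf)) i k * ent (stretch s) k j)
       = (\<Sum>k<Suc (2 * i + r). if k = 2 * i + r then (if k = 2 * j + s then 1 else 0) else 0)"
      by (rule sum.cong) auto
    ultimately show "(\<Sum>k<Suc (2 * i + r). ent (adj (stretch r :: 'a rcf)) i k * ent (stretch s) k j)
       = ent (if r = s then 1 else 0 :: 'a rcf) i j"
      by auto
  qed
qed

lemma pos_self: "pos (adj y * y)"
  by (auto simp: pos_def)

lemma pos_square: "adj k = k \<Longrightarrow> pos (k * k)"
  unfolding pos_def by metis

lemma pos_adj: "pos h \<Longrightarrow> adj h = h"
  by (auto simp: pos_def adj_mult)

lemma pos_conj: "pos h \<Longrightarrow> pos (adj x * h * x)"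
  by (auto simp: pos_def adj_mult mult.assoc intro: exI[of _ "_ * x"])

text \<open>The two \<^const>\<open>stretch\<close> isometries have orthogonal ranges, so the rows of the two
  square roots can be interleaved.\<close>

lemma pos_add: "pos g \<Longrightarrow> pos h \<Longrightarrow> pos (g + h)"
proof -
  assume "pos g" "pos h"
  then obtain x y where xy: "g = adj x * x" "h = adj y * y" by (auto simp: pos_def)
  have s: "adj (stretch r) * (stretch s * z) = (if r = s then z else 0)" if "r < 2" "s < 2" for r s and z :: "'a rcf"
    using adj_stretch_mult_stretch[OF that, where 'a = 'a] by (simp add: mult.assoc[symmetric])
  have "adj (stretch 0 * x + stretch 1 * y) * (stretch 0 * x + stretch 1 * y) = g + h"
    by (simp add: adj_add adj_mult distrib_left distrib_right mult.assoc s xy)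
  then show ?thesis by (metis pos_def)
qed

lemma pos_0 [simp]: "pos 0"
  using pos_self[of 0] by simp

lemma pos_1 [simp]: "pos 1"
  using pos_self[of 1] by simp

lemma pos_corner [simp]: "pos (corner N)"
  using pos_self[of "corner N"] by simp

lemma pos_scaleR: "0 \<le> r \<Longrightarrow> pos h \<Longrightarrow> pos (r *\<^sub>R h)"
proof -
  assume r: "0 \<le> r" and "pos h"
  then obtain y where "h = adj y * y" by (auto simp: pos_def)
  then have "r *\<^sub>R h = adj (sqrt r *\<^sub>R y) * (sqrt r *\<^sub>R y)" using r by (simp add: adj_scaleR)
  then show ?thesis by (metis pos_def)
qed

lemma pos_sum: "(\<And>i. i \<in> A \<Longrightarrow> pos (f i)) \<Longrightarrow> pos (sum f A)"
  by (induction A rule: infinite_finite_induct) (simp_all add: pos_add)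

lemma pos_ent:
  assumes "pos h"
  obtains R y where "\<And>i j. i < N \<Longrightarrow> j < N \<Longrightarrow> ent h i j = (\<Sum>l<(R::nat). star (ent y l i) * ent y l j)"
proof -
  from assms obtain y where y: "h = adj y * y" by (auto simp: pos_def)
  obtain R where R: "\<And>i j. i < N \<Longrightarrow> j \<ge> R \<Longrightarrow> ent y j i = 0" using ent_bound[of N y] by blast
  show ?thesis by (rule that[where R = R and y = y]) (simp add: y ent_mult[of R] R)
qed

lemma pos_mk_sum_of_squares: "pos h \<Longrightarrow> sum_of_squares (ent h 0 0)"
  by (rule pos_ent[of h 1]) (auto simp: sum_of_squares_def)

text \<open>The difference is diagonal. Away from \<open>j\<close> it is \<open>\<mu>\<close> times
  a projection; at \<open>j\<close> it is \<open>\<mu> - a\<close>, a square by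
  \<open>sqrt_one_minus\<close> because \<open>norm a < \<mu>\<close>.\<close>

lemma pos_corner_diff_mk:
  assumes "j < N" "star a = a" "norm a < \<mu>"
  shows "pos (\<mu> *\<^sub>R corner N - mk j j a)"
proof -
  have \<mu>: "\<mu> > 0" using assms(3) norm_ge_zero[of a] by linarith
  let ?d = "corner N - mk j j 1"
  have cm: "corner N * mk j j 1 = mk j j 1" "mk j j 1 * corner N = mk j j 1"
    by (rule rcf_eqI, use assms(1) in auto)+
  have dd: "?d * ?d = ?d" by (simp add: left_diff_distrib right_diff_distrib cm mk_mult_mk)
  have "adj ?d = ?d" by (simp add: adj_diff)
  from pos_square[OF this] have 1: "pos ?d" by (simp only: dd)
  have z: "star ((1/\<mu>) *\<^sub>R a) = (1/\<mu>) *\<^sub>R a" "norm ((1/\<mu>) *\<^sub>R a) < 1"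
    using assms \<mu> by (simp_all add: star_scaleR)
  obtain k where k: "star k = k" "k * k = 1 - (1/\<mu>) *\<^sub>R a"
    by (rule sqrt_one_minus[OF z]) blast
  have 2: "pos (mk j j (k * k))"
    using pos_square[of "mk j j k"] by (simp add: k(1) mk_mult_mk)
  have "\<mu> *\<^sub>R corner N - mk j j a = \<mu> *\<^sub>R (?d + mk j j (k * k))"
    using \<mu> by (simp add: k(2) mk_diff mk_scaleR scaleR_add_right scaleR_diff_right)
  also have "pos \<dots>" by (intro pos_scaleR pos_add 1 2) (use \<mu> in simp)
  finally show ?thesis .
qed

text \<open>That is, \<open>corner N\<close> is an order unit for the selfadjoint part of its
  corner. By additivity it suffices to treat one matrix unit, where completing a square leaves only
  diagonal terms.\<close>

lemma ex_pos_scaleR_corner_diff: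
  fixes v :: "'a::unital_cstar_algebra rcf"
  shows "\<exists>l\<ge>0. pos (l *\<^sub>R corner N - corner N * (v + adj v) * corner N)"
proof -
  define S where "S = {v :: 'a rcf. \<exists>l\<ge>0. pos (l *\<^sub>R corner N - (v + adj v))}"
  have add: "v + w \<in> S" if "v \<in> S" "w \<in> S" for v w
  proof -
    from that obtain l m where lm: "l \<ge> 0" "m \<ge> 0" "pos (l *\<^sub>R corner N - (v + adj v))"
      "pos (m *\<^sub>R corner N - (w + adj w))" unfolding S_def by blast
    have eq: "(l + m) *\<^sub>R corner N - (v + w + adj (v + w))
       = (l *\<^sub>R corner N - (v + adj v)) + (m *\<^sub>R corner N - (w + adj w))"
      by (simp add: adj_add algebra_simps)
    have "pos ((l + m) *\<^sub>R corner N - (v + w + adj (v + w)))"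
      unfolding eq by (rule pos_add[OF lm(3,4)])
    then show ?thesis using lm(1,2) unfolding S_def by (intro CollectI exI[of _ "l + m"]) simp
  qed
  have "0 \<in> S" by (auto simp: S_def intro!: exI[of _ 0])
  then have sum: "sum f A \<in> S" if "\<And>i. i \<in> A \<Longrightarrow> f i \<in> S" for f and A :: "nat set"
    using that by (induction A rule: infinite_finite_induct) (auto simp: add)
  have mk: "mk i j x \<in> S" if "i < N" "j < N" for i j x
  proof -
    \<comment> \<open>\<open>pos_corner_diff_mk\<close> wants strict bounds: \<open>\<mu>\<close> is
      used for the entry \<open>star x * x\<close> at \<open>j\<close>, and the constant 2 below for
      the entry 1 at \<open>i\<close>.\<close>
    define \<mu> where "\<mu> = norm (star x * x) + 1"
    let ?w = "mk i i 1 - mk i j x"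
    have "adj ?w * ?w = mk i i 1 - mk i j x - mk j i (star x) + mk j j (star x * x)"
      by (simp add: adj_diff algebra_simps mk_mult_mk)
    then have "(2 + \<mu>) *\<^sub>R corner N - (mk i j x + adj (mk i j x))
      = adj ?w * ?w + (2 *\<^sub>R corner N - mk i i 1) + (\<mu> *\<^sub>R corner N - mk j j (star x * x))"
      by (simp add: scaleR_add_left scaleR_2)
    also have "pos \<dots>"
      by (intro pos_add pos_self pos_corner_diff_mk that) (auto simp: \<mu>_def star_mult star_star)
    finally show ?thesis unfolding S_def by (intro CollectI exI[of _ "2 + \<mu>"]) (simp add: \<mu>_def)
  qed
  have "corner N * v * corner N \<in> S"
    unfolding corner_compress_eq_sum by (intro sum mk) auto
  then obtain l where "l \<ge> 0"
    and l: "pos (l *\<^sub>R corner N - (corner N * v * corner N + adj (corner N * v * corner N)))"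
    unfolding S_def by blast
  have eq: "corner N * v * corner N + adj (corner N * v * corner N) = corner N * (v + adj v) * corner N"
    by (simp only: adj_mult adj_corner distrib_left distrib_right mult.assoc)
  have "pos (l *\<^sub>R corner N - corner N * (v + adj v) * corner N)"
    using l by (simp only: eq)
  with \<open>l \<ge> 0\<close> show ?thesis by (intro exI conjI)
qed

section \<open>Separation from a cone with order unit\<close>

definition convex_cone :: "'b::real_vector set \<Rightarrow> bool" where
  "convex_cone K \<longleftrightarrow> (\<forall>x\<in>K. \<forall>y\<in>K. x + y \<in> K) \<and> (\<forall>x\<in>K. \<forall>r\<ge>0. r *\<^sub>R x \<in> K)"

lemma convex_coneD:
  assumes "convex_cone K"
  shows "x \<in> K \<Longrightarrow> y \<in> K \<Longrightarrow> x + y \<in> K" "x \<in> K \<Longrightarrow> r \<ge> 0 \<Longrightarrow> r *\<^sub>R x \<in> K"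
  using assms by (auto simp: convex_cone_def)

lemma exists_maximal_cone:
  fixes K :: "'b::real_vector set"
  assumes K: "convex_cone K" "K \<noteq> {}" "w \<notin> K"
  obtains C where "K \<subseteq> C" "convex_cone C" "w \<notin> C"
    "\<And>D. C \<subseteq> D \<Longrightarrow> convex_cone D \<Longrightarrow> w \<notin> D \<Longrightarrow> D = C"
proof -
  let ?A = "{C. K \<subseteq> C \<and> convex_cone C \<and> w \<notin> C}"
  have "\<exists>C\<in>?A. \<forall>D\<in>?A. C \<subseteq> D \<longrightarrow> D = C"
  proof (rule subset_Zorn_nonempty)
    show "?A \<noteq> {}" using K by blast
    fix \<C> assume \<C>: "\<C> \<noteq> {}" "subset.chain ?A \<C>"
    have sub: "\<And>C. C \<in> \<C> \<Longrightarrow> K \<subseteq> C \<and> convex_cone C \<and> w \<notin> C"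
      using \<C>(2) by (auto simp: subset.chain_def)
    have tot: "C \<subseteq> D \<or> D \<subseteq> C" if "C \<in> \<C>" "D \<in> \<C>" for C D
      using \<C>(2) that by (auto simp: subset.chain_def)
    have "convex_cone (\<Union>\<C>)"
      unfolding convex_cone_def
    proof (intro conjI ballI allI impI)
      fix x y assume "x \<in> \<Union>\<C>" "y \<in> \<Union>\<C>"
      then obtain C D where CD: "C \<in> \<C>" "D \<in> \<C>" "x \<in> C" "y \<in> D" by blast
      then obtain E where "E \<in> \<C>" "x \<in> E" "y \<in> E" using tot[OF CD(1,2)] by blast
      then show "x + y \<in> \<Union>\<C>" using sub convex_coneD(1) by blast
    next
      fix x and r :: real assume "x \<in> \<Union>\<C>" "r \<ge> 0"
      then show "r *\<^sub>R x \<in> \<Union>\<C>" using sub convex_coneD(2) by blast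
    qed
    then show "\<Union>\<C> \<in> ?A" using sub \<C>(1) by blast
  qed
  then obtain C where C: "C \<in> ?A" and max: "\<forall>D\<in>?A. C \<subseteq> D \<longrightarrow> D = C" by blast
  show ?thesis
  proof (rule that[of C])
    show "D = C" if "C \<subseteq> D" "convex_cone D" "w \<notin> D" for D
      using max C that by blast
  qed (use C in auto)
qed

text \<open>An order-unit form of the Hahn-Banach theorem, without topology. Adjoin the negative of
  \<open>h + \<epsilon> *\<^sub>R e\<close>, extend to a cone maximal among those avoiding
  \<open>- e\<close>, and take the infimum of the \<open>l\<close> with
  \<open>l *\<^sub>R e - v\<close> in that cone. Totality of the maximal cone turns sublinearity
  into linearity.\<close>

lemma separating_functional:
  fixes K :: "'b::real_vector set"
  assumes K: "convex_cone K" and e: "e \<in> K"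
    and unit: "\<And>v. \<exists>l. l *\<^sub>R e - v \<in> K"
    and h: "\<epsilon> > 0" "h + \<epsilon> *\<^sub>R e \<notin> K"
  shows "\<exists>f :: 'b \<Rightarrow> real. linear f \<and> (\<forall>v\<in>K. f v \<ge> 0) \<and> f e = 1 \<and> f h < 0"
proof -
  define g where "g = h + \<epsilon> *\<^sub>R e"
  define K' where "K' = {k - s *\<^sub>R g | k s. k \<in> K \<and> s \<ge> 0}"
  have K0: "0 \<in> K" using convex_coneD(2)[OF K e, of 0] by simp
  have KK': "K \<subseteq> K'" unfolding K'_def by (force intro: exI[of _ 0])
  have gK': "- g \<in> K'" unfolding K'_def using K0 by (force intro: exI[of _ 1])
  have cK': "convex_cone K'"
    unfolding convex_cone_def
  proof (intro conjI ballI allI impI)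
    fix x y assume "x \<in> K'" "y \<in> K'"
    then obtain k s k' s' where "x = k - s *\<^sub>R g" "y = k' - s' *\<^sub>R g" "k \<in> K" "k' \<in> K" "s \<ge> 0" "s' \<ge> 0"
      by (auto simp: K'_def)
    then have "x + y = (k + k') - (s + s') *\<^sub>R g \<and> k + k' \<in> K \<and> s + s' \<ge> 0"
      by (auto simp: algebra_simps convex_coneD[OF K])
    then show "x + y \<in> K'" unfolding K'_def by blast
  next
    fix x and r :: real assume "x \<in> K'" "r \<ge> 0"
    then obtain k s where "x = k - s *\<^sub>R g" "k \<in> K" "s \<ge> 0" by (auto simp: K'_def)
    then have "r *\<^sub>R x = r *\<^sub>R k - (r * s) *\<^sub>R g \<and> r *\<^sub>R k \<in> K \<and> r * s \<ge> 0"
      using \<open>r \<ge> 0\<close> by (auto simp: algebra_simps convex_coneD[OF K])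
    then show "r *\<^sub>R x \<in> K'" unfolding K'_def by blast
  qed
  \<comment> \<open>If \<open>- e\<close> were reached, then either \<open>g\<close> would lie in
    \<open>K\<close> at once, or \<open>- e\<close> would, and the order unit property would again
    put \<open>g\<close> into \<open>K\<close>.\<close>
  have ne: "- e \<notin> K'"
  proof
    assume "- e \<in> K'"
    then obtain k s where ks: "- e = k - s *\<^sub>R g" "k \<in> K" "s \<ge> 0" by (auto simp: K'_def)
    then have sg: "s *\<^sub>R g = k + e" by (simp add: algebra_simps)
    show False
    proof (cases "s = 0")
      case True
      then have me: "- e \<in> K" using ks by simp
      obtain l where l: "l *\<^sub>R e - (- g) \<in> K" using unit by blast
      have "\<bar>l\<bar> *\<^sub>R (- e) + (\<bar>l\<bar> - l) *\<^sub>R e + (l *\<^sub>R e - (- g)) \<in> K"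
        by (intro convex_coneD[OF K] l e me) auto
      then have "g \<in> K" by (simp add: algebra_simps)
      with h show False by (simp add: g_def)
    next
      case False
      then have "g = (1/s) *\<^sub>R (k + e)" by (simp flip: sg)
      moreover have "(1/s) *\<^sub>R (k + e) \<in> K" using ks False by (intro convex_coneD[OF K] e) auto
      ultimately show False using h by (simp add: g_def)
    qed
  qed
  have "K' \<noteq> {}" using gK' by blast
  obtain C where C: "K' \<subseteq> C" "convex_cone C" "- e \<notin> C"
    and max: "\<And>D. C \<subseteq> D \<Longrightarrow> convex_cone D \<Longrightarrow> - e \<notin> D \<Longrightarrow> D = C"
    by (rule exists_maximal_cone[OF cK' \<open>K' \<noteq> {}\<close> ne]) metis
  note cone = convex_coneD[OF C(2)]
  have eC: "e \<in> C" using e KK' C by blast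
  have C0: "0 \<in> C" using K0 KK' C by blast
  text \<open>By maximality the cone is total.\<close>
  have total: "- v \<in> C" if v: "v \<notin> C" for v
  proof -
    define D where "D = {k + s *\<^sub>R v | k s. k \<in> C \<and> s \<ge> 0}"
    have "C \<subseteq> D" unfolding D_def by (force intro: exI[of _ 0])
    have "v \<in> D" unfolding D_def using C0 by (force intro: exI[of _ 1])
    have "convex_cone D"
      unfolding convex_cone_def
    proof (intro conjI ballI allI impI)
      fix x y assume "x \<in> D" "y \<in> D"
      then obtain k s k' s' where "x = k + s *\<^sub>R v" "y = k' + s' *\<^sub>R v" "k \<in> C" "k' \<in> C" "s \<ge> 0" "s' \<ge> 0"
        by (auto simp: D_def)
      then have "x + y = (k + k') + (s + s') *\<^sub>R v \<and> k + k' \<in> C \<and> s + s' \<ge> 0"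
        by (auto simp: algebra_simps cone)
      then show "x + y \<in> D" unfolding D_def by blast
    next
      fix x and r :: real assume "x \<in> D" "r \<ge> 0"
      then obtain k s where "x = k + s *\<^sub>R v" "k \<in> C" "s \<ge> 0" by (auto simp: D_def)
      then have "r *\<^sub>R x = r *\<^sub>R k + (r * s) *\<^sub>R v \<and> r *\<^sub>R k \<in> C \<and> r * s \<ge> 0"
        using \<open>r \<ge> 0\<close> by (auto simp: algebra_simps cone)
      then show "r *\<^sub>R x \<in> D" unfolding D_def by blast
    qed
    then have "- e \<in> D" using max[of D] \<open>C \<subseteq> D\<close> \<open>v \<in> D\<close> v by blast
    then obtain k s where ks: "- e = k + s *\<^sub>R v" "k \<in> C" "s \<ge> 0" by (auto simp: D_def)
    have "s \<noteq> 0" using ks C(3) by auto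
    have "s *\<^sub>R v = - e - k" by (simp add: ks(1))
    then have "k + e = - (s *\<^sub>R v)" by simp
    then have "- v = (1/s) *\<^sub>R (k + e)" using \<open>s \<noteq> 0\<close> by simp
    moreover have "(1/s) *\<^sub>R (k + e) \<in> C" using ks eC by (intro cone) auto
    ultimately show ?thesis by simp
  qed
  define f where "f v = Inf {l. l *\<^sub>R e - v \<in> C}" for v
  have mono: "m *\<^sub>R e - v \<in> C" if "l *\<^sub>R e - v \<in> C" "l \<le> m" for l m v
  proof -
    have "(l *\<^sub>R e - v) + (m - l) *\<^sub>R e \<in> C" using that eC by (intro cone) auto
    then show ?thesis by (simp add: algebra_simps)
  qed
  have scal: "l \<ge> 0" if "l *\<^sub>R e \<in> C" for l
  proof (rule ccontr)
    assume "\<not> l \<ge> 0"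
    then have "(1 / - l) *\<^sub>R (l *\<^sub>R e) \<in> C" by (intro cone(2)[OF that]) auto
    then show False using C(3) \<open>\<not> l \<ge> 0\<close> by simp
  qed
  have ne': "{l. l *\<^sub>R e - v \<in> C} \<noteq> {}" for v using unit[of v] KK' C(1) by blast
  have bdd: "bdd_below {l. l *\<^sub>R e - v \<in> C}" for v
  proof -
    obtain m where m: "m *\<^sub>R e - (- v) \<in> C" using ne'[of "- v"] by blast
    have "- m \<le> l" if "l *\<^sub>R e - v \<in> C" for l
    proof -
      have "(m *\<^sub>R e - (- v)) + (l *\<^sub>R e - v) \<in> C" using m that by (rule cone)
      then have "(m + l) *\<^sub>R e \<in> C" by (simp add: algebra_simps)
      from scal[OF this] show ?thesis by simp
    qed
    then show ?thesis by (auto simp: bdd_below_def)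
  qed
  have f_le: "f v \<le> l" if "l *\<^sub>R e - v \<in> C" for v l
    unfolding f_def using that bdd by (intro cInf_lower) auto
  have f_less: "l *\<^sub>R e - v \<in> C" if "f v < l" for v l
  proof -
    have "\<exists>m\<in>{l. l *\<^sub>R e - v \<in> C}. m < l"
      by (rule cInf_lessD[OF ne']) (use that in \<open>simp add: f_def\<close>)
    then obtain m where "m *\<^sub>R e - v \<in> C" "m < l" by blast
    then show ?thesis using mono[of m v l] by simp
  qed
  have sub: "f (v + w) \<le> f v + f w" for v w
  proof (rule field_le_epsilon)
    fix \<delta> :: real assume "\<delta> > 0"
    have "((f v + \<delta>/2) *\<^sub>R e - v) + ((f w + \<delta>/2) *\<^sub>R e - w) \<in> C"
      using \<open>\<delta> > 0\<close> by (intro cone f_less) auto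
    moreover have "((f v + \<delta>/2) *\<^sub>R e - v) + ((f w + \<delta>/2) *\<^sub>R e - w) = (f v + f w + \<delta>) *\<^sub>R e - (v + w)"
      by (simp add: algebra_simps flip: scaleR_add_left)
    ultimately show "f (v + w) \<le> f v + f w + \<delta>" using f_le by simp
  qed
  \<comment> \<open>Totality is used here: with a coefficient below \<open>f v\<close> the element
    is outside \<open>C\<close>, so its negative is inside.\<close>
  have neg_le: "f (- v) \<le> - f v" for v
  proof (rule field_le_epsilon)
    fix \<delta> :: real assume "\<delta> > 0"
    then have "(f v - \<delta>) *\<^sub>R e - v \<notin> C" using f_le[of "f v - \<delta>" v] by auto
    from total[OF this] have "(- f v + \<delta>) *\<^sub>R e - (- v) \<in> C" by (simp add: algebra_simps)
    then show "f (- v) \<le> - f v + \<delta>" by (rule f_le)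
  qed
  have f0: "f 0 = 0"
  proof (rule antisym)
    show "f 0 \<le> 0" by (rule f_le) (simp add: C0)
    show "0 \<le> f 0" unfolding f_def by (rule cInf_greatest[OF ne']) (use scal in simp)
  qed
  have neg: "f (- v) = - f v" for v
    using sub[of v "- v"] neg_le[of v] f0 by simp
  have add: "f (v + w) = f v + f w" for v w
    using sub[of v w] sub[of "- v" "- w"] neg[of v] neg[of w] neg[of "v + w"] by simp
  have pos_scale: "f (r *\<^sub>R v) = r * f v" if r: "r > 0" for r v
  proof -
    have le: "f (r *\<^sub>R v) \<le> r * f v" if r: "r > 0" for r v
    proof (rule field_le_epsilon)
      fix \<delta> :: real assume "\<delta> > 0"
      have "r *\<^sub>R ((f v + \<delta> / r) *\<^sub>R e - v) \<in> C" using r \<open>\<delta> > 0\<close> by (intro cone f_less) auto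
      then have "(r * f v + \<delta>) *\<^sub>R e - r *\<^sub>R v \<in> C" using r by (simp add: algebra_simps)
      then show "f (r *\<^sub>R v) \<le> r * f v + \<delta>" by (rule f_le)
    qed
    have "f ((1/r) *\<^sub>R (r *\<^sub>R v)) \<le> (1/r) * f (r *\<^sub>R v)" using r by (intro le) simp
    then have "r * f v \<le> f (r *\<^sub>R v)" using r by (simp add: field_simps)
    with le[OF r, of v] show ?thesis by simp
  qed
  have scale: "f (r *\<^sub>R v) = r * f v" for r v
  proof (cases r "0::real" rule: linorder_cases)
    case less
    have "f (- ((- r) *\<^sub>R v)) = - ((- r) * f v)" using pos_scale[of "- r" v] neg less by simp
    then show ?thesis by simp
  next
    case equal
    then show ?thesis by (simp add: f0)
  qed (rule pos_scale)
  have pos: "f v \<ge> 0" if "v \<in> C" for v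
    using f_le[of 0 "- v"] that by (simp add: neg)
  have fe: "f e = 1"
  proof (rule antisym)
    show "f e \<le> 1" by (rule f_le) (simp add: C0)
    have "l \<ge> 1" if "l *\<^sub>R e - e \<in> C" for l
      using scal[of "l - 1"] that by (simp add: algebra_simps)
    then show "1 \<le> f e" unfolding f_def by (intro cInf_greatest[OF ne']) auto
  qed
  show ?thesis
  proof (intro exI[of _ f] conjI ballI)
    show "linear f" by (rule linearI) (simp_all add: add scale)
    show "f v \<ge> 0" if "v \<in> K" for v using that KK' C(1) pos by blast
    show "f e = 1" by (rule fe)
    \<comment> \<open>As \<open>- g\<close> was put into the cone,
      \<open>f h \<le> - \<epsilon>\<close>; the margin \<open>\<epsilon>\<close> in the hypothesis
      yields the strict sign.\<close>
    have "f (- g) \<ge> 0" using gK' C(1) pos by blast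
    moreover have "f (- g) = - (f h + \<epsilon> * 1)" by (simp only: neg g_def add scale fe)
    ultimately show "f h < 0" using h(1) by simp
  qed
qed

section \<open>Sesquilinear forms\<close>

definition sesq :: "'i set \<Rightarrow> ('i \<Rightarrow> 'i \<Rightarrow> complex) \<Rightarrow> ('i \<Rightarrow> complex) \<Rightarrow> ('i \<Rightarrow> complex) \<Rightarrow> complex" where
  "sesq I T x y = (\<Sum>i\<in>I. \<Sum>j\<in>I. cnj (x i) * T i j * y j)"

lemma psd_on_sesq: "psd_on I T \<longleftrightarrow> (\<forall>x. 0 \<le> sesq I T x x)"
  by (simp add: psd_on_def sesq_def)

lemma sesq_cong:
  "(\<And>i. i \<in> I \<Longrightarrow> x i = x' i) \<Longrightarrow> (\<And>i. i \<in> I \<Longrightarrow> y i = y' i) \<Longrightarrow> sesq I T x y = sesq I T x' y'"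
  unfolding sesq_def by (intro sum.cong refl) simp

lemma sesq_add_right: "sesq I T x (\<lambda>i. y i + z i) = sesq I T x y + sesq I T x z"
  by (simp add: sesq_def distrib_left sum.distrib)

lemma sesq_add_left: "sesq I T (\<lambda>i. x i + y i) z = sesq I T x z + sesq I T y z"
  by (simp add: sesq_def distrib_right sum.distrib)

lemma sesq_scale_right: "sesq I T x (\<lambda>i. c * y i) = c * sesq I T x y"
  by (simp add: sesq_def sum_distrib_left mult_ac)

lemma sesq_scale_left: "sesq I T (\<lambda>i. c * x i) y = cnj c * sesq I T x y"
  by (simp add: sesq_def sum_distrib_left mult_ac)

lemma sesq_0_right: "sesq I T x (\<lambda>i. 0) = 0"
  by (simp add: sesq_def)

lemma sesq_0_left: "sesq I T (\<lambda>i. 0) x = 0"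
  by (simp add: sesq_def)

lemma sesq_sum_right: "sesq I T x (\<lambda>i. \<Sum>a\<in>A. c a * S a i) = (\<Sum>a\<in>A. c a * sesq I T x (S a))"
  by (induction A rule: infinite_finite_induct)
    (simp_all add: sesq_0_right sesq_add_right sesq_scale_right)

lemma sesq_sum_left: "sesq I T (\<lambda>i. \<Sum>a\<in>A. c a * S a i) x = (\<Sum>a\<in>A. cnj (c a) * sesq I T (S a) x)"
  by (induction A rule: infinite_finite_induct)
    (simp_all add: sesq_0_left sesq_add_left sesq_scale_left)

lemma sesq_delta:
  assumes "finite I" "i \<in> I" "j \<in> I"
  shows "sesq I T (\<lambda>k. if k = i then 1 else 0) (\<lambda>k. if k = j then 1 else 0) = T i j"
proof -
  have "sesq I T (\<lambda>k. if k = i then 1 else 0) (\<lambda>k. if k = j then 1 else 0)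
      = (\<Sum>k\<in>I. if k = i then (\<Sum>l\<in>I. if l = j then T i j else 0) else 0)"
    unfolding sesq_def by (intro sum.cong) (auto intro!: sum.cong)
  then show ?thesis using assms by simp
qed

text \<open>Polarization: the form is real at \<open>e i + c * e j\<close> for \<open>c = 1\<close>
  and \<open>c = \<i>\<close>.\<close>

lemma psd_on_hermitian:
  fixes I :: "'i set"
  assumes "finite I" "psd_on I T" "i \<in> I" "j \<in> I"
  shows "T j i = cnj (T i j)"
proof -
  define e :: "'i \<Rightarrow> 'i \<Rightarrow> complex" where "e = (\<lambda>i k. if k = i then 1 else 0)"
  have d: "sesq I T (e k) (e l) = T k l" if "k \<in> I" "l \<in> I" for k l
    unfolding e_def by (rule sesq_delta[OF assms(1) that])
  have im: "Im (sesq I T x x) = 0" for x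
    using assms(2) by (simp add: psd_on_sesq less_eq_complex_def)
  have eq: "sesq I T (\<lambda>k. e i k + c * e j k) (\<lambda>k. e i k + c * e j k)
      = T i i + c * T i j + cnj c * T j i + cnj c * (c * T j j)" for c
    by (simp add: sesq_add_left sesq_add_right sesq_scale_left sesq_scale_right d assms algebra_simps)
  have *: "Im (T i i + c * T i j + cnj c * T j i + cnj c * (c * T j j)) = 0" for c
    using im[of "\<lambda>k. e i k + c * e j k"] by (simp only: eq)
  have r: "Im (T i i) = 0" "Im (T j j) = 0"
    using im[of "e i"] im[of "e j"] by (simp_all only: d assms(3,4))
  have "Im (T i j) + Im (T j i) = 0" using *[of 1] r by simp
  moreover have "Re (T i j) - Re (T j i) = 0" using *[of \<i>] r by simp
  ultimately show ?thesis by (simp add: complex_eq_iff)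
qed

definition posdef_on :: "'i set \<Rightarrow> ('i \<Rightarrow> 'i \<Rightarrow> complex) \<Rightarrow> bool" where
  "posdef_on I T \<longleftrightarrow> (\<forall>x. (\<exists>i\<in>I. x i \<noteq> 0) \<longrightarrow> 0 < sesq I T x x)"

lemma posdef_on_psd_on: "posdef_on I T \<Longrightarrow> psd_on I T"
  unfolding psd_on_sesq posdef_on_def
proof
  fix x assume *: "\<forall>x. (\<exists>i\<in>I. x i \<noteq> 0) \<longrightarrow> 0 < sesq I T x x"
  show "0 \<le> sesq I T x x"
  proof (cases "\<exists>i\<in>I. x i \<noteq> 0")
    case False
    then have "sesq I T x x = sesq I T x (\<lambda>i. 0)" by (intro sesq_cong) auto
    then show ?thesis by (simp add: sesq_0_right)
  next
    case True
    with * have "0 < sesq I T x x" by blast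
    then show ?thesis by (rule less_imp_le)
  qed
qed

text \<open>Gram-Schmidt, one standard basis vector at a time. It serves to normalize a completely
  positive map to a unital one and to write a positive definite matrix as a Gram matrix.\<close>

lemma orthonormalize:
  assumes "finite I" "posdef_on I T"
  shows "\<exists>S. (\<forall>a\<in>I. \<forall>b\<in>I. sesq I T (S a) (S b) = (if a = b then 1 else 0)) \<and>
    (\<forall>x. \<exists>\<xi>. \<forall>i\<in>I. x i = (\<Sum>a\<in>I. \<xi> a * S a i))"
proof -
  have herm: "T j i = cnj (T i j)" if "i \<in> I" "j \<in> I" for i j
    using psd_on_hermitian[OF assms(1) posdef_on_psd_on[OF assms(2)] that] .
  have sherm: "sesq I T y x = cnj (sesq I T x y)" for x y
  proof -
    have "cnj (sesq I T x y) = (\<Sum>i\<in>I. \<Sum>j\<in>I. cnj (y j) * T j i * x i)"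
      unfolding sesq_def cnj_sum
    proof (intro sum.cong refl)
      fix i j assume "i \<in> I" "j \<in> I"
      then show "cnj (cnj (x i) * T i j * y j) = cnj (y j) * T j i * x i"
        by (simp add: herm[of i j] mult_ac)
    qed
    also have "\<dots> = sesq I T y x" unfolding sesq_def by (rule sum.swap)
    finally show ?thesis by simp
  qed
  \<comment> \<open>Keeping the support of \<open>S a\<close> inside \<open>J\<close> ensures that
    the vector built at a new index \<open>k\<close> has coordinate 1 there and is therefore
    nonzero.\<close>
  have "\<exists>S. (\<forall>a\<in>J. \<forall>b\<in>J. sesq I T (S a) (S b) = (if a = b then 1 else 0)) \<and>
      (\<forall>a\<in>J. \<forall>i. i \<notin> J \<longrightarrow> S a i = 0) \<and>
      (\<forall>x. (\<forall>i\<in>I - J. x i = 0) \<longrightarrow> (\<exists>\<xi>. \<forall>i\<in>I. x i = (\<Sum>a\<in>J. \<xi> a * S a i)))"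
    if "finite J" "J \<subseteq> I" for J
    using that
  proof (induction J)
    case empty
    then show ?case by auto
  next
    case (insert k J)
    have "J \<subseteq> I" using insert.prems by simp
    from insert.IH[OF this] obtain S where
      S1: "\<forall>a\<in>J. \<forall>b\<in>J. sesq I T (S a) (S b) = (if a = b then 1 else 0)"
      and S2: "\<forall>a\<in>J. \<forall>i. i \<notin> J \<longrightarrow> S a i = 0"
      and S3: "\<forall>x. (\<forall>i\<in>I - J. x i = 0) \<longrightarrow> (\<exists>\<xi>. \<forall>i\<in>I. x i = (\<Sum>a\<in>J. \<xi> a * S a i))"
      by (elim exE conjE) (rule that)
    have S: "sesq I T (S a) (S b) = (if a = b then 1 else 0)" if "a \<in> J" "b \<in> J" for a b
      using S1 that by simp
    have S0: "S a i = 0" if "a \<in> J" "i \<notin> J" for a i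
      using S2 that by simp
    note span = S3[rule_format]
    define e where "e = (\<lambda>i. if i = k then 1 else (0::complex))"
    define c where "c a = - sesq I T (S a) e" for a
    define v where "v = (\<lambda>i. e i + (\<Sum>a\<in>J. c a * S a i))"
    have v_right: "sesq I T (S b) v = 0" if "b \<in> J" for b
    proof -
      have "sesq I T (S b) v = sesq I T (S b) e + (\<Sum>a\<in>J. c a * (if b = a then 1 else 0))"
        unfolding v_def sesq_add_right sesq_sum_right using S that by (simp cong: sum.cong)
      also have "(\<Sum>a\<in>J. c a * (if b = a then 1 else 0)) = c b"
        using insert.hyps(1) that by (simp add: if_distrib[of "\<lambda>x. _ * x"] cong: if_cong)
      finally show ?thesis by (simp add: c_def)
    qed
    have v_left: "sesq I T v (S b) = 0" if "b \<in> J" for b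
      using sherm[of v "S b"] v_right[OF that] by simp
    have "(\<Sum>a\<in>J. c a * S a k) = 0"
      by (rule sum.neutral) (simp add: S0[OF _ insert.hyps(2)])
    then have "v k = 1" unfolding v_def e_def by simp
    then have "\<exists>i\<in>I. v i \<noteq> 0" using insert.prems by (intro bexI[of _ k]) simp_all
    then have vv: "0 < sesq I T v v" using assms(2) unfolding posdef_on_def by blast
    define t where "t = sqrt (Re (sesq I T v v))"
    have t: "t > 0" "sesq I T v v = of_real (t * t)"
      using vv by (auto simp: t_def less_complex_def complex_eq_iff)
    define u where "u = (\<lambda>i. of_real (1 / t) * v i)"
    have uu: "sesq I T u u = 1" using t(1) unfolding u_def sesq_scale_left sesq_scale_right t(2) by simp
    have us: "sesq I T u (S b) = 0" "sesq I T (S b) u = 0" if "b \<in> J" for b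
      unfolding u_def sesq_scale_left sesq_scale_right by (simp_all add: v_left v_right that)
    define S' where "S' = S(k := u)"
    have S'J: "S' a = S a" if "a \<in> J" for a using that insert.hyps(2) by (auto simp: S'_def)
    have S'k: "S' k = u" by (simp add: S'_def)
    show ?case
    proof (intro exI[of _ S'] conjI ballI allI impI)
      fix a b assume "a \<in> insert k J" "b \<in> insert k J"
      then show "sesq I T (S' a) (S' b) = (if a = b then 1 else 0)"
        using insert.hyps(2) by (auto simp: S'J S'k uu us S)
    next
      fix a i assume "a \<in> insert k J" "i \<notin> insert k J"
      then show "S' a i = 0" by (auto simp: S'J S'k S0 u_def v_def e_def)
    next
      fix x :: "'a \<Rightarrow> complex" assume x: "\<forall>i\<in>I - insert k J. x i = 0"
      have x0: "\<forall>i\<in>I - J. x i - x k * e i = 0" using x by (auto simp: e_def)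
      have "\<exists>\<xi>. \<forall>i\<in>I. x i - x k * e i = (\<Sum>a\<in>J. \<xi> a * S a i)"
        by (rule span) (use x0 in blast)
      then obtain \<xi> where \<xi>: "\<And>i. i \<in> I \<Longrightarrow> x i - x k * e i = (\<Sum>a\<in>J. \<xi> a * S a i)"
        by (elim exE) (rule that, simp)
      \<comment> \<open>Since \<open>t * u = v = e + \<Sum> c a * S a\<close>, the multiple
        \<open>x k\<close> of \<open>e\<close> is \<open>x k * t * u\<close> minus the corrections
        \<open>x k * c a * S a\<close>.\<close>
      define \<xi>' where "\<xi>' a = (if a = k then x k * of_real t else \<xi> a - x k * c a)" for a
      have "x i = (\<Sum>a\<in>insert k J. \<xi>' a * S' a i)" if "i \<in> I" for i
      proof -
        have "(\<Sum>a\<in>insert k J. \<xi>' a * S' a i) = x k * of_real t * u i + (\<Sum>a\<in>J. \<xi>' a * S' a i)"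
          using insert.hyps by (simp add: S'k \<xi>'_def)
        also have "(\<Sum>a\<in>J. \<xi>' a * S' a i) = (\<Sum>a\<in>J. \<xi> a * S a i - x k * (c a * S a i))"
          by (rule sum.cong) (use insert.hyps(2) in \<open>auto simp: \<xi>'_def S'J algebra_simps\<close>)
        also have "\<dots> = (x i - x k * e i) - x k * (\<Sum>a\<in>J. c a * S a i)"
          by (simp add: sum_subtractf \<xi>[OF that] sum_distrib_left)
        also have "x k * of_real t * u i = x k * v i" using t by (simp add: u_def)
        finally show ?thesis by (simp add: v_def algebra_simps)
      qed
      then show "\<exists>\<xi>. \<forall>i\<in>I. x i = (\<Sum>a\<in>insert k J. \<xi> a * S' a i)" by blast
    qed
  qed
  from this[OF assms(1) order_refl] obtain S where
    S: "\<forall>a\<in>I. \<forall>b\<in>I. sesq I T (S a) (S b) = (if a = b then 1 else 0)"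
    and span: "\<forall>x. (\<forall>i\<in>I - I. x i = 0) \<longrightarrow> (\<exists>\<xi>. \<forall>i\<in>I. x i = (\<Sum>a\<in>I. \<xi> a * S a i))"
    by blast
  have "\<exists>\<xi>. \<forall>i\<in>I. x i = (\<Sum>a\<in>I. \<xi> a * S a i)" for x
    using span[rule_format, of x] by simp
  with S show ?thesis by (intro exI[of _ S] conjI allI)
qed

section \<open>Positive kernels and completely positive maps\<close>

text \<open>A map \<open>A \<rightarrow> M\<^sub>q\<close> is given by its entries \<open>F i j\<close>.\<close>

definition cp_kernel :: "nat \<Rightarrow> (nat \<Rightarrow> nat \<Rightarrow> 'a::unital_cstar_algebra \<Rightarrow> complex) \<Rightarrow> bool" where
  "cp_kernel q F \<longleftrightarrow> (\<forall>i j x y. F i j (x + y) = F i j x + F i j y) \<and>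
     (\<forall>i j c x. F i j (scaleC c x) = c * F i j x) \<and>
     (\<forall>w. 0 \<le> (\<Sum>i<q. \<Sum>j<q. F i j (star (w i) * w j)))"

context
  fixes q :: nat and F :: "nat \<Rightarrow> nat \<Rightarrow> 'a::unital_cstar_algebra \<Rightarrow> complex"
  assumes F: "cp_kernel q F"
begin

lemma cp_kernel_add: "F i j (x + y) = F i j x + F i j y"
  and cp_kernel_scale: "F i j (scaleC c x) = c * F i j x"
  and cp_kernel_nonneg: "0 \<le> (\<Sum>i<q. \<Sum>j<q. F i j (star (w i) * w j))"
  using F by (simp_all add: cp_kernel_def)

lemma cp_kernel_0: "F i j 0 = 0"
  using cp_kernel_scale[of i j 0 0] by simp

lemma cp_kernel_sum: "F i j (sum f A) = (\<Sum>a\<in>A. F i j (f a))"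
  by (induction A rule: infinite_finite_induct) (simp_all add: cp_kernel_0 cp_kernel_add)

lemma cp_kernel_sesq:
  "F i j (star (\<Sum>a\<in>A. scaleC (c a) (w a)) * (\<Sum>b\<in>B. scaleC (d b) (z b)))
    = (\<Sum>a\<in>A. \<Sum>b\<in>B. cnj (c a) * d b * F i j (star (w a) * z b))"
  by (simp add: star_sum star_scaleC sum_product cp_kernel_sum scaleC_mult_left scaleC_mult_right
      scaleC_scaleC cp_kernel_scale mult_ac)

end

lemma sum_reorder5:
  "(\<Sum>l\<in>L. \<Sum>i\<in>I. \<Sum>j\<in>I'. \<Sum>a\<in>A. \<Sum>b\<in>B. G l i j a b) =
    (\<Sum>a\<in>A. \<Sum>i\<in>I. \<Sum>b\<in>B. \<Sum>j\<in>I'. \<Sum>l\<in>L. (G l i j a b :: 'c::comm_monoid_add))" (is "?l = ?r")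
proof -
  have "?l = (\<Sum>i\<in>I. \<Sum>l\<in>L. \<Sum>j\<in>I'. \<Sum>a\<in>A. \<Sum>b\<in>B. G l i j a b)"
    by (rule sum.swap)
  also have "\<dots> = (\<Sum>i\<in>I. \<Sum>j\<in>I'. \<Sum>l\<in>L. \<Sum>a\<in>A. \<Sum>b\<in>B. G l i j a b)"
    by (rule sum.cong[OF refl], rule sum.swap)
  also have "\<dots> = (\<Sum>i\<in>I. \<Sum>j\<in>I'. \<Sum>a\<in>A. \<Sum>l\<in>L. \<Sum>b\<in>B. G l i j a b)"
    by (rule sum.cong[OF refl], rule sum.cong[OF refl], rule sum.swap)
  also have "\<dots> = (\<Sum>i\<in>I. \<Sum>j\<in>I'. \<Sum>a\<in>A. \<Sum>b\<in>B. \<Sum>l\<in>L. G l i j a b)"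
    by (rule sum.cong[OF refl], rule sum.cong[OF refl], rule sum.cong[OF refl], rule sum.swap)
  also have "\<dots> = (\<Sum>i\<in>I. \<Sum>a\<in>A. \<Sum>j\<in>I'. \<Sum>b\<in>B. \<Sum>l\<in>L. G l i j a b)"
    by (rule sum.cong[OF refl], rule sum.swap)
  also have "\<dots> = (\<Sum>a\<in>A. \<Sum>i\<in>I. \<Sum>j\<in>I'. \<Sum>b\<in>B. \<Sum>l\<in>L. G l i j a b)"
    by (rule sum.swap)
  also have "\<dots> = ?r"
    by (rule sum.cong[OF refl], rule sum.cong[OF refl], rule sum.swap)
  finally show ?thesis .
qed

lemma star_mat_mult_self_index:
  assumes "Y \<in> carrier_mat p p" "\<alpha> < p" "\<beta> < p"
  shows "(star_mat Y * Y) $$ (\<alpha>, \<beta>) = (\<Sum>l<p. star (Y $$ (l, \<alpha>)) * Y $$ (l, \<beta>))"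
  using assms by (simp add: star_mat_def scalar_prod_def atLeast0LessThan)

text \<open>For a target of dimension \<open>q\<close>, positivity of the kernel on \<open>q\<close>
  elements already gives positivity at every matrix level \<open>p\<close>: for fixed
  \<open>l\<close> the test vector \<open>x\<close> collapses row \<open>l\<close> of
  \<open>Y\<close> into the \<open>q\<close> elements \<open>w l i\<close>.\<close>

lemma cp_kernel_quadratic_form:
  fixes x :: "nat \<Rightarrow> nat \<Rightarrow> complex" and Y :: "nat \<Rightarrow> nat \<Rightarrow> 'a::unital_cstar_algebra"
  assumes F: "cp_kernel q F"
  shows "0 \<le> (\<Sum>\<alpha><p. \<Sum>i<q. \<Sum>\<beta><p. \<Sum>j<q. cnj (x \<alpha> i) * F i j (\<Sum>l<r. star (Y l \<alpha>) * Y l \<beta>) * x \<beta> j)"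
    (is "0 \<le> ?L")
proof -
  define w where "w = (\<lambda>l i. \<Sum>\<alpha><p. scaleC (x \<alpha> i) (Y l \<alpha>))"
  have "(\<Sum>i<q. \<Sum>j<q. F i j (star (w l i) * w l j))
    = (\<Sum>i<q. \<Sum>j<q. \<Sum>\<alpha><p. \<Sum>\<beta><p. cnj (x \<alpha> i) * F i j (star (Y l \<alpha>) * Y l \<beta>) * x \<beta> j)" for l
    unfolding w_def by (simp add: cp_kernel_sesq[OF F] mult_ac)
  then have "(\<Sum>l<r. \<Sum>i<q. \<Sum>j<q. F i j (star (w l i) * w l j))
    = (\<Sum>l<r. \<Sum>i<q. \<Sum>j<q. \<Sum>\<alpha><p. \<Sum>\<beta><p. cnj (x \<alpha> i) * F i j (star (Y l \<alpha>) * Y l \<beta>) * x \<beta> j)"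
    by (simp only:)
  also have "\<dots> = (\<Sum>\<alpha><p. \<Sum>i<q. \<Sum>\<beta><p. \<Sum>j<q. \<Sum>l<r. cnj (x \<alpha> i) * F i j (star (Y l \<alpha>) * Y l \<beta>) * x \<beta> j)"
    by (rule sum_reorder5)
  also have "\<dots> = ?L"
    by (simp only: cp_kernel_sum[OF F] sum_distrib_left sum_distrib_right)
  finally have "?L = (\<Sum>l<r. \<Sum>i<q. \<Sum>j<q. F i j (star (w l i) * w l j))" by simp
  also have "0 \<le> \<dots>" by (intro sum_nonneg cp_kernel_nonneg[OF F])
  finally show ?thesis .
qed

lemma sesq_Times:
  "sesq (A \<times> B) (\<lambda>(i, a) (j, b). M i j a b) x y =
    (\<Sum>i\<in>A. \<Sum>a\<in>B. \<Sum>j\<in>A. \<Sum>b\<in>B. cnj (x (i, a)) * M i j a b * y (j, b))"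
proof -
  have *: "sum g (A \<times> B) = (\<Sum>i\<in>A. \<Sum>a\<in>B. g (i, a))" for g :: "'a \<times> 'b \<Rightarrow> complex"
    by (simp add: sum.cartesian_product)
  show ?thesis unfolding sesq_def by (subst *, rule sum.cong[OF refl], rule sum.cong[OF refl], subst *) simp
qed

lemma ucp_of_cp_kernel:
  assumes F: "cp_kernel q F"
    and unital: "\<And>i j. i < q \<Longrightarrow> j < q \<Longrightarrow> F i j 1 = (if i = j then 1 else 0)"
  shows "ucp cstar_opsys q (\<lambda>x. Matrix.mat q q (\<lambda>(i, j). F i j x))"
  unfolding ucp_def
proof (intro conjI allI ballI)
  let ?\<psi> = "\<lambda>x. Matrix.mat q q (\<lambda>(i, j). F i j x)"
  show "?\<psi> (v + w) = ?\<psi> v + ?\<psi> w" for v w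
    by (rule eq_matI) (auto simp: cp_kernel_add[OF F])
  show "?\<psi> (scaleC c v) = c \<cdot>\<^sub>m ?\<psi> v" for c v
    by (rule eq_matI) (auto simp: cp_kernel_scale[OF F])
  show "?\<psi> (os_unit cstar_opsys) = 1\<^sub>m q"
    by (rule eq_matI) (auto simp: cstar_opsys_def unital)
  fix p and P :: "'a mat" assume "P \<in> os_cone cstar_opsys p"
  then obtain Y where Y: "Y \<in> carrier_mat p p" "P = star_mat Y * Y" by (auto simp: cstar_opsys_def)
  have P: "P \<in> carrier_mat p p" using Y by (auto simp: star_mat_def)
  have "psd_on ({..<p} \<times> {..<q}) (\<lambda>(i, a) (j, b). map_mat ?\<psi> P $$ (i, j) $$ (a, b))"
    unfolding psd_on_sesq
  proof
    fix x :: "nat \<times> nat \<Rightarrow> complex"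
    have "0 \<le> (\<Sum>\<alpha><p. \<Sum>i<q. \<Sum>\<beta><p. \<Sum>j<q.
        cnj (x (\<alpha>, i)) * F i j (\<Sum>l<p. star (Y $$ (l, \<alpha>)) * Y $$ (l, \<beta>)) * x (\<beta>, j))"
      by (rule cp_kernel_quadratic_form[OF F])
    also have "\<dots> = (\<Sum>\<alpha><p. \<Sum>i<q. \<Sum>\<beta><p. \<Sum>j<q.
        cnj (x (\<alpha>, i)) * map_mat ?\<psi> P $$ (\<alpha>, \<beta>) $$ (i, j) * x (\<beta>, j))"
    proof (intro sum.cong refl)
      fix \<alpha> i \<beta> j assume "\<alpha> \<in> {..<p}" "i \<in> {..<q}" "\<beta> \<in> {..<p}" "j \<in> {..<q}"
      then have "map_mat ?\<psi> P $$ (\<alpha>, \<beta>) $$ (i, j) = F i j (P $$ (\<alpha>, \<beta>))" using P by simp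
      also have "P $$ (\<alpha>, \<beta>) = (\<Sum>l<p. star (Y $$ (l, \<alpha>)) * Y $$ (l, \<beta>))"
        unfolding Y(2) by (rule star_mat_mult_self_index[OF Y(1)]) (use \<open>\<alpha> \<in> {..<p}\<close> \<open>\<beta> \<in> {..<p}\<close> in auto)
      finally show "cnj (x (\<alpha>, i)) * F i j (\<Sum>l<p. star (Y $$ (l, \<alpha>)) * Y $$ (l, \<beta>)) * x (\<beta>, j)
        = cnj (x (\<alpha>, i)) * map_mat ?\<psi> P $$ (\<alpha>, \<beta>) $$ (i, j) * x (\<beta>, j)" by simp
    qed
    finally show "0 \<le> sesq ({..<p} \<times> {..<q}) (\<lambda>(i, a) (j, b). map_mat ?\<psi> P $$ (i, j) $$ (a, b)) x x"
      unfolding sesq_Times .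
  qed
  then show "map_mat ?\<psi> P \<in> matrix_cone q p" using P by (simp add: matrix_cone_def)
qed auto

lemma sum_sandwich:
  "(\<Sum>a\<in>A. \<Sum>b\<in>A. cnj (\<xi> a) * sesq I G (S a) (S b) * \<eta> b)
    = sesq I G (\<lambda>i. \<Sum>a\<in>A. \<xi> a * S a i) (\<lambda>i. \<Sum>a\<in>A. \<eta> a * S a i)"
proof -
  have "sesq I G (\<lambda>i. \<Sum>a\<in>A. \<xi> a * S a i) (\<lambda>i. \<Sum>a\<in>A. \<eta> a * S a i)
      = (\<Sum>a\<in>A. cnj (\<xi> a) * sesq I G (S a) (\<lambda>i. \<Sum>a\<in>A. \<eta> a * S a i))"
    by (rule sesq_sum_left)
  also have "\<dots> = (\<Sum>a\<in>A. cnj (\<xi> a) * (\<Sum>b\<in>A. \<eta> b * sesq I G (S a) (S b)))"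
    by (intro sum.cong refl arg_cong2[of _ _ _ _ times] sesq_sum_right)
  finally show ?thesis by (simp add: sum_distrib_left mult_ac)
qed

lemma scaleC_diff_left: "scaleC (c - d) (x::'a::complex_vector) = scaleC c x - scaleC d x"
  using scaleC_add_left[of c "- d" x] by (simp add: scaleC_minus_left)

section \<open>Positivity from unital completely positive maps\<close>

text \<open>By contraposition. A functional that is negative at \<open>v\<close> and nonnegative on
  Gram matrices gives, through its values on matrix units, a completely positive map into
  \<open>q\<close> by \<open>q\<close> matrices whose quadratic form at \<open>v\<close> is
  negative. What remains is to make that map unital.\<close>

lemma pos_if_ucp_nonneg:
  fixes v :: "'a::unital_cstar_algebra rcf"
  assumes nn: "\<And>m \<psi> \<xi>. ucp (cstar_opsys :: 'a opsys) m \<psi> \<Longrightarrow>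
      0 \<le> Re (\<Sum>i<q. \<Sum>j<q. \<Sum>a<m. \<Sum>b<m. cnj (\<xi> i a) * \<psi> (ent v i j) $$ (a, b) * \<xi> j b)"
    and \<epsilon>: "\<epsilon> > 0"
  shows "pos (corner q * (v + adj v) * corner q + \<epsilon> *\<^sub>R corner q)"
proof (rule ccontr)
  define e :: "'a rcf" where "e = corner q"
  have ee: "e * e = e" "adj e = e" by (simp_all add: e_def)
  \<comment> \<open>Only the hermitian part of the compression enters, so the separating functional
    vanishes on skew elements and is determined by the corner.\<close>
  define K where "K = {w :: 'a rcf. pos (e * (w + adj w) * e)}"
  assume "\<not> ?thesis"
  then have np: "\<not> pos (e * (v + adj v) * e + \<epsilon> *\<^sub>R e)" by (simp add: e_def)
  have cK: "convex_cone K"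
    unfolding convex_cone_def
  proof (intro conjI ballI allI impI)
    fix x y assume "x \<in> K" "y \<in> K"
    then have "pos (e * (x + adj x) * e + e * (y + adj y) * e)" by (simp add: K_def pos_add)
    also have "e * (x + adj x) * e + e * (y + adj y) * e = e * (x + y + adj (x + y)) * e"
      by (simp add: adj_add algebra_simps)
    finally show "x + y \<in> K" by (simp add: K_def)
  next
    fix x and r :: real assume "x \<in> K" "r \<ge> 0"
    then have "pos (r *\<^sub>R (e * (x + adj x) * e))" by (simp add: K_def pos_scaleR)
    also have "r *\<^sub>R (e * (x + adj x) * e) = e * (r *\<^sub>R x + adj (r *\<^sub>R x)) * e"
      by (simp add: adj_scaleR algebra_simps)
    finally show "r *\<^sub>R x \<in> K" by (simp add: K_def)
  qed
  have eK: "e \<in> K"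
  proof -
    have "e * (e + adj e) * e = 2 *\<^sub>R e" by (simp add: ee distrib_left distrib_right mult.assoc scaleR_2)
    then show ?thesis by (simp add: K_def pos_scaleR e_def)
  qed
  have unit: "\<exists>l. l *\<^sub>R e - w \<in> K" for w
  proof -
    obtain l where l: "pos (l *\<^sub>R e - e * (w + adj w) * e)"
      using ex_pos_scaleR_corner_diff[of q w] by (auto simp: e_def)
    have "e * ((l/2) *\<^sub>R e - w + adj ((l/2) *\<^sub>R e - w)) * e = ((l/2) *\<^sub>R e + (l/2) *\<^sub>R e) - e * (w + adj w) * e"
      by (simp add: ee adj_diff adj_scaleR algebra_simps)
    also have "(l/2) *\<^sub>R e + (l/2) *\<^sub>R e = l *\<^sub>R e" by (simp flip: scaleR_add_left)
    finally show ?thesis using l by (auto simp: K_def intro!: exI[of _ "l/2"])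
  qed
  have nK: "v + (\<epsilon>/2) *\<^sub>R e \<notin> K"
  proof -
    have "e * (v + (\<epsilon>/2) *\<^sub>R e + adj (v + (\<epsilon>/2) *\<^sub>R e)) * e = e * (v + adj v) * e + ((\<epsilon>/2) *\<^sub>R e + (\<epsilon>/2) *\<^sub>R e)"
      by (simp add: ee adj_add adj_scaleR algebra_simps)
    also have "(\<epsilon>/2) *\<^sub>R e + (\<epsilon>/2) *\<^sub>R e = \<epsilon> *\<^sub>R e" by (simp flip: scaleR_add_left)
    finally show ?thesis using np by (simp add: K_def)
  qed
  obtain f :: "'a rcf \<Rightarrow> real" where f: "linear f" "\<forall>w\<in>K. f w \<ge> 0" "f e = 1" "f v < 0"
    using separating_functional[OF cK eK unit half_gt_zero[OF \<epsilon>] nK] by (elim exE conjE) (rule that)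
  note flin = linear_add[OF f(1)] linear_diff[OF f(1)] linear_neg[OF f(1)] linear_scale[OF f(1)] linear_sum[OF f(1)]
  have f0: "f w = 0" if "e * (w + adj w) * e = 0" for w
  proof -
    have "e * (- w + adj (- w)) * e = - (e * (w + adj w) * e)" by (simp add: adj_minus algebra_simps)
    then have "w \<in> K" "- w \<in> K" using that by (simp_all add: K_def)
    then have "f w \<ge> 0" "f (- w) \<ge> 0" using f(2) by blast+
    then show ?thesis by (simp add: flin)
  qed
  have fskew: "f w = 0" if "adj w = - w" for w
    by (rule f0) (simp add: that)
  have fpos: "f (adj y * y) \<ge> 0" for y
  proof (rule f(2)[rule_format])
    have "e * (adj y * y + adj (adj y * y)) * e = 2 *\<^sub>R (adj e * (adj y * y) * e)"
      by (simp add: adj_mult ee distrib_left distrib_right scaleR_2)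
    also have "pos \<dots>" by (intro pos_scaleR pos_conj pos_self) simp
    finally show "adj y * y \<in> K" by (simp add: K_def)
  qed
  have fcorner: "f w = (\<Sum>i<q. \<Sum>j<q. f (mk i j (ent w i j)))" for w
  proof -
    have "e * (w - e * w * e + adj (w - e * w * e)) * e = 0"
      by (simp add: adj_diff adj_mult ee algebra_simps) (simp add: ee mult.assoc[symmetric])
    from f0[OF this] have "f w = f (e * w * e)" by (simp add: flin)
    then show ?thesis unfolding e_def corner_compress_eq_sum by (simp add: flin)
  qed
  \<comment> \<open>On each matrix unit, the complex-linear functional with real part
    \<open>f\<close>.\<close>
  define F where "F i j a = complex_of_real (f (mk i j a)) - \<i> * complex_of_real (f (mk i j (scaleC \<i> a)))"
    for i j and a :: 'a
  have Re_F: "Re (F i j a) = f (mk i j a)" for i j a by (simp add: F_def)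
  have F_scale: "F i j (scaleC c a) = c * F i j a" for i j c a
  proof -
    have 1: "scaleC c a = Re c *\<^sub>R a + Im c *\<^sub>R scaleC \<i> a"
    proof -
      have "scaleC c a = scaleC (of_real (Re c) + of_real (Im c) * \<i>) a"
        by (rule arg_cong[of _ _ "\<lambda>c. scaleC c a"], rule complex_eqI) simp_all
      then show ?thesis by (simp only: scaleC_add_left scaleC_scaleC[symmetric] scaleR_scaleC)
    qed
    have 2: "scaleC \<i> (scaleC c a) = Re c *\<^sub>R scaleC \<i> a - Im c *\<^sub>R a"
    proof -
      have "scaleC \<i> (scaleC c a) = scaleC (of_real (Re c) * \<i> + - of_real (Im c)) a"
        unfolding scaleC_scaleC
        by (rule arg_cong[of _ _ "\<lambda>c. scaleC c a"], rule complex_eqI) simp_all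
      then show ?thesis
        by (simp only: scaleC_add_left scaleC_scaleC[symmetric] scaleR_scaleC scaleC_diff_left add_uminus_conv_diff)
    qed
    show ?thesis unfolding F_def 2 unfolding 1
      by (simp add: mk_add mk_diff mk_scaleR flin complex_eq_iff)
  qed
  have F_add: "F i j (x + y) = F i j x + F i j y" for i j x y
    by (simp add: F_def scaleC_add_right mk_add flin algebra_simps)
  have F: "cp_kernel q F"
    unfolding cp_kernel_def
  proof (intro conjI allI F_add F_scale)
    fix w :: "nat \<Rightarrow> 'a"
    define W where "W = (\<Sum>i<q. mk 0 i (w i))"
    have W: "adj W * W = (\<Sum>i<q. \<Sum>j<q. mk i j (star (w i) * w j))"
      by (simp add: W_def adj_sum sum_product mk_mult_mk)
    have "Re (\<Sum>i<q. \<Sum>j<q. F i j (star (w i) * w j)) = f (adj W * W)"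
      by (simp add: W Re_F flin)
    moreover have "Im (\<Sum>i<q. \<Sum>j<q. F i j (star (w i) * w j))
        = - f (\<Sum>i<q. \<Sum>j<q. mk i j (scaleC \<i> (star (w i) * w j)))"
      by (simp add: F_def flin sum_negf)
    moreover have "f (\<Sum>i<q. \<Sum>j<q. mk i j (scaleC \<i> (star (w i) * w j))) = 0"
    proof (rule fskew)
      have m: "mk j i (- x) = - mk j i x" for i j and x :: 'a by (rule rcf_eqI) simp
      have "adj (\<Sum>i<q. \<Sum>j<q. mk i j (scaleC \<i> (star (w i) * w j)))
          = - (\<Sum>i<q. \<Sum>j<q. mk j i (scaleC \<i> (star (w j) * w i)))"
        by (simp add: adj_sum star_scaleC star_mult star_star scaleC_minus_left m sum_negf)
      also have "(\<Sum>i<q. \<Sum>j<q. mk j i (scaleC \<i> (star (w j) * w i)))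
          = (\<Sum>i<q. \<Sum>j<q. mk i j (scaleC \<i> (star (w i) * w j)))"
        by (rule sum.swap)
      finally show "adj (\<Sum>i<q. \<Sum>j<q. mk i j (scaleC \<i> (star (w i) * w j))) =
          - (\<Sum>i<q. \<Sum>j<q. mk i j (scaleC \<i> (star (w i) * w j)))" .
    qed
    ultimately show "0 \<le> (\<Sum>i<q. \<Sum>j<q. F i j (star (w i) * w j))"
      using fpos[of W] by (simp add: less_eq_complex_def)
  qed
  text \<open>The matrix \<open>F(1)\<close> is only semidefinite. Adding a small multiple of the trace \<open>s\<close> makes it
    definite, so that it can be normalized to the identity.\<close>
  define s where "s a = (\<Sum>k<q. F k k a)" for a
  have s_sq: "0 \<le> s (star x * x)" for x
    unfolding s_def
  proof (rule sum_nonneg)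
    fix k assume k: "k \<in> {..<q}"
    define w where "w i = (if i = k then x else 0)" for i
    have "F i j (star (w i) * w j) = (if i = k then if j = k then F k k (star x * x) else 0 else 0)" for i j
      by (auto simp: w_def cp_kernel_0[OF F])
    then have "(\<Sum>i<q. \<Sum>j<q. F i j (star (w i) * w j))
        = (\<Sum>i<q. \<Sum>j<q. if i = k then if j = k then F k k (star x * x) else 0 else 0)"
      by (simp only:)
    also have "\<dots> = (\<Sum>i<q. if i = k then F k k (star x * x) else 0)"
      by (rule sum.cong) (use k in auto)
    also have "\<dots> = F k k (star x * x)" using k by simp
    finally show "0 \<le> F k k (star x * x)" using cp_kernel_nonneg[OF F, of w] by simp
  qed
  have s1: "s 1 = 1"
  proof -
    have "Re (s 1) = f (corner q)" by (simp add: s_def Re_F corner_eq_sum flin)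
    then have "Re (s 1) = 1" using f(3) by (simp add: e_def)
    with s_sq[of 1] show ?thesis by (simp add: less_eq_complex_def complex_eq_iff)
  qed
  have s_add: "s (x + y) = s x + s y" and s_scale: "s (scaleC c x) = c * s x" for x y c
    by (simp_all add: s_def F_add F_scale sum.distrib sum_distrib_left)
  define R where "R = Re (\<Sum>i<q. s (ent v i i))"
  \<comment> \<open>The perturbation changes the value at \<open>v\<close> by
    \<open>\<delta> * R\<close>; this \<open>\<delta>\<close> spends at most half of the gap
    \<open>- f v\<close>.\<close>
  define \<delta> where "\<delta> = - f v / (2 * (1 + \<bar>R\<bar>))"
  have \<delta>: "\<delta> > 0" unfolding \<delta>_def using f(4) by (intro divide_pos_pos) auto
  have \<delta>R: "f v + \<delta> * R < 0"
  proof -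
    have "\<delta> * R \<le> \<delta> * (1 + \<bar>R\<bar>)" using \<delta> by (intro mult_left_mono) auto
    also have "\<dots> = - f v / 2" by (simp add: \<delta>_def field_simps)
    finally show ?thesis using f(4) by linarith
  qed
  define F' where "F' i j a = F i j a + (if i = j then of_real \<delta> * s a else 0)" for i j a
  have F'sum: "(\<Sum>i<q. \<Sum>j<q. F' i j (G i j)) = (\<Sum>i<q. \<Sum>j<q. F i j (G i j)) + of_real \<delta> * (\<Sum>i<q. s (G i i))" for G
  proof -
    have "(\<Sum>i<q. \<Sum>j<q. F' i j (G i j)) = (\<Sum>i<q. \<Sum>j<q. F i j (G i j)) + (\<Sum>i<q. \<Sum>j<q. if i = j then of_real \<delta> * s (G i j) else 0)"
      by (simp add: F'_def sum.distrib)
    also have "(\<Sum>i<q. \<Sum>j<q. if i = j then of_real \<delta> * s (G i j) else 0) = (\<Sum>i<q. of_real \<delta> * s (G i i))"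
      by (rule sum.cong) auto
    finally show ?thesis by (simp add: sum_distrib_left)
  qed
  have F': "cp_kernel q F'"
    unfolding cp_kernel_def
  proof (intro conjI allI)
    show "F' i j (x + y) = F' i j x + F' i j y" for i j x y
      by (simp add: F'_def F_add s_add algebra_simps)
    show "F' i j (scaleC c x) = c * F' i j x" for i j c x
      by (simp add: F'_def F_scale s_scale algebra_simps)
    show "0 \<le> (\<Sum>i<q. \<Sum>j<q. F' i j (star (w i) * w j))" for w
      unfolding F'sum using \<delta>
      by (intro add_nonneg_nonneg cp_kernel_nonneg[OF F] mult_nonneg_nonneg sum_nonneg s_sq)
        (simp add: less_eq_complex_def)
  qed
  define T where "T i j = F' i j 1" for i j
  have pd: "posdef_on {..<q} T"
    unfolding posdef_on_def
  proof (intro allI impI)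
    fix x :: "nat \<Rightarrow> complex" assume x: "\<exists>i\<in>{..<q}. x i \<noteq> 0"
    define w where "w i = scaleC (x i) (1::'a)" for i
    have ww: "star (w i) * w j = scaleC (cnj (x i) * x j) 1" for i j
      by (simp add: w_def star_scaleC scaleC_mult_left scaleC_scaleC)
    have "sesq {..<q} T x x = (\<Sum>i<q. \<Sum>j<q. F' i j (star (w i) * w j))"
      by (simp add: sesq_def T_def ww cp_kernel_scale[OF F'] mult_ac)
    also have "\<dots> = (\<Sum>i<q. \<Sum>j<q. F i j (star (w i) * w j)) + of_real \<delta> * (\<Sum>i<q. cnj (x i) * x i)"
      unfolding F'sum by (simp add: ww s_scale s1)
    also have "(\<Sum>i<q. cnj (x i) * x i) = of_real (\<Sum>i<q. (cmod (x i))\<^sup>2)"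
      by (simp add: complex_norm_square[symmetric] mult.commute)
    finally have eq: "sesq {..<q} T x x = (\<Sum>i<q. \<Sum>j<q. F i j (star (w i) * w j)) + of_real (\<delta> * (\<Sum>i<q. (cmod (x i))\<^sup>2))"
      by simp
    obtain i where "i < q" "x i \<noteq> 0" using x by auto
    then have "0 < (\<Sum>i<q. (cmod (x i))\<^sup>2)" by (intro sum_pos2[of _ i]) auto
    then have "0 < complex_of_real (\<delta> * (\<Sum>i<q. (cmod (x i))\<^sup>2))"
      using \<delta> by (simp add: less_complex_def del: of_real_mult of_real_sum of_real_power)
    then show "0 < sesq {..<q} T x x"
      unfolding eq by (intro add_nonneg_pos cp_kernel_nonneg[OF F])
  qed
  obtain S where S: "\<forall>a\<in>{..<q}. \<forall>b\<in>{..<q}. sesq {..<q} T (S a) (S b) = (if a = b then 1 else 0)"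
    and span: "\<forall>x. \<exists>\<xi>. \<forall>i\<in>{..<q}. x i = (\<Sum>a<q. \<xi> a * S a i)"
    using orthonormalize[OF finite_lessThan pd] by (elim exE conjE) (rule that)
  \<comment> \<open>Congruence by a basis that is orthonormal for the form \<open>T\<close>, the
    value of \<open>F'\<close> at 1, makes the map unital.\<close>
  define F'' where "F'' a b x = sesq {..<q} (\<lambda>i j. F' i j x) (S a) (S b)" for a b x
  have F'': "cp_kernel q F''"
    unfolding cp_kernel_def
  proof (intro conjI allI)
    show "F'' i j (x + y) = F'' i j x + F'' i j y" for i j x y
      by (simp add: F''_def sesq_def cp_kernel_add[OF F'] algebra_simps sum.distrib)
    show "F'' i j (scaleC c x) = c * F'' i j x" for i j c x
      by (simp add: F''_def sesq_def cp_kernel_scale[OF F'] sum_distrib_left mult_ac)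
    fix w :: "nat \<Rightarrow> 'a"
    define w' where "w' i = (\<Sum>a<q. scaleC (S a i) (w a))" for i
    have "(\<Sum>i<q. \<Sum>j<q. F' i j (star (w' i) * w' j))
      = (\<Sum>i<q. \<Sum>j<q. \<Sum>a<q. \<Sum>b<q. cnj (S a i) * F' i j (star (w a) * w b) * S b j)"
      by (simp add: w'_def cp_kernel_sesq[OF F'] mult_ac)
    also have "\<dots> = (\<Sum>a<q. \<Sum>b<q. \<Sum>i<q. \<Sum>j<q. cnj (S a i) * F' i j (star (w a) * w b) * S b j)"
    proof -
      define H where "H i j a b = cnj (S a i) * F' i j (star (w a) * w b) * S b j" for i j a b
      have "(\<Sum>i<q. \<Sum>j<q. \<Sum>a<q. \<Sum>b<q. H i j a b) = (\<Sum>i<q. \<Sum>a<q. \<Sum>j<q. \<Sum>b<q. H i j a b)"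
        by (rule sum.cong[OF refl], rule sum.swap)
      also have "\<dots> = (\<Sum>a<q. \<Sum>i<q. \<Sum>j<q. \<Sum>b<q. H i j a b)" by (rule sum.swap)
      also have "\<dots> = (\<Sum>a<q. \<Sum>i<q. \<Sum>b<q. \<Sum>j<q. H i j a b)"
        by (rule sum.cong[OF refl], rule sum.cong[OF refl], rule sum.swap)
      also have "\<dots> = (\<Sum>a<q. \<Sum>b<q. \<Sum>i<q. \<Sum>j<q. H i j a b)"
        by (rule sum.cong[OF refl], rule sum.swap)
      finally show ?thesis by (simp only: H_def)
    qed
    also have "\<dots> = (\<Sum>a<q. \<Sum>b<q. F'' a b (star (w a) * w b))"
      by (simp add: F''_def sesq_def)
    finally show "0 \<le> (\<Sum>a<q. \<Sum>b<q. F'' a b (star (w a) * w b))"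
      using cp_kernel_nonneg[OF F', of w'] by simp
  qed
  define \<psi> where "\<psi> = (\<lambda>x. Matrix.mat q q (\<lambda>(i, j). F'' i j x))"
  have ucp: "ucp (cstar_opsys :: 'a opsys) q \<psi>"
    unfolding \<psi>_def by (rule ucp_of_cp_kernel[OF F'']) (simp add: F''_def S flip: T_def)
  \<comment> \<open>Coordinates of the standard basis vectors with respect to \<open>S\<close>.
    Inserting them undoes the congruence, so the hypothesis \<open>nn\<close> evaluates
    \<open>F'\<close> at \<open>v\<close>.\<close>
  have "\<forall>i. \<exists>\<xi>. \<forall>k\<in>{..<q}. (if k = i then 1 else 0) = (\<Sum>a<q. \<xi> a * S a k)"
  proof
    fix i
    show "\<exists>\<xi>. \<forall>k\<in>{..<q}. (if k = i then 1 else 0) = (\<Sum>a<q. \<xi> a * S a k)"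
      using span by (rule spec)
  qed
  from choice[OF this] obtain \<xi> where
    \<xi>': "\<forall>i. \<forall>k\<in>{..<q}. (if k = i then 1 else 0) = (\<Sum>a<q. \<xi> i a * S a k)"
    by (elim exE) (rule that)
  have \<xi>: "(if k = i then 1 else 0) = (\<Sum>a<q. \<xi> i a * S a k)" if "k < q" for i k
    using \<xi>' that by simp
  have "(\<Sum>a<q. \<Sum>b<q. cnj (\<xi> i a) * \<psi> x $$ (a, b) * \<xi> j b) = F' i j x" if "i < q" "j < q" for i j x
  proof -
    have "(\<Sum>a<q. \<Sum>b<q. cnj (\<xi> i a) * \<psi> x $$ (a, b) * \<xi> j b)
      = sesq {..<q} (\<lambda>i j. F' i j x) (\<lambda>k. \<Sum>a<q. \<xi> i a * S a k) (\<lambda>k. \<Sum>a<q. \<xi> j a * S a k)"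
      by (simp add: \<psi>_def F''_def flip: sum_sandwich)
    also have "\<dots> = sesq {..<q} (\<lambda>i j. F' i j x) (\<lambda>k. if k = i then 1 else 0) (\<lambda>k. if k = j then 1 else 0)"
      by (rule sesq_cong) (simp_all add: \<xi>[symmetric])
    also have "\<dots> = F' i j x" using that by (intro sesq_delta) auto
    finally show ?thesis .
  qed
  then have "(\<Sum>i<q. \<Sum>j<q. \<Sum>a<q. \<Sum>b<q. cnj (\<xi> i a) * \<psi> (ent v i j) $$ (a, b) * \<xi> j b)
      = (\<Sum>i<q. \<Sum>j<q. F' i j (ent v i j))"
    by (intro sum.cong) auto
  with nn[OF ucp, of \<xi>] have "0 \<le> Re (\<Sum>i<q. \<Sum>j<q. F' i j (ent v i j))" by simp
  also have "\<dots> = f v + \<delta> * R"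
    unfolding F'sum by (simp add: Re_F R_def fcorner[of v])
  finally show False using \<delta>R by simp
qed

section \<open>Coordinates in \<open>E\<^sub>n' \<otimes> A\<close>\<close>

lemma Rep_eprime_simps [simp]:
  "Rep_eprime 0 = 0" "Rep_eprime (v + w) = Rep_eprime v + Rep_eprime w"
  "Rep_eprime (scaleC c v) = matrix_scale c (Rep_eprime v)"
  "Rep_eprime one_eprime = Finite_Cartesian_Product.mat 1"
  by (simp_all add: zero_eprime.rep_eq plus_eprime.rep_eq scaleC_eprime.rep_eq one_eprime.rep_eq)

lemma Rep_eprime_sum: "Rep_eprime (sum f A) = (\<Sum>i\<in>A. Rep_eprime (f i))"
  by (induction A rule: infinite_finite_induct) simp_all

lift_definition ecol :: "'n \<Rightarrow> 'n::finite eprime" is "\<lambda>i. matrix_unit (Some i) None"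
  by (rule Modules.module.span_base[OF module_matrix_scale]) auto

lift_definition erow :: "'n \<Rightarrow> 'n::finite eprime" is "\<lambda>i. matrix_unit None (Some i)"
  by (rule Modules.module.span_base[OF module_matrix_scale]) auto

lemmas ecol_erow_rep [simp] = ecol.rep_eq erow.rep_eq

lemma eprime_entries:
  fixes v :: "'n::finite eprime"
  shows "Rep_eprime v $ Some i $ Some j = (if i = j then Rep_eprime v $ None $ None else 0)"
proof -
  interpret Modules.module "matrix_scale :: complex \<Rightarrow> complex^('n option)^('n option) \<Rightarrow> _"
    by (rule module_matrix_scale)
  let ?W = "{M :: complex^('n option)^('n option).
    \<forall>i j. M $ Some i $ Some j = (if i = j then M $ None $ None else 0)}"
  have "subspace ?W" by (rule subspaceI) (auto simp: matrix_scale_def)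
  then have "span ({Finite_Cartesian_Product.mat 1}
      \<union> (\<Union>i. {matrix_unit (Some i) None, matrix_unit None (Some i)})) \<subseteq> ?W"
    by (intro span_minimal) (auto simp: matrix_unit_def Finite_Cartesian_Product.mat_def)
  then show ?thesis using Rep_eprime[of v] by auto
qed

lemma eprime_decomp:
  fixes v :: "'n::finite eprime"
  shows "v = scaleC (Rep_eprime v $ None $ None) one_eprime
    + (\<Sum>i\<in>UNIV. scaleC (Rep_eprime v $ Some i $ None) (ecol i))
    + (\<Sum>i\<in>UNIV. scaleC (Rep_eprime v $ None $ Some i) (erow i))" (is "v = ?r")
proof -
  have nth: "matrix_scale c (matrix_unit a b) $ x $ y = (if x = a \<and> y = b then c else 0)"
    for c and a b x y :: "'n option"
    by (simp add: matrix_scale_def matrix_unit_def)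
  have col: "Rep_eprime (\<Sum>i\<in>UNIV. scaleC (f i) (ecol i)) $ x $ y
      = (case x of None \<Rightarrow> 0 | Some i \<Rightarrow> if y = None then f i else 0)" for f :: "'n \<Rightarrow> complex" and x y
    by (cases x; cases y) (simp_all add: Rep_eprime_sum nth)
  have row: "Rep_eprime (\<Sum>i\<in>UNIV. scaleC (f i) (erow i)) $ x $ y
      = (case y of None \<Rightarrow> 0 | Some i \<Rightarrow> if x = None then f i else 0)" for f :: "'n \<Rightarrow> complex" and x y
    by (cases x; cases y) (simp_all add: Rep_eprime_sum nth)
  have one: "Rep_eprime (scaleC c one_eprime) $ x $ y = (if x = y then c else 0)" for c and x y :: "'n option"
    by (simp add: matrix_scale_def Finite_Cartesian_Product.mat_def)
  define r where "r = ?r"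
  have eq: "Rep_eprime r $ x $ y = (if x = y then Rep_eprime v $ None $ None else 0)
      + (case x of None \<Rightarrow> 0 | Some i \<Rightarrow> if y = None then Rep_eprime v $ Some i $ None else 0)
      + (case y of None \<Rightarrow> 0 | Some i \<Rightarrow> if x = None then Rep_eprime v $ None $ Some i else 0)" for x y
    unfolding r_def by (simp only: Rep_eprime_simps(2) vector_add_component col row one)
  have "Rep_eprime v $ x $ y = Rep_eprime r $ x $ y" for x y
    unfolding eq by (cases x; cases y) (simp_all add: eprime_entries)
  then have "Rep_eprime v = Rep_eprime r" by (simp add: vec_eq_iff)
  then have "v = r" by (simp only: Rep_eprime_inject)
  then show ?thesis by (simp only: r_def)
qed

lemma pure_tensor_0_left [simp]: "0 \<otimes>\<^sub>t w = 0"
  using pure_tensor_add_left[of 0 0 w] by simp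

lemma pure_tensor_0_right [simp]: "v \<otimes>\<^sub>t 0 = 0"
  using pure_tensor_add_right[of v 0 0] by simp

lemma pure_tensor_sum_left: "(\<Sum>i\<in>A. f i) \<otimes>\<^sub>t w = (\<Sum>i\<in>A. f i \<otimes>\<^sub>t w)"
  by (induction A rule: infinite_finite_induct) (simp_all add: pure_tensor_add_left)

lemma pure_tensor_sum_right: "v \<otimes>\<^sub>t (\<Sum>i\<in>A. f i) = (\<Sum>i\<in>A. v \<otimes>\<^sub>t f i)"
  by (induction A rule: infinite_finite_induct) (simp_all add: pure_tensor_add_right)

lemma tensor_induct [case_names pure add]:
  assumes pure: "\<And>v w. P (v \<otimes>\<^sub>t w)" and add: "\<And>x y. P x \<Longrightarrow> P y \<Longrightarrow> P (x + y)"
  shows "P u"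
proof -
  have "P (abs_tensor f)" for f
  proof (induction f rule: update_induct)
    case const
    have "P (0 \<otimes>\<^sub>t 0)" by (rule pure)
    then show ?case by (simp add: zero_tensor_def)
  next
    case (update f k c)
    obtain v w where k: "k = (v, w)" by (cases k)
    have "Poly_Mapping.update k c f = Poly_Mapping.single k c + f"
      by (rule poly_mapping_eqI)
        (use update.hyps in \<open>auto simp: lookup_update lookup_add lookup_single when_def in_keys_iff\<close>)
    moreover have "abs_tensor (Poly_Mapping.single k c) = scaleC c v \<otimes>\<^sub>t w"
      unfolding pure_tensor_scaleC_left k by (simp add: pure_tensor.abs_eq scaleC_tensor.abs_eq)
    ultimately have "abs_tensor (Poly_Mapping.update k c f) = scaleC c v \<otimes>\<^sub>t w + abs_tensor f"
      by (simp only: plus_tensor.abs_eq[symmetric])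
    then show ?case using add[OF pure update.IH] by simp
  qed
  from this[of "rep_tensor u"] show ?thesis
    by (simp add: Quotient_abs_rep[OF Quotient_tensor])
qed

definition arrow_tensor :: "'a \<Rightarrow> ('n \<Rightarrow> 'a) \<Rightarrow> ('n \<Rightarrow> 'a) \<Rightarrow> ('n::finite eprime, 'a::complex_vector) tensor" where
  "arrow_tensor c a b = one_eprime \<otimes>\<^sub>t c + (\<Sum>i\<in>UNIV. ecol i \<otimes>\<^sub>t a i) + (\<Sum>i\<in>UNIV. erow i \<otimes>\<^sub>t b i)"

lemma arrow_tensor_add:
  "arrow_tensor c a b + arrow_tensor c' a' b' = arrow_tensor (c + c') (\<lambda>i. a i + a' i) (\<lambda>i. b i + b' i)"
  by (simp add: arrow_tensor_def pure_tensor_add_right sum.distrib algebra_simps)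

lemma ex_arrow_tensor: "\<exists>c a b. u = arrow_tensor c a b"
proof (induction u rule: tensor_induct)
  case (pure v w)
  have "v \<otimes>\<^sub>t w = arrow_tensor (scaleC (Rep_eprime v $ None $ None) w)
      (\<lambda>i. scaleC (Rep_eprime v $ Some i $ None) w) (\<lambda>i. scaleC (Rep_eprime v $ None $ Some i) w)"
    by (subst eprime_decomp)
      (simp add: arrow_tensor_def pure_tensor_add_left pure_tensor_sum_left pure_tensor_scaleC_left pure_tensor_scaleC_right)
  then show ?case by blast
next
  case (add x y)
  then show ?case using arrow_tensor_add by metis
qed

text \<open>The entries of \<open>arrow_tensor c a b\<close> under the inclusion of
  \<open>E_n'\<close> into the matrices indexed by \<open>'n option\<close>.\<close>

definition arrow_entry :: "'a::zero \<Rightarrow> ('n \<Rightarrow> 'a) \<Rightarrow> ('n \<Rightarrow> 'a) \<Rightarrow> 'n option \<Rightarrow> 'n option \<Rightarrow> 'a" where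
  "arrow_entry c a b x y = (case x of
      None \<Rightarrow> (case y of None \<Rightarrow> c | Some j \<Rightarrow> b j)
    | Some i \<Rightarrow> (case y of None \<Rightarrow> a i | Some j \<Rightarrow> if i = j then c else 0))"

section \<open>Consequences of positivity in the minimal tensor product\<close>

lemma bilinear_form_kron:
  assumes "\<And>v w. \<phi> (v + w) = \<phi> v + \<phi> w" "\<And>c v. \<phi> (scaleC c v) = c \<cdot>\<^sub>m \<phi> v"
    "\<And>v w. \<psi> (v + w) = \<psi> v + \<psi> w" "\<And>c v. \<psi> (scaleC c v) = c \<cdot>\<^sub>m \<psi> v"
    "\<And>v. \<phi> v \<in> carrier_mat k k" "\<And>v. \<psi> v \<in> carrier_mat m m" "x < k * m" "y < k * m"
  shows "bilinear_form (\<lambda>v w. kron (*) (\<phi> v) (\<psi> w) $$ (x, y))"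
    and "kron (*) (\<phi> v) (\<psi> w) $$ (x, y) = \<phi> v $$ (x div m, y div m) * \<psi> w $$ (x mod m, y mod m)"
proof -
  have d: "dim_row (\<phi> v) = k" "dim_col (\<phi> v) = k" "dim_row (\<psi> w) = m" "dim_col (\<psi> w) = m" for v w
    using assms(5)[of v] assms(6)[of w] by auto
  have k: "x div m < k" "y div m < k" using assms(7,8) by (simp_all add: less_mult_imp_div_less)
  have m: "x mod m < m" "y mod m < m" using assms(7,8) by (metis mod_less_divisor mult_0_right not_less0 gr0I)+
  show eq: "kron (*) (\<phi> v) (\<psi> w) $$ (x, y) = \<phi> v $$ (x div m, y div m) * \<psi> w $$ (x mod m, y mod m)" for v w
    using assms(7,8) by (simp add: kron_def d)
  show "bilinear_form (\<lambda>v w. kron (*) (\<phi> v) (\<psi> w) $$ (x, y))"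
    unfolding bilinear_form_def eq assms(1-4)
    using d k m by (simp add: algebra_simps)
qed

lemma tensor_lift_sum:
  assumes "bilinear_form B"
  shows "tensor_lift B (sum f A) = (\<Sum>i\<in>A. tensor_lift B (f i))"
proof -
  have "tensor_lift B 0 = 0" using tensor_lift_add[OF assms, of 0 0] by simp
  then show ?thesis
    by (induction A rule: infinite_finite_induct) (simp_all add: tensor_lift_add[OF assms])
qed

lemma tensor_lift_arrow_tensor:
  assumes "bilinear_form B"
  shows "tensor_lift B (arrow_tensor c a b) = B one_eprime c + (\<Sum>i\<in>UNIV. B (ecol i) (a i)) + (\<Sum>i\<in>UNIV. B (erow i) (b i))"
  by (simp add: arrow_tensor_def tensor_lift_add[OF assms] tensor_lift_sum[OF assms] tensor_lift_pure[OF assms])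

lemma psd_on_reindex:
  fixes f :: "'i \<Rightarrow> 'j"
  assumes f: "bij_betw f I J" and "\<And>i j. i \<in> I \<Longrightarrow> j \<in> I \<Longrightarrow> T i j = T' (f i) (f j)"
  shows "psd_on I T \<longleftrightarrow> psd_on J T'"
proof -
  have *: "sesq J T' y y = sesq I T (y \<circ> f) (y \<circ> f)" for y
    unfolding sesq_def
    by (simp add: sum.reindex_bij_betw[OF f, symmetric] assms(2) cong: sum.cong)
  have inv: "\<exists>y. \<forall>i\<in>I. x i = y (f i)" for x :: "'i \<Rightarrow> complex"
    using f by (intro exI[of _ "x \<circ> inv_into I f"]) (auto simp: bij_betw_def)
  show ?thesis
  proof
    assume I: "psd_on I T"
    then show "psd_on J T'" by (simp add: psd_on_sesq *)
  next
    assume J: "psd_on J T'"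
    show "psd_on I T" unfolding psd_on_sesq
    proof
      fix x :: "'i \<Rightarrow> complex"
      obtain y where "\<forall>i\<in>I. x i = y (f i)" using inv[of x] by blast
      then have "sesq I T x x = sesq I T (y \<circ> f) (y \<circ> f)" by (intro sesq_cong) auto
      then show "0 \<le> sesq I T x x" using J * by (simp add: psd_on_sesq)
    qed
  qed
qed

text \<open>The Gram matrix of the row \<open>(1, x)\<close> has off-diagonal entries
  \<open>x\<close> and \<open>star x\<close>; its image is positive, hence hermitian. This recovers
  the involution, which \<open>ucp\<close> does not mention.\<close>

lemma ucp_star:
  fixes \<psi> :: "'a::unital_cstar_algebra \<Rightarrow> complex mat"
  assumes \<psi>: "ucp cstar_opsys m \<psi>" and "l < m" "l' < m"
  shows "\<psi> (star x) $$ (l', l) = cnj (\<psi> x $$ (l, l'))"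
proof -
  define Y where "Y = Matrix.mat 2 2 (\<lambda>(i, j). if i = 0 then (if j = 0 then 1 else x) else 0)"
  have Y: "Y \<in> carrier_mat 2 2" by (simp add: Y_def)
  define P where "P = star_mat Y * Y"
  have "P \<in> os_cone cstar_opsys 2" using Y by (auto simp: cstar_opsys_def P_def)
  then have "map_mat \<psi> P \<in> matrix_cone m 2" using \<psi> by (auto simp: ucp_def)
  then have psd: "psd_on ({..<2} \<times> {..<m}) (\<lambda>(i, a) (j, b). map_mat \<psi> P $$ (i, j) $$ (a, b))"
    by (simp add: matrix_cone_def)
  have P: "P \<in> carrier_mat 2 2" using Y by (auto simp: P_def star_mat_def)
  have 01: "P $$ (0, Suc 0) = x" "P $$ (Suc 0, 0) = star x"
    unfolding P_def by (subst star_mat_mult_self_index[OF Y]; simp add: Y_def numeral_2_eq_2)+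
  have "map_mat \<psi> P $$ (1, 0) $$ (l', l) = cnj (map_mat \<psi> P $$ (0, 1) $$ (l, l'))"
    using psd_on_hermitian[OF _ psd, of "(0, l)" "(1, l')"] assms(2,3) by simp
  then show ?thesis using P by (simp add: 01)
qed

lemma sum_of_squares_scaleR: "sum_of_squares h \<Longrightarrow> r \<ge> 0 \<Longrightarrow> sum_of_squares (r *\<^sub>R h)"
proof -
  assume "sum_of_squares h" and r: "r \<ge> 0"
  then obtain n :: nat and x where "h = (\<Sum>l<n. star (x l) * x l)" by (auto simp: sum_of_squares_def)
  then have "r *\<^sub>R h = (\<Sum>l<n. star (sqrt r *\<^sub>R x l) * (sqrt r *\<^sub>R x l))"
    using r by (simp add: star_scaleR scaleR_sum_right)
  then show ?thesis
    unfolding sum_of_squares_def by (intro exI[of _ n] exI[of _ "\<lambda>l. sqrt r *\<^sub>R x l"])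
qed

text \<open>By \<open>pos_if_ucp_nonneg\<close>, the real part \<open>g\<close> of any multiple of
  \<open>x\<close>, and likewise \<open>- g\<close>, becomes a sum of squares after adding any
  \<epsilon> > 0. \<open>norm_le_1_if_sums_of_squares\<close>, rescaled by \<epsilon>, then gives
  \<open>norm g \<le> \<epsilon>\<close>.\<close>

lemma eq_0_if_ucp_eq_0:
  fixes x :: "'a::unital_cstar_algebra"
  assumes 0: "\<And>m \<psi> l l'. ucp (cstar_opsys :: 'a opsys) m \<psi> \<Longrightarrow> l < m \<Longrightarrow> l' < m \<Longrightarrow> \<psi> x $$ (l, l') = 0"
  shows "x = 0"
proof -
  have re: "scaleC c x + star (scaleC c x) = 0" for c
  proof -
    have sos: "sum_of_squares (scaleC d x + star (scaleC d x) + of_real \<epsilon>)" if "\<epsilon> > 0" for d and \<epsilon> :: real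
    proof -
      let ?v = "mk 0 0 (scaleC d x)"
      have "pos (corner 1 * (?v + adj ?v) * corner 1 + \<epsilon> *\<^sub>R corner 1)"
      proof (rule pos_if_ucp_nonneg[OF _ that])
        fix m \<psi> \<xi> assume u: "ucp (cstar_opsys :: 'a opsys) m \<psi>"
        have "\<psi> (scaleC d x) $$ (l, l') = 0" if "l < m" "l' < m" for l l'
        proof -
          have "\<psi> (scaleC d x) = d \<cdot>\<^sub>m \<psi> x" "\<psi> x \<in> carrier_mat m m" using u by (auto simp: ucp_def)
          then show ?thesis using 0[OF u that] that by simp
        qed
        then show "0 \<le> Re (\<Sum>i<1. \<Sum>j<1. \<Sum>a<m. \<Sum>b<m. cnj (\<xi> i a) * \<psi> (ent ?v i j) $$ (a, b) * \<xi> j b)"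
          by simp
      qed
      from pos_mk_sum_of_squares[OF this] show ?thesis by (simp add: of_real_def)
    qed
    define g where "g = scaleC c x + star (scaleC c x)"
    have g: "star g = g" by (simp add: g_def star_add star_star add.commute)
    have "norm g \<le> \<epsilon>" if "\<epsilon> > 0" for \<epsilon> :: real
    proof -
      have "sum_of_squares (g + of_real \<epsilon>)" using sos[of \<epsilon> c] that by (simp add: g_def)
      moreover have "sum_of_squares (- g + of_real \<epsilon>)"
        using sos[of \<epsilon> "- c"] that by (simp add: g_def scaleC_minus_left star_minus)
      ultimately have s: "sum_of_squares ((1/\<epsilon>) *\<^sub>R (g + of_real \<epsilon>))" "sum_of_squares ((1/\<epsilon>) *\<^sub>R (- g + of_real \<epsilon>))"
        using that by (auto intro!: sum_of_squares_scaleR)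
      have e: "(1/\<epsilon>) *\<^sub>R (g + of_real \<epsilon>) = 1 + (1/\<epsilon>) *\<^sub>R g" "(1/\<epsilon>) *\<^sub>R (- g + of_real \<epsilon>) = 1 - (1/\<epsilon>) *\<^sub>R g"
        using that by (simp_all add: scaleR_add_right scaleR_diff_right of_real_def)
      have "norm ((1/\<epsilon>) *\<^sub>R g) \<le> 1"
        by (rule norm_le_1_if_sums_of_squares) (use s g in \<open>simp_all only: e star_scaleR\<close>)
      then show ?thesis using that by (simp add: field_simps)
    qed
    then have "norm g \<le> 0" by (meson dense_ge)
    then show ?thesis by (simp add: g_def)
  qed
  \<comment> \<open>\<open>c = 1\<close> makes \<open>x\<close> skew, \<open>c = \<i>\<close> makes
    it selfadjoint.\<close>
  have 1: "star x = - x" using re[of 1] by (simp add: eq_neg_iff_add_eq_0 add.commute)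
  have "scaleC \<i> x + scaleC \<i> x = 0"
    using re[of \<i>] by (simp add: star_scaleC 1 scaleC_minus_left scaleC_minus_right)
  then have "scaleC (2 * \<i>) x = 0" by (simp only: mult_2 scaleC_add_left)
  then have "scaleC (- \<i>) (scaleC (2 * \<i>) x) = 0" by (simp only: scaleC_0_right)
  then have "scaleC (- \<i> * (2 * \<i>)) x = 0" by (simp only: scaleC_scaleC)
  moreover have "- \<i> * (2 * \<i>) = (2::complex)" by (simp add: complex_eq_iff)
  ultimately have "scaleC 2 x = 0" by (simp only:)
  then have "scaleC (1/2) (scaleC 2 x) = 0" by simp
  then show ?thesis by (simp add: scaleC_scaleC)
qed

text \<open>The inclusion of \<open>E_n'\<close> into the full matrix algebra is ucp. Taken as
  \<open>\<phi>\<close>, it turns membership in the minimal cone into positivity of every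
  \<open>\<psi>\<close> on the arrow matrix.\<close>

lemma min_cone_psd:
  fixes c :: "nat \<Rightarrow> nat \<Rightarrow> 'a::unital_cstar_algebra" and a b :: "nat \<Rightarrow> nat \<Rightarrow> 'n::finite \<Rightarrow> 'a"
  assumes U: "U \<in> os_cone (min_tensor (eprime_opsys :: 'n eprime opsys) (cstar_opsys :: 'a opsys)) p"
    and dec: "\<And>s s'. s < p \<Longrightarrow> s' < p \<Longrightarrow> U $$ (s, s') = arrow_tensor (c s s') (a s s') (b s s')"
    and \<psi>: "ucp (cstar_opsys :: 'a opsys) m \<psi>"
  shows "psd_on ((UNIV \<times> {..<p}) \<times> {..<m})
    (\<lambda>((x, s), l) ((y, s'), l'). \<psi> (arrow_entry (c s s') (a s s') (b s s') x y) $$ (l, l'))"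
proof -
  define k where "k = CARD('n option)"
  obtain g where g: "bij_betw g {..<k} (UNIV :: 'n option set)"
    using ex_bij_betw_nat_finite[of "UNIV :: 'n option set"] unfolding k_def atLeast0LessThan by auto
  define \<phi> where "\<phi> = (\<lambda>v :: 'n eprime. Matrix.mat k k (\<lambda>(i, j). Rep_eprime v $ g i $ g j))"
  have \<phi>: "ucp eprime_opsys k \<phi>"
    unfolding ucp_def
  proof (intro conjI allI ballI)
    show "\<phi> v \<in> carrier_mat k k" for v by (simp add: \<phi>_def)
    show "\<phi> (v + w) = \<phi> v + \<phi> w" for v w by (rule eq_matI) (auto simp: \<phi>_def)
    show "\<phi> (scaleC c v) = c \<cdot>\<^sub>m \<phi> v" for c v by (rule eq_matI) (auto simp: \<phi>_def matrix_scale_def)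
    have "g i = g j \<longleftrightarrow> i = j" if "i < k" "j < k" for i j
      using g that by (auto simp: bij_betw_def inj_on_def)
    then show "\<phi> (os_unit eprime_opsys) = 1\<^sub>m k"
      by (intro eq_matI) (auto simp: \<phi>_def eprime_opsys_def Finite_Cartesian_Product.mat_def)
    fix r and P :: "'n eprime mat" assume "P \<in> os_cone eprime_opsys r"
    then have P: "P \<in> carrier_mat r r"
      "psd_on ({..<r} \<times> UNIV) (\<lambda>(i, a) (j, b). Rep_eprime (P $$ (i, j)) $ a $ b)"
      by (auto simp: eprime_opsys_def)
    have "bij_betw (map_prod id g) ({..<r} \<times> {..<k}) ({..<r} \<times> UNIV)"
      using g by (intro bij_betw_map_prod) auto
    then have "psd_on ({..<r} \<times> {..<k}) (\<lambda>(i, a) (j, b). map_mat \<phi> P $$ (i, j) $$ (a, b)) \<longleftrightarrow>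
        psd_on ({..<r} \<times> UNIV) (\<lambda>(i, a) (j, b). Rep_eprime (P $$ (i, j)) $ a $ b)"
      by (rule psd_on_reindex) (use P(1) in \<open>auto simp: \<phi>_def\<close>)
    with P(2) have "psd_on ({..<r} \<times> {..<k}) (\<lambda>(i, a) (j, b). map_mat \<phi> P $$ (i, j) $$ (a, b))"
      by simp
    then show "map_mat \<phi> P \<in> matrix_cone k r" using P by (auto simp: matrix_cone_def \<phi>_def)
  qed
  have U': "U \<in> carrier_mat p p" "map_mat (tensor_map k m \<phi> \<psi>) U \<in> matrix_cone (k * m) p"
    using U \<phi> \<psi> by (auto simp: min_tensor_def)
  then have psd: "psd_on ({..<p} \<times> {..<k * m})
      (\<lambda>(s, i) (s', j). map_mat (tensor_map k m \<phi> \<psi>) U $$ (s, s') $$ (i, j))"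
    by (simp add: matrix_cone_def)
  \<comment> \<open>Splits a Kronecker index into the matrix position \<open>g (i div m)\<close> and
    the coordinate \<open>i mod m\<close> for \<open>\<psi>\<close>.\<close>
  define f :: "nat \<times> nat \<Rightarrow> ('n option \<times> nat) \<times> nat" where "f = (\<lambda>(s, i). ((g (i div m), s), i mod m))"
  have f: "bij_betw f ({..<p} \<times> {..<k * m}) ((UNIV \<times> {..<p}) \<times> {..<m})"
  proof (rule bij_betw_byWitness[where f' = "\<lambda>((x, s), l). (s, inv_into {..<k} g x * m + l)"])
    have gi: "g (inv_into {..<k} g x) = x" "inv_into {..<k} g x < k" for x
      using g by (auto simp: bij_betw_def f_inv_into_f intro!: inv_into_into[of x g "{..<k}", simplified])
    have ig: "inv_into {..<k} g (g i) = i" if "i < k" for i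
      using g that by (auto simp: bij_betw_def)
    show "\<forall>z\<in>{..<p} \<times> {..<k * m}. (case f z of (xa, b) \<Rightarrow> (case xa of (x, s) \<Rightarrow> \<lambda>l. (s, inv_into {..<k} g x * m + l)) b) = z"
      by (auto simp: f_def ig less_mult_imp_div_less)
    show "\<forall>z\<in>(UNIV \<times> {..<p}) \<times> {..<m}. f (case z of (xa, b) \<Rightarrow> (case xa of (x, s) \<Rightarrow> \<lambda>l. (s, inv_into {..<k} g x * m + l)) b) = z"
      by (auto simp: f_def gi)
    have "m > 0" if "i < k * m" for i using that by (cases m) auto
    then show "f ` ({..<p} \<times> {..<k * m}) \<subseteq> (UNIV \<times> {..<p}) \<times> {..<m}"
      by (auto simp: f_def)
    have "inv_into {..<k} g x * m + l < k * m" if "l < m" for x l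
    proof -
      have "inv_into {..<k} g x * m + l < Suc (inv_into {..<k} g x) * m" using that by simp
      also have "\<dots> \<le> k * m" using gi(2)[of x] by (intro mult_le_mono1) simp
      finally show ?thesis .
    qed
    then show "(\<lambda>((x, s), l). (s, inv_into {..<k} g x * m + l)) ` ((UNIV \<times> {..<p}) \<times> {..<m}) \<subseteq> {..<p} \<times> {..<k * m}"
      by auto
  qed
  show ?thesis
  proof (rule psd_on_reindex[OF f, THEN iffD1, OF _ psd])
    fix z z' assume "z \<in> {..<p} \<times> {..<k * m}" "z' \<in> {..<p} \<times> {..<k * m}"
    then obtain s i s' j where z: "z = (s, i)" "z' = (s', j)" "s < p" "s' < p" "i < k * m" "j < k * m"
      by auto
    note u\<phi> = \<phi>[unfolded ucp_def] and u\<psi> = \<psi>[unfolded ucp_def]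
    have B: "bilinear_form (\<lambda>v w. kron (*) (\<phi> v) (\<psi> w) $$ (i, j))"
      and eq: "kron (*) (\<phi> v) (\<psi> w) $$ (i, j) = \<phi> v $$ (i div m, j div m) * \<psi> w $$ (i mod m, j mod m)" for v w
      using bilinear_form_kron[of \<phi> \<psi> k m i j] u\<phi> u\<psi> z by blast+
    have m: "m > 0" using z by (cases m) auto
    have k: "i div m < k" "j div m < k" using z by (simp_all add: less_mult_imp_div_less)
    have ij: "i mod m < m" "j mod m < m" using m by auto
    let ?\<psi> = "\<lambda>w. \<psi> w $$ (i mod m, j mod m)"
    have \<psi>0: "?\<psi> 0 = 0"
    proof -
      have "\<psi> (scaleC 0 0) = 0 \<cdot>\<^sub>m \<psi> 0" and car: "\<psi> 0 \<in> carrier_mat m m" using u\<psi> by blast+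
      then have "\<psi> 0 = 0 \<cdot>\<^sub>m \<psi> 0" by (simp only: scaleC_0_left)
      then have "\<psi> 0 $$ (i mod m, j mod m) = (0 \<cdot>\<^sub>m \<psi> 0) $$ (i mod m, j mod m)" by (rule arg_cong)
      also have "\<dots> = 0" using carrier_matD[OF car] ij by (subst index_smult_mat(1)) auto
      finally show ?thesis .
    qed
    have ru: "Rep_eprime (ecol l) $ x $ y = (if x = Some l \<and> y = None then 1 else 0)"
      "Rep_eprime (erow l) $ x $ y = (if x = None \<and> y = Some l then 1 else 0)"
      "Rep_eprime one_eprime $ x $ y = (if x = y then 1 else 0)" for x y :: "'n option" and l
      by (auto simp: matrix_unit_def Finite_Cartesian_Product.mat_def)
    have "map_mat (tensor_map k m \<phi> \<psi>) U $$ (s, s') $$ (i, j)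
      = tensor_lift (\<lambda>v w. kron (*) (\<phi> v) (\<psi> w) $$ (i, j)) (arrow_tensor (c s s') (a s s') (b s s'))"
      using U'(1) z by (simp add: tensor_map_def dec)
    also have "\<dots> = ?\<psi> (arrow_entry (c s s') (a s s') (b s s') (g (i div m)) (g (j div m)))"
      unfolding tensor_lift_arrow_tensor[OF B] unfolding eq
      using k by (cases "g (i div m)"; cases "g (j div m)")
        (auto simp: \<phi>_def ru arrow_entry_def \<psi>0 if_distrib[of "\<lambda>x. x * _"] cong: if_cong simp del: Rep_eprime_simps ecol_erow_rep)
    finally show "(\<lambda>(s, i) (s', j). map_mat (tensor_map k m \<phi> \<psi>) U $$ (s, s') $$ (i, j)) z z'
      = (\<lambda>((x, s), l) ((y, s'), l'). \<psi> (arrow_entry (c s s') (a s s') (b s s') x y) $$ (l, l')) (f z) (f z')"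
      by (simp add: z f_def)
  qed
qed

lemma ent_mk_mult: "ent (mk i j x * f) k l = (if k = i then x * ent f j l else 0)"
proof -
  have "ent (mk i j x * f) k l = (\<Sum>r<Suc j. ent (mk i j x) k r * ent f r l)"
    by (rule ent_mult) auto
  also have "\<dots> = (\<Sum>r<Suc j. if r = j then (if k = i then x * ent f j l else 0) else 0)"
    by (rule sum.cong) auto
  finally show ?thesis by simp
qed

lemma ent_mult_mk: "ent (f * mk i j x) k l = (if l = j then ent f k i * x else 0)"
proof -
  have "ent (f * mk i j x) k l = (\<Sum>r<Suc i. ent f k r * ent (mk i j x) r l)"
    by (rule ent_mult) auto
  also have "\<dots> = (\<Sum>r<Suc i. if r = i then (if l = j then ent f k i * x else 0) else 0)"
    by (rule sum.cong) auto
  finally show ?thesis by simp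
qed

lemma mk_sandwich_sum:
  "(\<Sum>s<p. \<Sum>s'<p. mk s (f s) 1 * W * mk (g s') s' 1) = block p (\<lambda>s s'. ent W (f s) (g s'))"
proof (rule rcf_eqI)
  fix i j
  have "ent (mk s (f s) 1 * W * mk (g s') s' 1) i j = (if i = s then if j = s' then ent W (f s) (g s') else 0 else 0)" for s s'
    by (simp add: ent_mult_mk ent_mk_mult)
  then have "ent (\<Sum>s<p. \<Sum>s'<p. mk s (f s) 1 * W * mk (g s') s' 1) i j
      = (\<Sum>s<p. \<Sum>s'<p. if i = s then if j = s' then ent W (f s) (g s') else 0 else 0)"
    by (simp only: ent_sum)
  also have "\<dots> = (\<Sum>s<p. if i = s then if j < p then ent W (f s) (g j) else 0 else 0)"
    by (rule sum.cong) auto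
  also have "\<dots> = ent (block p (\<lambda>s s'. ent W (f s) (g s'))) i j" by simp
  finally show "ent (\<Sum>s<p. \<Sum>s'<p. mk s (f s) 1 * W * mk (g s') s' 1) i j
    = ent (block p (\<lambda>s s'. ent W (f s) (g s'))) i j" .
qed

text \<open>The columns of a square root of the arrow matrix, grouped into blocks.\<close>

lemma min_cone_imp_blocks:
  fixes U :: "('n::finite eprime, 'a::unital_cstar_algebra) tensor mat"
  assumes U: "U \<in> os_cone (min_tensor (eprime_opsys :: 'n eprime opsys) (cstar_opsys :: 'a opsys)) p"
  obtains c a b where
    "\<And>s s'. s < p \<Longrightarrow> s' < p \<Longrightarrow> U $$ (s, s') = arrow_tensor (c s s') (a s s') (b s s')"
    "\<And>\<epsilon>::real. \<epsilon> > 0 \<Longrightarrow> \<exists>y. (\<forall>x. y x * corner p = y x) \<and> (\<forall>x x'. adj (y x) * y x' =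
      block p (\<lambda>s s'. arrow_entry (c s s' + (if s = s' then of_real \<epsilon> else 0)) (a s s') (b s s') x x'))"
proof -
  have "\<forall>z. \<exists>t. U $$ z = arrow_tensor (fst t) (fst (snd t)) (snd (snd t))"
  proof
    fix z
    obtain c a b where "U $$ z = arrow_tensor c a b" using ex_arrow_tensor by blast
    then show "\<exists>t. U $$ z = arrow_tensor (fst t) (fst (snd t)) (snd (snd t))"
      by (intro exI[of _ "(c, a, b)"]) simp
  qed
  from choice[OF this] obtain t where t: "\<forall>z. U $$ z = arrow_tensor (fst (t z)) (fst (snd (t z))) (snd (snd (t z)))"
    by (elim exE) (rule that)
  define c a b where "c = (\<lambda>s s'. fst (t (s, s')))" "a = (\<lambda>s s'. fst (snd (t (s, s'))))" "b = (\<lambda>s s'. snd (snd (t (s, s'))))"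
  have dec: "U $$ (s, s') = arrow_tensor (c s s') (a s s') (b s s')" for s s'
    using t by (simp add: c_a_b_def)
  define h where "h = (\<lambda>(x, s) (x', s'). arrow_entry (c s s') (a s s') (b s s') x x')"
  define I where "I = (UNIV :: 'n option set) \<times> {..<p}"
  note psd = min_cone_psd[OF U dec]
  have psd': "psd_on (I \<times> {..<m}) (\<lambda>(i, l) (j, l'). \<psi> (h i j) $$ (l, l'))" if "ucp (cstar_opsys :: 'a opsys) m \<psi>" for m \<psi>
    using psd[OF that] by (simp add: h_def I_def case_prod_unfold)
  have finI: "finite I" by (simp add: I_def)
  \<comment> \<open>Symmetry is visible only through ucp maps: each \<open>\<psi>\<close> takes the
    same value at \<open>h j i\<close> and \<open>star (h i j)\<close>, and ucp maps separate
    points.\<close>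
  have herm: "star (h i j) = h j i" if "i \<in> I" "j \<in> I" for i j
  proof -
    have "h j i - star (h i j) = 0"
    proof (rule eq_0_if_ucp_eq_0)
      fix m l l' and \<psi> :: "'a \<Rightarrow> complex mat" assume u: "ucp (cstar_opsys :: 'a opsys) m \<psi>" and l: "l < m" "l' < m"
      have lin: "\<psi> (v + w) = \<psi> v + \<psi> w" "\<psi> (scaleC d v) = d \<cdot>\<^sub>m \<psi> v" "\<psi> v \<in> carrier_mat m m" for v w d
        using u by (auto simp: ucp_def)
      have "h j i - star (h i j) = h j i + scaleC (- 1) (star (h i j))" by (simp add: scaleC_minus_left)
      then have "\<psi> (h j i - star (h i j)) = \<psi> (h j i) + (- 1) \<cdot>\<^sub>m \<psi> (star (h i j))"
        by (simp only: lin)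
      then have "\<psi> (h j i - star (h i j)) $$ (l, l') = \<psi> (h j i) $$ (l, l') - \<psi> (star (h i j)) $$ (l, l')"
        using l lin(3)[of "h j i"] lin(3)[of "star (h i j)"] by simp
      also have "\<psi> (star (h i j)) $$ (l, l') = cnj (\<psi> (h i j) $$ (l', l))"
        by (rule ucp_star[OF u l(2,1)])
      also have "\<psi> (h j i) $$ (l, l') = cnj (\<psi> (h i j) $$ (l', l))"
        using psd_on_hermitian[OF _ psd'[OF u], of "(i, l')" "(j, l)"] l that finI by simp
      finally show "\<psi> (h j i - star (h i j)) $$ (l, l') = 0" by simp
    qed
    then show ?thesis by simp
  qed
  define N where "N = card I"
  obtain e where e: "bij_betw e {..<N} I"
    using ex_bij_betw_nat_finite[OF finI] unfolding N_def atLeast0LessThan by auto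
  have eI: "e i \<in> I" if "i < N" for i using e that by (auto simp: bij_betw_def)
  define v where "v = block N (\<lambda>i j. h (e i) (e j))"
  have vadj: "adj v = v" by (rule rcf_eqI) (auto simp: v_def herm eI)
  have vc: "corner N * v * corner N = v" by (rule rcf_eqI) (auto simp: v_def)
  have pv: "pos (v + \<epsilon> *\<^sub>R corner N)" if "\<epsilon> > 0" for \<epsilon> :: real
  proof -
    \<comment> \<open>Twice \<open>\<epsilon>\<close>, because \<open>v + adj v\<close> is
      \<open>2 v\<close> and everything is halved at the end.\<close>
    have "pos (corner N * (v + adj v) * corner N + (2 * \<epsilon>) *\<^sub>R corner N)"
    proof (rule pos_if_ucp_nonneg)
      fix m \<psi> and \<xi> :: "nat \<Rightarrow> nat \<Rightarrow> complex" assume u: "ucp (cstar_opsys :: 'a opsys) m \<psi>"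
      have "bij_betw (map_prod e id) ({..<N} \<times> {..<m}) (I \<times> {..<m})"
        using e by (intro bij_betw_map_prod) auto
      then have "psd_on ({..<N} \<times> {..<m}) (\<lambda>(i, l) (j, l'). \<psi> (h (e i) (e j)) $$ (l, l')) \<longleftrightarrow>
          psd_on (I \<times> {..<m}) (\<lambda>(i, l) (j, l'). \<psi> (h i j) $$ (l, l'))"
        by (rule psd_on_reindex) auto
      with psd'[OF u] have "psd_on ({..<N} \<times> {..<m}) (\<lambda>(i, l) (j, l'). \<psi> (h (e i) (e j)) $$ (l, l'))"
        by simp
      then have "0 \<le> sesq ({..<N} \<times> {..<m}) (\<lambda>(i, l) (j, l'). \<psi> (h (e i) (e j)) $$ (l, l')) (case_prod \<xi>) (case_prod \<xi>)"
        by (simp add: psd_on_sesq)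
      also have "\<dots> = (\<Sum>i<N. \<Sum>l<m. \<Sum>j<N. \<Sum>l'<m. cnj (\<xi> i l) * \<psi> (h (e i) (e j)) $$ (l, l') * \<xi> j l')"
        unfolding sesq_Times by simp
      also have "\<dots> = (\<Sum>i<N. \<Sum>j<N. \<Sum>l<m. \<Sum>l'<m. cnj (\<xi> i l) * \<psi> (h (e i) (e j)) $$ (l, l') * \<xi> j l')"
        by (rule sum.cong[OF refl], rule sum.swap)
      also have "\<dots> = (\<Sum>i<N. \<Sum>j<N. \<Sum>l<m. \<Sum>l'<m. cnj (\<xi> i l) * \<psi> (ent v i j) $$ (l, l') * \<xi> j l')"
        by (intro sum.cong refl) (simp add: v_def)
      finally show "0 \<le> Re (\<Sum>i<N. \<Sum>j<N. \<Sum>l<m. \<Sum>l'<m. cnj (\<xi> i l) * \<psi> (ent v i j) $$ (l, l') * \<xi> j l')"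
        by (simp add: less_eq_complex_def)
    qed (use that in simp)
    also have "corner N * (v + adj v) * corner N + (2 * \<epsilon>) *\<^sub>R corner N = 2 *\<^sub>R (v + \<epsilon> *\<^sub>R corner N)"
      unfolding vadj by (simp add: distrib_left distrib_right vc scaleR_add_right scaleR_2[symmetric])
    finally have "pos ((1/2) *\<^sub>R (2 *\<^sub>R (v + \<epsilon> *\<^sub>R corner N)))" by (intro pos_scaleR[of "1/2"]) simp_all
    then show ?thesis by simp
  qed
  define d where "d = inv_into {..<N} e"
  have ed: "e (d i) = i" "d i < N" if "i \<in> I" for i
    using e that inv_into_into[of i e "{..<N}"] by (auto simp: d_def bij_betw_def f_inv_into_f)
  show ?thesis
  proof (rule that[OF dec])
    fix \<epsilon> :: real assume "\<epsilon> > 0"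
    from pv[OF this] obtain Y where Y: "v + \<epsilon> *\<^sub>R corner N = adj Y * Y" by (auto simp: pos_def)
    \<comment> \<open>Moves the columns of the root that belong to block \<open>x\<close> to the
      positions below \<open>p\<close>.\<close>
    define y where "y x = Y * (\<Sum>s<p. mk (d (x, s)) s 1)" for x
    have "y x * corner p = y x" for x
      by (simp add: y_def mult.assoc)
        (rule arg_cong2[of _ _ _ _ times], simp, rule rcf_eqI, auto simp: ent_sum intro!: sum.neutral sum.cong)
    moreover have "adj (y x) * y x' =
      block p (\<lambda>s s'. arrow_entry (c s s' + (if s = s' then of_real \<epsilon> else 0)) (a s s') (b s s') x x')" for x x'
    proof -
      have "adj (y x) * y x' = (\<Sum>s<p. mk s (d (x, s)) 1) * (adj Y * Y) * (\<Sum>s<p. mk (d (x', s)) s 1)"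
        by (simp add: y_def adj_mult adj_sum mult.assoc)
      also have "\<dots> = (\<Sum>s<p. \<Sum>s'<p. mk s (d (x, s)) 1 * (v + \<epsilon> *\<^sub>R corner N) * mk (d (x', s')) s' 1)"
        by (simp only: Y sum_distrib_left sum_distrib_right) (rule sum.swap)
      also have "\<dots> = block p (\<lambda>s s'. ent (v + \<epsilon> *\<^sub>R corner N) (d (x, s)) (d (x', s')))"
        by (rule mk_sandwich_sum)
      also have "\<dots> = block p (\<lambda>s s'. arrow_entry (c s s' + (if s = s' then of_real \<epsilon> else 0)) (a s s') (b s s') x x')"
      proof (rule rcf_eqI)
        fix s s'
        have "ent (v + \<epsilon> *\<^sub>R corner N) (d (x, s)) (d (x', s')) =
            arrow_entry (c s s' + (if s = s' then of_real \<epsilon> else 0)) (a s s') (b s s') x x'" if "s < p" "s' < p"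
        proof -
          have I: "(x, s) \<in> I" "(x', s') \<in> I" using that by (auto simp: I_def)
          have d: "d (x, s) = d (x', s') \<longleftrightarrow> x = x' \<and> s = s'"
            using ed(1)[OF I(1)] ed(1)[OF I(2)] by (metis prod.inject)
          have 1: "ent v (d (x, s)) (d (x', s')) = arrow_entry (c s s') (a s s') (b s s') x x'"
            by (simp add: v_def ed[OF I(1)] ed[OF I(2)] h_def)
          have 2: "ent (corner N :: 'a rcf) (d (x, s)) (d (x', s')) = (if x = x' \<and> s = s' then 1 else 0)"
            by (simp add: d ed(2)[OF I(1)])
          show ?thesis
            unfolding plus_rcf.rep_eq scaleR_rcf.rep_eq 1 2
            by (cases x; cases x') (simp_all add: arrow_entry_def of_real_def)
        qed
        then show "ent (block p (\<lambda>s s'. ent (v + \<epsilon> *\<^sub>R corner N) (d (x, s)) (d (x', s')))) s s'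
          = ent (block p (\<lambda>s s'. arrow_entry (c s s' + (if s = s' then of_real \<epsilon> else 0)) (a s s') (b s s') x x')) s s'"
          by simp
      qed
      finally show ?thesis .
    qed
    ultimately show "\<exists>y. (\<forall>x. y x * corner p = y x) \<and> (\<forall>x x'. adj (y x) * y x' =
      block p (\<lambda>s s'. arrow_entry (c s s' + (if s = s' then of_real \<epsilon> else 0)) (a s s') (b s s') x x'))"
      by blast
  qed
qed

section \<open>An approximate inverse\<close>

text \<open>Induction in steps of two, since \<open>z ^ (j + 2) = adj z * z ^ j * z\<close> is a
  conjugation of \<open>z ^ j\<close>.\<close>

lemma pos_power: "pos z \<Longrightarrow> pos (z ^ i)"
proof (induction i rule: less_induct)
  case (less i)
  consider "i = 0" | "i = 1" | j where "i = Suc (Suc j)" by (metis One_nat_def not0_implies_Suc)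
  then show ?case
  proof cases
    case 3
    have "pos (adj z * z ^ j * z)" using less 3 by (intro pos_conj) auto
    then show ?thesis using 3 pos_adj[OF less.prems] by (simp add: power_commutes mult.assoc)
  qed (use less.prems in auto)
qed

text \<open>With \<open>t = \<Sum>\<^sub>m z\<^sup>m\<close> in place of \<open>c\<inverse>\<close>, the Schur complement of the arrow matrix stays positive:
  it differs from a square by \<open>2 \<Sum>\<^sub>i a\<^sub>i\<^sup>* (t - t c t) a\<^sub>i\<close>, and \<open>t - t c t = \<Sum>\<^sub>m z\<^bsup>m+M\<^esup>\<close>.\<close>

lemma pos_approx_schur:
  fixes y :: "'n::finite option \<Rightarrow> 'a::unital_cstar_algebra rcf"
  assumes diag: "\<And>x. adj (y x) * y x = c"
    and off: "\<And>i j. i \<noteq> j \<Longrightarrow> adj (y (Some i)) * y (Some j) = 0"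
    and le1: "pos (1 - c)"
    and t: "t = (\<Sum>m<M. (1 - c) ^ m)"
  shows "pos (c - (\<Sum>i\<in>UNIV. adj (t * (adj (y (Some i)) * y None)) * c * (t * (adj (y (Some i)) * y None))))"
    and "c * t = 1 - (1 - c) ^ M" and "adj t = t"
proof -
  define z where "z = 1 - c"
  define a where "a i = adj (y (Some i)) * y None" for i
  define b where "b i = t * a i" for i
  have c: "c = 1 - z" by (simp add: z_def)
  have z: "adj z = z" using pos_adj[OF le1] by (simp add: z_def)
  show ta: "adj t = t" by (simp add: t adj_sum adj_power z flip: z_def)
  show ct: "c * t = 1 - (1 - c) ^ M" unfolding t c by (simp add: geometric_telescope)
  have ttc: "t - t * c * t = (\<Sum>m<M. z ^ (m + M))"
  proof -
    have "t - t * c * t = t * z ^ M" using ct by (simp add: mult.assoc right_diff_distrib z_def)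
    then show ?thesis by (simp add: t sum_distrib_right power_add flip: z_def)
  qed
  \<comment> \<open>If \<open>t\<close> were the exact inverse of \<open>c\<close>, this would be
    the part of \<open>y None\<close> orthogonal to all columns \<open>y (Some i)\<close>.\<close>
  define d where "d = y None - (\<Sum>i\<in>UNIV. y (Some i) * b i)"
  have adja: "adj (a i) = adj (y None) * y (Some i)" for i by (simp add: a_def adj_mult)
  have adjb: "adj (b i) = adj (a i) * t" for i by (simp add: b_def adj_mult ta)
  have cross: "adj (\<Sum>i\<in>UNIV. y (Some i) * b i) * (\<Sum>i\<in>UNIV. y (Some i) * b i) = (\<Sum>i\<in>UNIV. adj (b i) * c * b i)"
  proof -
    have "adj (y (Some i) * b i) * (y (Some j) * b j) = (if i = j then adj (b i) * c * b i else 0)" for i j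
    proof -
      have "adj (y (Some i) * b i) * (y (Some j) * b j) = adj (b i) * (adj (y (Some i)) * y (Some j)) * b j"
        by (simp add: adj_mult mult.assoc)
      then show ?thesis using diag[of "Some i"] off[of i j] by auto
    qed
    then have "adj (\<Sum>i\<in>UNIV. y (Some i) * b i) * (\<Sum>i\<in>UNIV. y (Some i) * b i)
        = (\<Sum>i\<in>UNIV. \<Sum>j\<in>UNIV. if i = j then adj (b i) * c * b i else 0)"
      by (simp only: adj_sum sum_product)
    then show ?thesis by simp
  qed
  have "adj d * d = adj (y None) * y None - adj (y None) * (\<Sum>i\<in>UNIV. y (Some i) * b i)
      - adj (\<Sum>i\<in>UNIV. y (Some i) * b i) * y None + adj (\<Sum>i\<in>UNIV. y (Some i) * b i) * (\<Sum>i\<in>UNIV. y (Some i) * b i)"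
    by (simp add: d_def adj_diff left_diff_distrib right_diff_distrib)
  also have "adj (y None) * (\<Sum>i\<in>UNIV. y (Some i) * b i) = (\<Sum>i\<in>UNIV. adj (a i) * t * a i)"
    by (simp add: sum_distrib_left adja b_def mult.assoc)
  also have "adj (\<Sum>i\<in>UNIV. y (Some i) * b i) * y None = (\<Sum>i\<in>UNIV. adj (a i) * t * a i)"
    by (simp add: adj_sum sum_distrib_right adj_mult adjb mult.assoc) (simp add: a_def)
  finally have dd: "adj d * d = c - 2 *\<^sub>R (\<Sum>i\<in>UNIV. adj (a i) * t * a i) + (\<Sum>i\<in>UNIV. adj (b i) * c * b i)"
    by (simp add: cross diag scaleR_2)
  have bb: "adj (b i) * c * b i = adj (a i) * t * a i - adj (a i) * (t - t * c * t) * a i" for i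
  proof -
    have "adj (b i) * c * b i = adj (a i) * t * c * (t * a i)" unfolding adjb by (simp only: b_def)
    then show ?thesis by (simp add: mult.assoc left_diff_distrib right_diff_distrib)
  qed
  have "c - (\<Sum>i\<in>UNIV. adj (b i) * c * b i)
      = adj d * d + 2 *\<^sub>R (\<Sum>i\<in>UNIV. adj (a i) * t * a i) - 2 *\<^sub>R (\<Sum>i\<in>UNIV. adj (b i) * c * b i)"
    by (simp add: dd scaleR_2)
  also have "\<dots> = adj d * d + 2 *\<^sub>R (\<Sum>i\<in>UNIV. adj (a i) * (t - t * c * t) * a i)"
    unfolding bb by (simp add: sum_subtractf scaleR_diff_right)
  also have "pos \<dots>"
    unfolding ttc
    by (intro pos_add pos_self pos_scaleR pos_sum pos_conj pos_power) (use le1 in \<open>simp_all add: z_def\<close>)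
  finally show "pos (c - (\<Sum>i\<in>UNIV. adj (t * (adj (y (Some i)) * y None)) * c * (t * (adj (y (Some i)) * y None))))"
    by (simp only: b_def a_def)
qed

text \<open>The bound \<open>(1 - c) ^ L * c \<le> 1 / (L + 1)\<close> in the matrix ring; it
  controls what the truncated Neumann series misses.\<close>

lemma pos_one_minus_weighted_power:
  assumes c: "pos c" "pos (1 - c)"
  shows "pos (1 - real (Suc L) *\<^sub>R ((1 - c) ^ L * c))"
proof -
  have "pos (adj c * (1 - c) ^ i * c)" for i by (intro pos_conj pos_power c)
  then have p: "pos (c * (1 - c) ^ i * c)" for i using pos_adj[OF c(1)] by simp
  have "1 - real (Suc L) *\<^sub>R ((1 - c) ^ L * (1 - (1 - c))) =
    (1 - c) ^ Suc L + (\<Sum>i<L. real (Suc i) *\<^sub>R ((1 - (1 - c)) * (1 - c) ^ i * (1 - (1 - c))))"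
    by (rule weighted_power_identity)
  then have "1 - real (Suc L) *\<^sub>R ((1 - c) ^ L * c) =
    (1 - c) ^ Suc L + (\<Sum>i<L. real (Suc i) *\<^sub>R (c * (1 - c) ^ i * c))" by simp
  also have "pos \<dots>"
    by (intro pos_add pos_power pos_sum pos_scaleR p c) auto
  finally show ?thesis .
qed

section \<open>Graph representations\<close>

text \<open>The data \<open>E\<close>, \<open>\<sigma>\<close> encode the matrix over \<open>E\<^sub>n'\<close> with \<open>I\<close> on the diagonal, \<open>E\<^bsub>i0\<^esub>\<close> at position
  \<open>(j, \<sigma>(j,i))\<close> and \<open>E\<^bsub>0i\<^esub>\<close> at position \<open>(\<sigma>(j,i), j)\<close>, for \<open>(j,i) \<in> E\<close>; injectivity of \<open>\<sigma>\<close> makes it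
  positive. Pairing it with the Gram matrix of the \<open>q\<^sub>j\<close> gives \<open>I \<otimes> C + \<Sum>\<^sub>i (E\<^bsub>i0\<^esub> \<otimes> A\<^sub>i + E\<^bsub>0i\<^esub> \<otimes> A\<^sub>i\<^sup>*)\<close>.\<close>

definition graph_rep :: "'a::unital_cstar_algebra rcf \<Rightarrow> ('n \<Rightarrow> 'a rcf) \<Rightarrow> bool" where
  "graph_rep C A \<longleftrightarrow> (\<exists>(k::nat) E \<sigma> q. E \<subseteq> {..<k} \<times> UNIV \<and> \<sigma> ` E \<subseteq> {..<k} \<and> inj_on \<sigma> E \<and>
     C = (\<Sum>j<k. adj (q j) * q j) \<and> (\<forall>i. A i = (\<Sum>j | (j, i) \<in> E. adj (q j) * q (\<sigma> (j, i)))))"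

text \<open>Lets later constructions take their vertices from disjoint sums, Booleans or words; an
  enumeration of \<open>J\<close> transports everything to numbers.\<close>

lemma graph_repI:
  fixes J :: "'j set" and E :: "('j \<times> 'n) set"
  assumes J: "finite J" and E: "E \<subseteq> J \<times> UNIV" and \<sigma>: "\<sigma> ` E \<subseteq> J" "inj_on \<sigma> E"
    and C: "C = (\<Sum>j\<in>J. adj (q j) * q j)"
    and A: "\<And>i. A i = (\<Sum>j | (j, i) \<in> E. adj (q j) * q (\<sigma> (j, i)))"
  shows "graph_rep C A"
proof -
  define k where "k = card J"
  obtain h where h: "bij_betw h {..<k} J"
    using ex_bij_betw_nat_finite[OF J] unfolding k_def atLeast0LessThan by auto
  define g where "g = inv_into {..<k} h"
  have hg: "h (g j) = j" "g j < k" if "j \<in> J" for j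
    using h that inv_into_into[of j h "{..<k}"] by (auto simp: g_def bij_betw_def f_inv_into_f)
  have hi: "h j = h j' \<longleftrightarrow> j = j'" if "j < k" "j' < k" for j j'
    using h that by (auto simp: bij_betw_def inj_on_def)
  have hJ: "h j \<in> J" if "j < k" for j using h that by (auto simp: bij_betw_def)
  define E' where "E' = {(j, i). j < k \<and> (h j, i) \<in> E}"
  define \<sigma>' where "\<sigma>' = (\<lambda>(j, i). g (\<sigma> (h j, i)))"
  define q' where "q' = (\<lambda>j. q (h j))"
  have \<sigma>J: "\<sigma> e \<in> J" if "e \<in> E" for e using \<sigma>(1) that by blast
  have "inj_on \<sigma>' E'"
  proof (rule inj_onI)
    fix x y assume "x \<in> E'" "y \<in> E'" and eq: "\<sigma>' x = \<sigma>' y"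
    then obtain j i j' i' where xy: "x = (j, i)" "y = (j', i')" "j < k" "j' < k" "(h j, i) \<in> E" "(h j', i') \<in> E"
      by (auto simp: E'_def)
    have "h (g (\<sigma> (h j, i))) = h (g (\<sigma> (h j', i')))" using eq by (simp add: xy \<sigma>'_def)
    then have "\<sigma> (h j, i) = \<sigma> (h j', i')" using hg(1)[OF \<sigma>J[OF xy(5)]] hg(1)[OF \<sigma>J[OF xy(6)]] by simp
    then have "(h j, i) = (h j', i')" by (rule inj_onD[OF \<sigma>(2) _ xy(5,6)])
    then show "x = y" using hi xy by simp
  qed
  moreover have "C = (\<Sum>j<k. adj (q' j) * q' j)"
    unfolding C q'_def by (rule sum.reindex_bij_betw[OF h, symmetric])
  moreover have "A i = (\<Sum>j | (j, i) \<in> E'. adj (q' j) * q' (\<sigma>' (j, i)))" for i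
    unfolding A
  proof (rule sum.reindex_bij_witness[of _ h g])
    fix j assume j: "j \<in> {j. (j, i) \<in> E}"
    then have jJ: "j \<in> J" using E by auto
    show "h (g j) = j" using hg[OF jJ] by simp
    show "g j \<in> {j. (j, i) \<in> E'}" using hg[OF jJ] j by (simp add: E'_def)
    have "h (g (\<sigma> (j, i))) = \<sigma> (j, i)" using hg(1)[OF \<sigma>J[of "(j, i)"]] j by simp
    then show "adj (q' (g j)) * q' (\<sigma>' (g j, i)) = adj (q j) * q (\<sigma> (j, i))"
      using hg(1)[OF jJ] by (simp add: q'_def \<sigma>'_def)
  next
    fix j assume "j \<in> {j. (j, i) \<in> E'}"
    then have j: "j < k" "(h j, i) \<in> E" by (auto simp: E'_def)
    show "g (h j) = j" using hg[OF hJ[OF j(1)]] hi j(1) by simp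
    show "h j \<in> {j. (j, i) \<in> E}" using j by simp
  qed
  moreover have "E' \<subseteq> {..<k} \<times> UNIV" by (auto simp: E'_def)
  moreover have "\<sigma>' ` E' \<subseteq> {..<k}" using hg(2)[OF \<sigma>J] by (auto simp: E'_def \<sigma>'_def)
  ultimately show ?thesis
    unfolding graph_rep_def by (intro exI[of _ k] exI[of _ E'] exI[of _ \<sigma>'] exI[of _ q'] conjI allI)
qed

text \<open>Disjoint union of the two graphs.\<close>

lemma graph_rep_add:
  fixes A A' :: "'n \<Rightarrow> 'a::unital_cstar_algebra rcf"
  assumes "graph_rep C A" "graph_rep C' A'"
  shows "graph_rep (C + C') (\<lambda>i. A i + A' i)"
proof -
  obtain k :: nat and E \<sigma> q where 1: "E \<subseteq> {..<k} \<times> UNIV" "\<sigma> ` E \<subseteq> {..<k}" "inj_on \<sigma> E"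
    "C = (\<Sum>j<k. adj (q j) * q j)" "\<forall>i. A i = (\<Sum>j | (j, i) \<in> E. adj (q j) * q (\<sigma> (j, i)))"
    using assms(1) unfolding graph_rep_def by (elim exE conjE) (rule that)
  obtain k' :: nat and E' \<sigma>' q' where 2: "E' \<subseteq> {..<k'} \<times> UNIV" "\<sigma>' ` E' \<subseteq> {..<k'}" "inj_on \<sigma>' E'"
    "C' = (\<Sum>j<k'. adj (q' j) * q' j)" "\<forall>i. A' i = (\<Sum>j | (j, i) \<in> E'. adj (q' j) * q' (\<sigma>' (j, i)))"
    using assms(2) unfolding graph_rep_def by (elim exE conjE) (rule that)
  define F where "F = {(x, i). case x of Inl j \<Rightarrow> (j, i) \<in> E | Inr j \<Rightarrow> (j, i) \<in> E'}"
  define \<tau> where "\<tau> = (\<lambda>(x, i). case x of Inl j \<Rightarrow> Inl (\<sigma> (j, i)) | Inr j \<Rightarrow> Inr (\<sigma>' (j, i)))"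
  have F: "(x, i) \<in> F \<longleftrightarrow> (\<exists>j. x = Inl j \<and> (j, i) \<in> E) \<or> (\<exists>j. x = Inr j \<and> (j, i) \<in> E')" for x i
    by (cases x) (auto simp: F_def)
  have \<sigma>: "e \<in> E \<Longrightarrow> \<sigma> e < k" "e' \<in> E' \<Longrightarrow> \<sigma>' e' < k'" for e e'
    using 1(2) 2(2) by auto
  have fin: "finite {j. (j, i) \<in> E}" "finite {j. (j, i) \<in> E'}" for i
    using 1(1) 2(1) by (auto intro: finite_subset[of _ "{..<k}"] finite_subset[of _ "{..<k'}"])
  show ?thesis
  proof (rule graph_repI[where J = "{..<k} <+> {..<k'}" and E = F and \<sigma> = \<tau> and q = "case_sum q q'"])
    show "F \<subseteq> ({..<k} <+> {..<k'}) \<times> UNIV" using 1(1) 2(1) by (auto simp: F)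
    show "\<tau> ` F \<subseteq> {..<k} <+> {..<k'}" by (auto simp: F \<tau>_def \<sigma>)
    show "inj_on \<tau> F"
    proof -
      have "\<sigma> e = \<sigma> e' \<longleftrightarrow> e = e'" if "e \<in> E" "e' \<in> E" for e e'
        using 1(3) that by (auto simp: inj_on_def)
      moreover have "\<sigma>' e = \<sigma>' e' \<longleftrightarrow> e = e'" if "e \<in> E'" "e' \<in> E'" for e e'
        using 2(3) that by (auto simp: inj_on_def)
      ultimately show ?thesis by (auto simp: inj_on_def F \<tau>_def)
    qed
    show "C + C' = (\<Sum>j\<in>{..<k} <+> {..<k'}. adj (case_sum q q' j) * case_sum q q' j)"
      by (simp add: sum.Plus 1(4) 2(4))
    fix i
    have "{x. (x, i) \<in> F} = {j. (j, i) \<in> E} <+> {j. (j, i) \<in> E'}"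
      by (auto simp: F)
    then show "A i + A' i = (\<Sum>j | (j, i) \<in> F. adj (case_sum q q' j) * case_sum q q' (\<tau> (j, i)))"
      using 1(5) 2(5) by (simp add: sum.Plus[OF fin] \<tau>_def)
  qed simp
qed

lemma graph_rep_scaleR:
  assumes "graph_rep C A" "r \<ge> 0"
  shows "graph_rep (r *\<^sub>R C) (\<lambda>i. r *\<^sub>R A i)"
proof -
  obtain k :: nat and E \<sigma> q where 1: "E \<subseteq> {..<k} \<times> UNIV" "\<sigma> ` E \<subseteq> {..<k}" "inj_on \<sigma> E"
    "C = (\<Sum>j<k. adj (q j) * q j)" "\<forall>i. A i = (\<Sum>j | (j, i) \<in> E. adj (q j) * q (\<sigma> (j, i)))"
    using assms(1) unfolding graph_rep_def by (elim exE conjE) (rule that)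
  show ?thesis
    by (rule graph_repI[where J = "{..<k}" and E = E and \<sigma> = \<sigma> and q = "\<lambda>j. sqrt r *\<^sub>R q j"])
      (use 1 assms(2) in \<open>simp_all add: adj_scaleR scaleR_sum_right\<close>)
qed

lemma graph_rep_pos: "pos C \<Longrightarrow> graph_rep C (\<lambda>i. 0)"
proof -
  assume "pos C"
  then obtain w where w: "C = adj w * w" by (auto simp: pos_def)
  show ?thesis
    by (rule graph_repI[where J = "{()}" and E = "{}" and \<sigma> = "\<lambda>_. ()" and q = "\<lambda>_. w"]) (simp_all add: w)
qed

lemma graph_rep_sum:
  "(\<And>f. f \<in> F \<Longrightarrow> graph_rep (C f) (A f)) \<Longrightarrow> graph_rep (\<Sum>f\<in>F. C f) (\<lambda>i. \<Sum>f\<in>F. A f i)"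
  by (induction F rule: infinite_finite_induct) (simp_all add: graph_rep_pos graph_rep_add)

text \<open>A single edge labelled \<open>i\<close> from the vertex \<open>False\<close>, carrying
  \<open>v\<close>, to the vertex \<open>True\<close>, carrying \<open>w\<close>.\<close>

lemma graph_rep_pair: "graph_rep (adj v * v + adj w * w) (\<lambda>i'. if i' = i then adj v * w else 0)"
proof (rule graph_repI[where J = UNIV and E = "{(False, i)}" and \<sigma> = "\<lambda>_. True" and q = "\<lambda>b. if b then w else v"])
  fix i'
  have "{j. (j, i') \<in> {(False, i)}} = (if i' = i then {False} else {})" by auto
  then show "(if i' = i then adj v * w else 0)
    = (\<Sum>j | (j, i') \<in> {(False, i)}. adj (if j then w else v) * (if True then w else v))" by simp
qed (auto simp: UNIV_bool add.commute)

text \<open>The index set consists of pairs \<open>(k, w)\<close> of a level \<open>k\<close> and a word \<open>w\<close> of length at most \<open>k\<close>. Words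
  shorter than their level start with the defect \<open>e\<close>, which keeps the sum over every level equal to \<open>c\<close>.\<close>

lemma graph_rep_chain:
  fixes b :: "'n::finite \<Rightarrow> 'a::unital_cstar_algebra rcf"
  assumes c: "c = adj q0 * q0" and e: "c - (\<Sum>i\<in>UNIV. adj (b i) * c * b i) = adj e * e"
  shows "graph_rep (real (Suc N) *\<^sub>R c) (\<lambda>i. real N *\<^sub>R (c * b i))"
proof -
  define W where "W k = {w :: 'n list. length w \<le> k}" for k
  have finW: "finite (W k)" for k
    using finite_lists_length_le[of "UNIV :: 'n set" k] by (simp add: W_def)
  \<comment> \<open>Letters are prepended while their factors multiply on the right, so following an
    edge is right multiplication by \<open>b i\<close>.\<close>
  define bw where "bw = (\<lambda>w. foldr (\<lambda>i x. x * b i) w 1)"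
  have bw: "bw [] = 1" "bw (i # w) = bw w * b i" for i w by (simp_all add: bw_def)
  define q where "q = (\<lambda>(k, w). (if length w = k then q0 else e) * bw w)"
  have q_Cons: "q (Suc k, i # w) = q (k, w) * b i" for k i w
    by (simp add: q_def bw mult.assoc)
  \<comment> \<open>One level further, the nonempty words reproduce
    \<open>\<Sum> adj (b i) * c * b i\<close> and the empty word supplies the defect; together they
    give \<open>c\<close> again.\<close>
  have level: "(\<Sum>w\<in>W k. adj (q (k, w)) * q (k, w)) = c" for k
  proof (induction k)
    case 0
    have "W 0 = {[]}" by (auto simp: W_def)
    then show ?case by (simp add: q_def bw c)
  next
    case (Suc k)
    have "W (Suc k) = insert [] (\<Union>i. (#) i ` W k)"
      by (auto simp: W_def image_iff) (metis Suc_le_mono length_Cons neq_Nil_conv)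
    then have "(\<Sum>w\<in>W (Suc k). adj (q (Suc k, w)) * q (Suc k, w))
      = adj (q (Suc k, [])) * q (Suc k, []) + (\<Sum>w\<in>(\<Union>i. (#) i ` W k). adj (q (Suc k, w)) * q (Suc k, w))"
      using finW by (simp add: image_iff)
    also have "(\<Sum>w\<in>(\<Union>i. (#) i ` W k). adj (q (Suc k, w)) * q (Suc k, w))
      = (\<Sum>i\<in>UNIV. \<Sum>w\<in>(#) i ` W k. adj (q (Suc k, w)) * q (Suc k, w))"
      by (rule sum.UNION_disjoint) (use finW in auto)
    also have "\<dots> = (\<Sum>i\<in>UNIV. \<Sum>w\<in>W k. adj (b i) * (adj (q (k, w)) * q (k, w)) * b i)"
      by (simp add: sum.reindex q_Cons adj_mult mult.assoc)
    also have "\<dots> = (\<Sum>i\<in>UNIV. adj (b i) * c * b i)"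
      by (simp only: sum_distrib_left[symmetric] sum_distrib_right[symmetric] Suc)
    also have "adj (q (Suc k, [])) * q (Suc k, []) = adj e * e" by (simp add: q_def bw)
    finally show ?case by (simp add: e[symmetric])
  qed
  \<comment> \<open>Edges leave only the levels below \<open>N\<close>: hence \<open>N\<close>
    copies of \<open>c * b i\<close> against \<open>N + 1\<close> copies of
    \<open>c\<close>.\<close>
  define E where "E = {((k, w), i :: 'n) | k w i. k < N \<and> w \<in> W k}"
  define \<sigma> where "\<sigma> = (\<lambda>((k, w), i :: 'n). (Suc k, i # w))"
  show ?thesis
  proof (rule graph_repI[where J = "Sigma {..N} W" and E = E and \<sigma> = \<sigma> and q = q])
    show "finite (Sigma {..N} W)" using finW by blast
    show "E \<subseteq> Sigma {..N} W \<times> UNIV" by (auto simp: E_def)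
    show "\<sigma> ` E \<subseteq> Sigma {..N} W" by (auto simp: E_def \<sigma>_def W_def)
    show "inj_on \<sigma> E" by (auto simp: inj_on_def E_def \<sigma>_def)
    have "(\<Sum>j\<in>Sigma {..N} W. adj (q j) * q j) = (\<Sum>k\<le>N. \<Sum>w\<in>W k. adj (q (k, w)) * q (k, w))"
      using finW by (subst sum.Sigma) (auto simp: case_prod_unfold)
    also have "\<dots> = real (Suc N) *\<^sub>R c" by (simp only: level sum_constant_scaleR card_atMost)
    finally show "real (Suc N) *\<^sub>R c = (\<Sum>j\<in>Sigma {..N} W. adj (q j) * q j)" by simp
    fix i :: 'n
    have "{j. (j, i) \<in> E} = Sigma {..<N} W" by (auto simp: E_def)
    then have "(\<Sum>j | (j, i) \<in> E. adj (q j) * q (\<sigma> (j, i))) = (\<Sum>(k, w)\<in>Sigma {..<N} W. adj (q (k, w)) * q (Suc k, i # w))"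
      by (intro sum.cong) (auto simp: \<sigma>_def)
    also have "\<dots> = (\<Sum>k<N. \<Sum>w\<in>W k. adj (q (k, w)) * q (Suc k, i # w))"
      using finW by (intro sum.Sigma[symmetric]) auto
    also have "\<dots> = (\<Sum>k<N. (\<Sum>w\<in>W k. adj (q (k, w)) * q (k, w)) * b i)"
      by (simp add: q_Cons sum_distrib_right mult.assoc)
    also have "\<dots> = real N *\<^sub>R (c * b i)" by (simp only: level sum_constant_scaleR card_lessThan)
    finally show "real N *\<^sub>R (c * b i) = (\<Sum>j | (j, i) \<in> E. adj (q j) * q (\<sigma> (j, i)))" by simp
  qed
qed

text \<open>With the approximate inverse \<open>t\<close> of \<open>c\<close> the chain yields \<open>N (a\<^sub>i - \<eta> a\<^sub>i)\<close> instead of the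
  desired \<open>(N + 1) a\<^sub>i\<close>, where \<open>\<eta> = (1 - c)\<^sup>M\<close>. The missing \<open>a\<^sub>i + N \<eta> a\<^sub>i\<close> comes from single edges,
  whose diagonal contribution stays bounded in \<open>N\<close> because \<open>M = N\<^sup>2\<close> and \<open>M \<eta> c \<eta> \<le> 1\<close>.\<close>

lemma graph_rep_arrow_contraction:
  fixes y :: "'n::finite option \<Rightarrow> 'a::unital_cstar_algebra rcf"
  assumes diag: "\<And>x. adj (y x) * y x = c"
    and off: "\<And>i j. i \<noteq> j \<Longrightarrow> adj (y (Some i)) * y (Some j) = 0"
    and le1: "pos (1 - c)" and \<epsilon>: "\<epsilon> > 0"
  shows "graph_rep (c + \<epsilon> *\<^sub>R 1) (\<lambda>i. adj (y (Some i)) * y None)"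
proof -
  define n where "n = CARD('n)"
  \<comment> \<open>The diagonal \<open>D\<close> of the single edges below is at most
    \<open>4 n\<close>; with this \<open>N\<close> it is absorbed by
    \<open>(N + 1) * \<epsilon>\<close>.\<close>
  obtain N :: nat where N: "4 * real n / \<epsilon> < real N" using reals_Archimedean2 by blast
  then have N': "4 * real n \<le> real (Suc N) * \<epsilon>" using \<epsilon> by (simp add: field_simps)
  define M where "M = N * N"
  define t where "t = (\<Sum>m<M. (1 - c) ^ m)"
  define \<eta> where "\<eta> = (1 - c) ^ M"
  define a where "a i = adj (y (Some i)) * y None" for i
  note schur = pos_approx_schur[where y = y, OF diag off le1 t_def]
  have c: "pos c" using pos_self[of "y None"] by (simp add: diag)
  have \<eta>: "adj \<eta> = \<eta>" by (simp add: \<eta>_def adj_power adj_diff pos_adj[OF c])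
  obtain e where e: "c - (\<Sum>i\<in>UNIV. adj (t * a i) * c * (t * a i)) = adj e * e"
    using schur(1) unfolding pos_def a_def by blast
  have chain: "graph_rep (real (Suc N) *\<^sub>R c) (\<lambda>i. real N *\<^sub>R (c * (t * a i)))"
    by (rule graph_rep_chain[OF diag[symmetric, of None] e])
  have cta: "c * (t * a i) = a i - \<eta> * a i" for i
    using schur(2) by (simp add: mult.assoc[symmetric] \<eta>_def left_diff_distrib)
  define X where "X = \<eta> * c * \<eta>"
  have X: "X = (1 - c) ^ (2 * M) * c"
  proof -
    have "c * (1 - c) = (1 - c) * c" by (simp add: algebra_simps)
    then have "c * (1 - c) ^ M = (1 - c) ^ M * c" by (metis power_commuting_commutes)
    then show ?thesis by (simp add: X_def \<eta>_def mult.assoc mult_2 power_add)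
  qed
  have pair1: "graph_rep (2 *\<^sub>R c) (\<lambda>i'. if i' = i then a i else 0)" for i
    unfolding a_def using graph_rep_pair[of "y (Some i)" "y None" i] by (simp add: diag scaleR_2)
  have pair2: "graph_rep (real M *\<^sub>R X + c) (\<lambda>i'. if i' = i then real N *\<^sub>R (\<eta> * a i) else 0)" for i
  proof -
    \<comment> \<open>The weight \<open>N\<close> sits on the source alone: the edge yields
      \<open>N * \<eta> * a i\<close>, the source costs \<open>N ^ 2 * X = M * X\<close>, and the
      target costs only \<open>c\<close>.\<close>
    let ?v = "real N *\<^sub>R (y (Some i) * \<eta>)"
    have "adj ?v * ?v = real M *\<^sub>R (\<eta> * (adj (y (Some i)) * y (Some i)) * \<eta>)"
      by (simp add: adj_scaleR adj_mult \<eta> M_def mult.assoc)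
    moreover have "adj ?v * y None = real N *\<^sub>R (\<eta> * a i)"
      by (simp add: adj_scaleR adj_mult \<eta> a_def mult.assoc)
    ultimately show ?thesis using graph_rep_pair[of ?v "y None" i] by (simp add: diag X_def cong: if_cong)
  qed
  define D where "D = (\<Sum>i\<in>(UNIV::'n set). (2 *\<^sub>R c) + (real M *\<^sub>R X + c))"
  have "graph_rep D (\<lambda>i'. \<Sum>i\<in>UNIV. (if i' = i then a i else 0) + (if i' = i then real N *\<^sub>R (\<eta> * a i) else 0))"
    unfolding D_def by (intro graph_rep_sum graph_rep_add pair1 pair2)
  then have pairs: "graph_rep D (\<lambda>i. a i + real N *\<^sub>R (\<eta> * a i))"
    by (simp add: sum.distrib)
  have "pos (1 - real M *\<^sub>R X)"
  proof -
    \<comment> \<open>As \<open>X\<close> is \<open>(1 - c) ^ (2 * M) * c\<close>, one has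
      \<open>(2 * M + 1) * X \<le> 1\<close>; \<open>r\<close> rescales this to the factor
      \<open>M\<close>.\<close>
    define r where "r = real M / real (Suc (2 * M))"
    have r: "0 \<le> r" "r \<le> 1" by (simp_all add: r_def field_simps)
    have "1 - real M *\<^sub>R X = r *\<^sub>R (1 - real (Suc (2 * M)) *\<^sub>R ((1 - c) ^ (2 * M) * c)) + (1 - r) *\<^sub>R 1"
      by (simp add: X scaleR_diff_right scaleR_diff_left r_def del: of_nat_Suc)
    also have "pos \<dots>"
      by (intro pos_add pos_scaleR pos_one_minus_weighted_power c le1 pos_1) (use r in auto)
    finally show ?thesis .
  qed
  then have "pos ((\<Sum>i\<in>(UNIV::'n set). 3 *\<^sub>R (1 - c) + (1 - real M *\<^sub>R X)) + (real (Suc N) * \<epsilon> - 4 * real n) *\<^sub>R 1)"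
    using N' by (intro pos_add pos_sum pos_scaleR le1 pos_1) auto
  also have "(\<Sum>i\<in>(UNIV::'n set). 3 *\<^sub>R (1 - c) + (1 - real M *\<^sub>R X)) + (real (Suc N) * \<epsilon> - 4 * real n) *\<^sub>R 1
      = (real (Suc N) * \<epsilon>) *\<^sub>R 1 - D"
  proof -
    have "3 *\<^sub>R (1 - c) + (1 - real M *\<^sub>R X) = 4 *\<^sub>R 1 - ((2 *\<^sub>R c) + (real M *\<^sub>R X + c))"
    proof -
      have "3 *\<^sub>R c = 2 *\<^sub>R c + c" using scaleR_add_left[of 2 1 c] by simp
      moreover have "4 *\<^sub>R (1::'a rcf) = 3 *\<^sub>R 1 + 1" using scaleR_add_left[of 3 1 "1::'a rcf"] by simp
      ultimately show ?thesis by (simp only: scaleR_diff_right) (simp add: algebra_simps)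
    qed
    then have "(\<Sum>i\<in>(UNIV::'n set). 3 *\<^sub>R (1 - c) + (1 - real M *\<^sub>R X)) = (\<Sum>i\<in>(UNIV::'n set). 4 *\<^sub>R 1) - D"
      by (simp only: D_def sum_subtractf)
    also have "(\<Sum>i\<in>(UNIV::'n set). 4 *\<^sub>R (1::'a rcf)) = (4 * real n) *\<^sub>R 1"
      by (simp only: sum_constant_scaleR scaleR_scaleR n_def mult.commute)
    finally show ?thesis by (simp add: scaleR_diff_left)
  qed
  finally have rest: "graph_rep ((real (Suc N) * \<epsilon>) *\<^sub>R 1 - D) (\<lambda>i :: 'n. 0)" by (rule graph_rep_pos)
  have "graph_rep (real (Suc N) *\<^sub>R c + (D + ((real (Suc N) * \<epsilon>) *\<^sub>R 1 - D)))
      (\<lambda>i. real N *\<^sub>R (c * (t * a i)) + ((a i + real N *\<^sub>R (\<eta> * a i)) + 0))"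
    by (intro graph_rep_add chain pairs rest)
  also have "real (Suc N) *\<^sub>R c + (D + ((real (Suc N) * \<epsilon>) *\<^sub>R 1 - D)) = real (Suc N) *\<^sub>R (c + \<epsilon> *\<^sub>R 1)"
    by (simp add: scaleR_add_right del: of_nat_Suc)
  also have "(\<lambda>i. real N *\<^sub>R (c * (t * a i)) + ((a i + real N *\<^sub>R (\<eta> * a i)) + 0)) = (\<lambda>i. real (Suc N) *\<^sub>R a i)"
    by (simp add: cta scaleR_diff_right scaleR_add_left add.commute)
  finally have "graph_rep ((1 / real (Suc N)) *\<^sub>R real (Suc N) *\<^sub>R (c + \<epsilon> *\<^sub>R 1)) (\<lambda>i. (1 / real (Suc N)) *\<^sub>R real (Suc N) *\<^sub>R a i)"
    by (rule graph_rep_scaleR) simp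
  then show ?thesis by (simp add: a_def del: of_nat_Suc)
qed

text \<open>\<open>c\<close> lives in the corner of size \<open>p\<close>, where the order unit
  property gives \<open>r\<close> with \<open>c \<le> r\<close>. Dividing \<open>y\<close> by the
  root of \<open>r\<close> reduces to the contractive case, and \<open>graph_rep_scaleR\<close>
  scales back.\<close>

lemma graph_rep_arrow:
  fixes y :: "'n::finite option \<Rightarrow> 'a::unital_cstar_algebra rcf"
  assumes diag: "\<And>x. adj (y x) * y x = c"
    and off: "\<And>i j. i \<noteq> j \<Longrightarrow> adj (y (Some i)) * y (Some j) = 0"
    and corner: "y None * corner p = y None" and \<epsilon>: "\<epsilon> > 0"
  shows "graph_rep (c + \<epsilon> *\<^sub>R 1) (\<lambda>i. adj (y (Some i)) * y None)"
proof -
  have c: "pos c" using pos_self[of "y None"] by (simp add: diag)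
  have cc: "corner p * c * corner p = c"
  proof -
    have "corner p * c * corner p = adj (y None * corner p) * (y None * corner p)"
      by (simp add: diag[symmetric, of None] adj_mult mult.assoc del: corner)
    then show ?thesis by (simp add: corner diag)
  qed
  \<comment> \<open>One half of \<open>c\<close>, because \<open>ex_pos_scaleR_corner_diff\<close>
    bounds \<open>v + adj v\<close>.\<close>
  obtain l where l: "l \<ge> 0" "pos (l *\<^sub>R corner p - corner p * ((1/2) *\<^sub>R c + adj ((1/2) *\<^sub>R c)) * corner p)"
    using ex_pos_scaleR_corner_diff by blast
  have half: "(1/2) *\<^sub>R c + adj ((1/2) *\<^sub>R c) = c"
    by (simp add: adj_scaleR pos_adj[OF c] flip: scaleR_add_left)
  have l': "pos (l *\<^sub>R corner p - c)" using l(2) unfolding half cc .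
  have sq: "(1 - corner p) * (1 - corner p) = (1 - corner p :: 'a rcf)"
    by (simp add: left_diff_distrib right_diff_distrib)
  have "adj (1 - corner p :: 'a rcf) = 1 - corner p" by (simp add: adj_diff)
  from pos_square[OF this] have pc: "pos (1 - corner p :: 'a rcf)" by (simp only: sq)
  define r where "r = l + 1"
  have r: "r > 0" using l by (simp add: r_def)
  have "r *\<^sub>R 1 - c = (l *\<^sub>R corner p - c) + l *\<^sub>R (1 - corner p) + 1"
    by (simp add: r_def algebra_simps)
  also have "pos \<dots>" by (intro pos_add l' pos_scaleR pc pos_1 l)
  finally have "pos ((1/r) *\<^sub>R (r *\<^sub>R 1 - c))" using r by (intro pos_scaleR) simp_all
  then have le1: "pos (1 - (1/r) *\<^sub>R c)" using r by (simp add: scaleR_diff_right)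
  define y' where "y' x = sqrt (1/r) *\<^sub>R y x" for x
  have y': "adj (y' x) * y' x' = (1/r) *\<^sub>R (adj (y x) * y x')" for x x'
    using r by (simp add: y'_def adj_scaleR flip: real_sqrt_mult)
  have "graph_rep ((1/r) *\<^sub>R c + (\<epsilon>/r) *\<^sub>R 1) (\<lambda>i. adj (y' (Some i)) * y' None)"
    by (rule graph_rep_arrow_contraction[OF _ _ le1]) (use \<epsilon> r off in \<open>simp_all add: y' diag\<close>)
  from graph_rep_scaleR[OF this, of r] r show ?thesis
    by (simp add: y' scaleR_add_right)
qed

section \<open>Positivity in the maximal tensor product\<close>

lemma sesq_add_mid: "sesq I (\<lambda>z z'. T z z' + T' z z') x y = sesq I T x y + sesq I T' x y"
  by (simp add: sesq_def distrib_left distrib_right sum.distrib)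

lemma sesq_scale_mid: "sesq I (\<lambda>z z'. c * T z z') x y = c * sesq I T x y"
  by (simp add: sesq_def sum_distrib_left mult_ac)

lemma sesq_0_mid: "sesq I (\<lambda>z z'. 0) x y = 0"
  by (simp add: sesq_def)

lemma sesq_sum_mid: "sesq I (\<lambda>z z'. \<Sum>e\<in>E. T e z z') x y = (\<Sum>e\<in>E. sesq I (T e) x y)"
  by (induction E rule: infinite_finite_induct) (simp_all add: sesq_0_mid sesq_add_mid)

lemma sesq_unit_mid:
  assumes "finite I" "u \<in> I" "v \<in> I"
  shows "sesq I (\<lambda>z z'. if z = u \<and> z' = v then 1 else 0) x y = cnj (x u) * y v"
proof -
  have "sesq I (\<lambda>z z'. if z = u \<and> z' = v then 1 else 0) x y
      = (\<Sum>z\<in>I. if z = u then (\<Sum>z'\<in>I. if z' = v then cnj (x u) * y v else 0) else 0)"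
    unfolding sesq_def by (intro sum.cong) (auto intro!: sum.cong sum.neutral)
  then show ?thesis using assms by simp
qed

lemma sesq_id_mid:
  assumes "finite I"
  shows "sesq I (\<lambda>z z'. if z = z' then 1 else 0) x x = of_real (\<Sum>z\<in>I. (cmod (x z))\<^sup>2)"
proof -
  have "sesq I (\<lambda>z z'. if z = z' then 1 else 0) x x = (\<Sum>z\<in>I. \<Sum>z'\<in>I. if z = z' then cnj (x z) * x z else 0)"
    unfolding sesq_def by (intro sum.cong) auto
  also have "\<dots> = (\<Sum>z\<in>I. cnj (x z) * x z)" using assms by simp
  finally show ?thesis by (simp add: complex_norm_square mult.commute del: of_real_power)
qed

definition graph_matrix :: "(nat \<times> 'n) set \<Rightarrow> (nat \<times> 'n \<Rightarrow> nat) \<Rightarrow> nat \<Rightarrow> nat \<Rightarrow> 'n::finite eprime" where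
  "graph_matrix E \<sigma> j j' = (if j = j' then one_eprime else 0) + (\<Sum>e\<in>E.
     (if j = fst e \<and> j' = \<sigma> e then ecol (snd e) else 0) + (if j = \<sigma> e \<and> j' = fst e then erow (snd e) else 0))"

text \<open>The quadratic form is the squared norm of \<open>x\<close> plus
  \<open>2 * Re (cnj (x (u e)) * x (v e))\<close> for each edge \<open>e\<close>. Sources
  \<open>u e\<close> carry a label \<open>Some\<close>, targets \<open>v e\<close> the label
  \<open>None\<close>, and both maps are injective, \<open>v\<close> because \<open>\<sigma>\<close>
  is. So each coordinate meets at most one edge, and the form dominates the sum of the squared
  moduli of \<open>x (u e) + x (v e)\<close>.\<close>

lemma psd_graph_matrix:
  fixes E :: "(nat \<times> 'n::finite) set"
  assumes E: "E \<subseteq> {..<k} \<times> UNIV" "\<sigma> ` E \<subseteq> {..<k}" "inj_on \<sigma> E"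
  shows "psd_on ({..<k} \<times> UNIV) (\<lambda>(j, a) (j', b). Rep_eprime (graph_matrix E \<sigma> j j') $ a $ b)"
  unfolding psd_on_sesq
proof
  fix x :: "nat \<times> 'n option \<Rightarrow> complex"
  define I where "I = {..<k} \<times> (UNIV :: 'n option set)"
  have finI: "finite I" by (simp add: I_def)
  have finE: "finite E" using E(1) by (rule finite_subset) simp
  define u where "u e = (fst e, Some (snd e))" for e :: "nat \<times> 'n"
  define v where "v e = (\<sigma> e, None :: 'n option)" for e :: "nat \<times> 'n"
  have uI: "u e \<in> I" and vI: "v e \<in> I" if "e \<in> E" for e
    using E(1,2) that by (auto simp: u_def v_def I_def)
  have col: "Rep_eprime (if Q then ecol i else 0) $ a $ b = (if Q \<and> a = Some i \<and> b = None then 1 else 0)"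
    and row: "Rep_eprime (if Q then erow i else 0) $ a $ b = (if Q \<and> a = None \<and> b = Some i then 1 else 0)"
    and one: "Rep_eprime (if Q then one_eprime else 0) $ a $ b = (if Q \<and> a = b then 1 else 0)"
    for Q and i :: 'n and a b
    by (simp_all add: matrix_unit_def Finite_Cartesian_Product.mat_def)
  have "(case z of (j, a) \<Rightarrow> \<lambda>(j', b). Rep_eprime (graph_matrix E \<sigma> j j') $ a $ b) z'
    = (if z = z' then 1 else 0) + (\<Sum>e\<in>E. (if z = u e \<and> z' = v e then 1 else 0) + (if z = v e \<and> z' = u e then 1 else 0))"
    for z z' :: "nat \<times> 'n option"
  proof -
    obtain j a j' b where z: "z = (j, a)" "z' = (j', b)" by (cases z; cases z')
    have "Rep_eprime (graph_matrix E \<sigma> j j') $ a $ b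
      = (if j = j' \<and> a = b then 1 else 0) + (\<Sum>e\<in>E. (if (j = fst e \<and> j' = \<sigma> e) \<and> a = Some (snd e) \<and> b = None then 1 else 0)
         + (if (j = \<sigma> e \<and> j' = fst e) \<and> a = None \<and> b = Some (snd e) then 1 else 0))"
      unfolding graph_matrix_def
      by (simp only: Rep_eprime_simps(2) Rep_eprime_sum vector_add_component sum_component col row one)
    then show ?thesis by (simp add: z u_def v_def conj_ac)
  qed
  then have "sesq I (\<lambda>(j, a) (j', b). Rep_eprime (graph_matrix E \<sigma> j j') $ a $ b) x x
    = sesq I (\<lambda>z z'. (if z = z' then 1 else 0) + (\<Sum>e\<in>E. (if z = u e \<and> z' = v e then 1 else 0) + (if z = v e \<and> z' = u e then 1 else 0))) x x"
    unfolding sesq_def by (simp only:)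
  also have "\<dots> = of_real (\<Sum>z\<in>I. (cmod (x z))\<^sup>2) + (\<Sum>e\<in>E. cnj (x (u e)) * x (v e) + cnj (x (v e)) * x (u e))"
    unfolding sesq_add_mid sesq_sum_mid sesq_id_mid[OF finI]
    by (simp add: sesq_unit_mid[OF finI] uI vI cong: sum.cong)
  also have "\<dots> = of_real ((\<Sum>z\<in>I. (cmod (x z))\<^sup>2) + (\<Sum>e\<in>E. 2 * Re (cnj (x (u e)) * x (v e))))"
  proof -
    have "cnj (x (u e)) * x (v e) + cnj (x (v e)) * x (u e) = of_real (2 * Re (cnj (x (u e)) * x (v e)))" for e
      by (simp add: complex_eq_iff)
    then show ?thesis by simp
  qed
  also have "0 \<le> \<dots>"
  proof -
    have iu: "inj_on u E" by (auto simp: inj_on_def u_def prod_eq_iff)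
    have iv: "inj_on v E" using E(3) by (auto simp: inj_on_def v_def)
    have "(\<Sum>e\<in>E. (cmod (x (u e)))\<^sup>2) + (\<Sum>e\<in>E. (cmod (x (v e)))\<^sup>2)
      = (\<Sum>z\<in>u ` E. (cmod (x z))\<^sup>2) + (\<Sum>z\<in>v ` E. (cmod (x z))\<^sup>2)"
      by (simp add: sum.reindex[OF iu] sum.reindex[OF iv])
    also have "\<dots> = (\<Sum>z\<in>u ` E \<union> v ` E. (cmod (x z))\<^sup>2)"
      using finE by (intro sum.union_disjoint[symmetric]) (auto simp: u_def v_def)
    also have "\<dots> \<le> (\<Sum>z\<in>I. (cmod (x z))\<^sup>2)"
      using uI vI by (intro sum_mono2[OF finI]) auto
    finally have le: "(\<Sum>e\<in>E. (cmod (x (u e)))\<^sup>2 + (cmod (x (v e)))\<^sup>2) \<le> (\<Sum>z\<in>I. (cmod (x z))\<^sup>2)"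
      by (simp add: sum.distrib)
    have sq: "(cmod (a + b))\<^sup>2 = (cmod a)\<^sup>2 + (cmod b)\<^sup>2 + 2 * Re (cnj a * b)" for a b
      by (simp only: cmod_power2) (simp add: power2_eq_square algebra_simps)
    have "0 \<le> (\<Sum>e\<in>E. (cmod (x (u e) + x (v e)))\<^sup>2)" by (intro sum_nonneg) simp
    also have "\<dots> = (\<Sum>e\<in>E. (cmod (x (u e)))\<^sup>2 + (cmod (x (v e)))\<^sup>2) + (\<Sum>e\<in>E. 2 * Re (cnj (x (u e)) * x (v e)))"
      by (simp only: sq sum.distrib)
    finally have "0 \<le> (\<Sum>z\<in>I. (cmod (x z))\<^sup>2) + (\<Sum>e\<in>E. 2 * Re (cnj (x (u e)) * x (v e)))"
      using le by linarith
    then show ?thesis by (simp only: less_eq_complex_def Re_complex_of_real Im_complex_of_real) simp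
  qed
  finally show "0 \<le> sesq ({..<k} \<times> UNIV) (\<lambda>(j, a) (j', b). Rep_eprime (graph_matrix E \<sigma> j j') $ a $ b) x x"
    by (simp only: I_def)
qed

section \<open>From graph representations to compressions of Kronecker products\<close>

lemma sum_graph_matrix:
  fixes E :: "(nat \<times> 'n::finite) set" and G :: "nat \<Rightarrow> nat \<Rightarrow> 'w::complex_vector"
  assumes E: "E \<subseteq> {..<k} \<times> UNIV" "\<sigma> ` E \<subseteq> {..<k}"
  shows "(\<Sum>j<k. \<Sum>j'<k. graph_matrix E \<sigma> j j' \<otimes>\<^sub>t G j j')
    = arrow_tensor (\<Sum>j<k. G j j) (\<lambda>i. \<Sum>j | (j, i) \<in> E. G j (\<sigma> (j, i))) (\<lambda>i. \<Sum>j | (j, i) \<in> E. G (\<sigma> (j, i)) j)"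
proof -
  have finE: "finite E" using E(1) by (rule finite_subset) simp
  have ltE: "fst e < k" "\<sigma> e < k" if "e \<in> E" for e using E that by auto
  have delta: "(\<Sum>j<k. \<Sum>j'<k. (if j = a \<and> j' = b then w else 0) \<otimes>\<^sub>t G j j') = w \<otimes>\<^sub>t G a b"
    if "a < k" "b < k" for a b and w :: "'n eprime"
  proof -
    have "(if j = a \<and> j' = b then w else 0) \<otimes>\<^sub>t G j j' = (if j = a then if j' = b then w \<otimes>\<^sub>t G a b else 0 else 0)" for j j'
      by auto
    then have "(\<Sum>j<k. \<Sum>j'<k. (if j = a \<and> j' = b then w else 0) \<otimes>\<^sub>t G j j')
      = (\<Sum>j<k. \<Sum>j'<k. if j = a then if j' = b then w \<otimes>\<^sub>t G a b else 0 else 0)"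
      by (simp only:)
    also have "\<dots> = (\<Sum>j<k. if j = a then w \<otimes>\<^sub>t G a b else 0)"
      by (rule sum.cong) (use that in auto)
    finally show ?thesis using that by simp
  qed
  have group: "(\<Sum>e\<in>E. H e) = (\<Sum>i\<in>UNIV. \<Sum>j | (j, i) \<in> E. H (j, i))" for H :: "nat \<times> 'n \<Rightarrow> ('n eprime, 'w) tensor"
  proof -
    have "(\<Sum>i\<in>UNIV. \<Sum>j | (j, i) \<in> E. H (j, i)) = (\<Sum>(i, j)\<in>(SIGMA i:UNIV. {j. (j, i) \<in> E}). H (j, i))"
    proof (rule sum.Sigma)
      have "{j. (j, i) \<in> E} \<subseteq> {..<k}" for i using E(1) by auto
      then show "\<forall>i\<in>UNIV. finite {j. (j, i) \<in> E}" using finite_subset by blast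
    qed simp
    also have "\<dots> = (\<Sum>e\<in>E. H e)"
      by (rule sum.reindex_bij_witness[of _ prod.swap prod.swap]) auto
    finally show ?thesis by simp
  qed
  have swap3: "(\<Sum>j<k. \<Sum>j'<k. \<Sum>e\<in>E. H j j' e) = (\<Sum>e\<in>E. \<Sum>j<k. \<Sum>j'<k. H j j' e)"
    for H :: "nat \<Rightarrow> nat \<Rightarrow> nat \<times> 'n \<Rightarrow> ('n eprime, 'w) tensor"
  proof -
    have "(\<Sum>j<k. \<Sum>j'<k. \<Sum>e\<in>E. H j j' e) = (\<Sum>j<k. \<Sum>e\<in>E. \<Sum>j'<k. H j j' e)"
      by (rule sum.cong[OF refl], rule sum.swap)
    also have "\<dots> = (\<Sum>e\<in>E. \<Sum>j<k. \<Sum>j'<k. H j j' e)" by (rule sum.swap)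
    finally show ?thesis .
  qed
  have "(\<Sum>j<k. \<Sum>j'<k. graph_matrix E \<sigma> j j' \<otimes>\<^sub>t G j j')
    = (\<Sum>j<k. \<Sum>j'<k. (if j = j' then one_eprime else 0) \<otimes>\<^sub>t G j j')
      + (\<Sum>j<k. \<Sum>j'<k. \<Sum>e\<in>E. (if j = fst e \<and> j' = \<sigma> e then ecol (snd e) else 0) \<otimes>\<^sub>t G j j')
      + (\<Sum>j<k. \<Sum>j'<k. \<Sum>e\<in>E. (if j = \<sigma> e \<and> j' = fst e then erow (snd e) else 0) \<otimes>\<^sub>t G j j')"
    unfolding graph_matrix_def
    by (simp only: pure_tensor_add_left pure_tensor_sum_left sum.distrib add.assoc)
  also have "(\<Sum>j<k. \<Sum>j'<k. (if j = j' then one_eprime else 0) \<otimes>\<^sub>t G j j') = one_eprime \<otimes>\<^sub>t (\<Sum>j<k. G j j)"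
  proof -
    have "(\<Sum>j<k. \<Sum>j'<k. (if j = j' then one_eprime else 0) \<otimes>\<^sub>t G j j')
      = (\<Sum>j<k. \<Sum>j'<k. if j = j' then one_eprime \<otimes>\<^sub>t G j j else 0)"
      by (intro sum.cong) auto
    then show ?thesis by (simp add: pure_tensor_sum_right)
  qed
  also have "(\<Sum>j<k. \<Sum>j'<k. \<Sum>e\<in>E. (if j = fst e \<and> j' = \<sigma> e then ecol (snd e) else 0) \<otimes>\<^sub>t G j j')
    = (\<Sum>e\<in>E. \<Sum>j<k. \<Sum>j'<k. (if j = fst e \<and> j' = \<sigma> e then ecol (snd e) else 0) \<otimes>\<^sub>t G j j')"
    by (rule swap3)
  also have "\<dots> = (\<Sum>e\<in>E. ecol (snd e) \<otimes>\<^sub>t G (fst e) (\<sigma> e))"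
    by (rule sum.cong[OF refl], rule delta) (auto simp: ltE)
  also have "\<dots> = (\<Sum>i\<in>UNIV. ecol i \<otimes>\<^sub>t (\<Sum>j | (j, i) \<in> E. G j (\<sigma> (j, i))))"
    by (simp add: group pure_tensor_sum_right)
  also have "(\<Sum>j<k. \<Sum>j'<k. \<Sum>e\<in>E. (if j = \<sigma> e \<and> j' = fst e then erow (snd e) else 0) \<otimes>\<^sub>t G j j')
    = (\<Sum>e\<in>E. \<Sum>j<k. \<Sum>j'<k. (if j = \<sigma> e \<and> j' = fst e then erow (snd e) else 0) \<otimes>\<^sub>t G j j')"
    by (rule swap3)
  also have "\<dots> = (\<Sum>e\<in>E. erow (snd e) \<otimes>\<^sub>t G (\<sigma> e) (fst e))"
    by (rule sum.cong[OF refl], rule delta) (auto simp: ltE)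
  also have "\<dots> = (\<Sum>i\<in>UNIV. erow i \<otimes>\<^sub>t (\<Sum>j | (j, i) \<in> E. G (\<sigma> (j, i)) j))"
    by (simp add: group pure_tensor_sum_right)
  finally show ?thesis by (simp only: arrow_tensor_def)
qed

text \<open>\<open>P\<close> will be indexed by \<open>j\<close> and \<open>Q\<close> by pairs
  \<open>(j, s)\<close> encoded as \<open>j * p' + s\<close>. Row \<open>s\<close> of the 0/1 matrix
  picks the Kronecker indices whose two \<open>j\<close> agree, so the compression pairs entry
  \<open>(j, j')\<close> of \<open>P\<close> with block \<open>(j, j')\<close> of \<open>Q\<close>
  and sums.\<close>

lemma compress_select:
  fixes W :: "'v::complex_vector mat"
  assumes "k * p' \<le> m" "p \<le> p'" "s < p" "s' < p"
  shows "compress (Matrix.mat p (k * m) (\<lambda>(s, \<alpha>). if \<alpha> mod m = (\<alpha> div m) * p' + s then 1 else 0)) W $$ (s, s')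
    = (\<Sum>j<k. \<Sum>j'<k. W $$ (j * m + (j * p' + s), j' * m + (j' * p' + s')))"
proof -
  have sel: "(\<Sum>\<alpha><k * m. if \<alpha> mod m = (\<alpha> div m) * p' + s then f \<alpha> else 0) = (\<Sum>j<k. f (j * m + (j * p' + s)))"
    if s: "s < p" for s and f :: "nat \<Rightarrow> 'v"
  proof -
    have lt: "j * p' + s < m" if "j < k" for j
    proof -
      have "j * p' + s < Suc j * p'" using s assms(2) by simp
      also have "\<dots> \<le> k * p'" using that by (intro mult_le_mono1) simp
      finally show ?thesis using assms(1) by simp
    qed
    have "(\<Sum>\<alpha><k * m. if \<alpha> mod m = (\<alpha> div m) * p' + s then f \<alpha> else 0)
      = (\<Sum>\<alpha>\<in>{..<k * m} \<inter> {\<alpha>. \<alpha> mod m = (\<alpha> div m) * p' + s}. f \<alpha>)"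
      by (simp add: sum.inter_restrict)
    also have "\<dots> = (\<Sum>j<k. f (j * m + (j * p' + s)))"
    proof (rule sum.reindex_bij_witness[of _ "\<lambda>j. j * m + (j * p' + s)" "\<lambda>\<alpha>. \<alpha> div m"])
      fix \<alpha> assume "\<alpha> \<in> {..<k * m} \<inter> {\<alpha>. \<alpha> mod m = (\<alpha> div m) * p' + s}"
      then have \<alpha>: "\<alpha> < k * m" "\<alpha> mod m = (\<alpha> div m) * p' + s" by auto
      then show "\<alpha> div m * m + (\<alpha> div m * p' + s) = \<alpha>" by (metis div_mult_mod_eq)
      then show "f (\<alpha> div m * m + (\<alpha> div m * p' + s)) = f \<alpha>" by simp
      show "\<alpha> div m \<in> {..<k}" using \<alpha>(1) by (simp add: less_mult_imp_div_less)
    next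
      fix j assume j: "j \<in> {..<k}"
      then have l: "j * p' + s < m" using lt by simp
      have "j * m + (j * p' + s) < Suc j * m" using l by simp
      also have "\<dots> \<le> k * m" using j by (intro mult_le_mono1) simp
      finally show "j * m + (j * p' + s) \<in> {..<k * m} \<inter> {\<alpha>. \<alpha> mod m = (\<alpha> div m) * p' + s}"
        using l by simp
      show "(j * m + (j * p' + s)) div m = j" using l by simp
    qed
    finally show ?thesis .
  qed
  let ?c = "\<lambda>s \<alpha>. \<alpha> mod m = (\<alpha> div m) * p' + s"
  have "compress (Matrix.mat p (k * m) (\<lambda>(s, \<alpha>). if ?c s \<alpha> then 1 else 0)) W $$ (s, s')
    = (\<Sum>\<alpha><k * m. \<Sum>\<beta><k * m. scaleC ((if ?c s \<alpha> then 1 else 0) * cnj (if ?c s' \<beta> then 1 else 0)) (W $$ (\<alpha>, \<beta>)))"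
    using assms by (simp add: compress_def)
  also have "\<dots> = (\<Sum>\<alpha><k * m. if ?c s \<alpha> then (\<Sum>\<beta><k * m. if ?c s' \<beta> then W $$ (\<alpha>, \<beta>) else 0) else 0)"
    by (intro sum.cong) (auto intro!: sum.cong sum.neutral)
  also have "\<dots> = (\<Sum>\<alpha><k * m. if ?c s \<alpha> then (\<Sum>j'<k. W $$ (\<alpha>, j' * m + (j' * p' + s'))) else 0)"
    unfolding sel[OF assms(4)] ..
  also have "\<dots> = (\<Sum>j<k. \<Sum>j'<k. W $$ (j * m + (j * p' + s), j' * m + (j' * p' + s')))"
    by (rule sel[OF assms(3)])
  finally show ?thesis .
qed

lemma graph_rep_imp_compress:
  fixes A :: "'n::finite \<Rightarrow> 'a::unital_cstar_algebra rcf"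
  assumes rep: "graph_rep C A" and U: "U \<in> carrier_mat p p"
    and dec: "\<And>s s'. s < p \<Longrightarrow> s' < p \<Longrightarrow>
      U $$ (s, s') = arrow_tensor (ent C s s') (\<lambda>i. ent (A i) s s') (\<lambda>i. ent (adj (A i)) s s')"
  shows "\<exists>k m. \<exists>P \<in> os_cone (eprime_opsys :: 'n eprime opsys) k. \<exists>Q \<in> os_cone (cstar_opsys :: 'a opsys) m.
    \<exists>X \<in> carrier_mat p (k * m). U = compress X (kron (\<otimes>\<^sub>t) P Q)"
proof -
  obtain k :: nat and E \<sigma> q where E: "E \<subseteq> {..<k} \<times> UNIV" "\<sigma> ` E \<subseteq> {..<k}" "inj_on \<sigma> E"
    and C: "C = (\<Sum>j<k. adj (q j) * q j)" and A: "\<forall>i. A i = (\<Sum>j | (j, i) \<in> E. adj (q j) * q (\<sigma> (j, i)))"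
    using rep unfolding graph_rep_def by (elim exE conjE) (rule that)
  have "\<forall>j. \<exists>R. \<forall>s<p. \<forall>l\<ge>R. ent (q j) s l = 0 \<and> ent (q j) l s = 0" using ent_bound by blast
  from choice[OF this] obtain R where R: "\<forall>j. \<forall>s<p. \<forall>l\<ge>R j. ent (q j) s l = 0 \<and> ent (q j) l s = 0"
    by (elim exE) (rule that)
  \<comment> \<open>Blocks are padded to width \<open>p'\<close> so that \<open>m = k * p'\<close>
    is also at least the number of rows needed for each \<open>q j\<close> with
    \<open>j < k\<close>: the cone of \<open>cstar_opsys\<close> asks for a square matrix
    \<open>Y\<close>.\<close>
  define p' where "p' = p + (\<Sum>j<k. R j)"
  define m where "m = k * p'"
  have rows: "ent (q j) l s = 0" if "j < k" "l \<ge> m" "s < p" for j l s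
  proof -
    have "R j \<le> (\<Sum>j<k. R j)" using that(1) by (intro member_le_sum) auto
    also have "\<dots> \<le> p'" by (simp add: p'_def)
    also have "\<dots> \<le> m" using that(1) by (simp add: m_def)
    finally show ?thesis using R that by (meson order_trans)
  qed
  define P where "P = Matrix.mat k k (\<lambda>(j, j'). graph_matrix E \<sigma> j j')"
  define Y where "Y = Matrix.mat m m (\<lambda>(l, \<beta>). ent (q (\<beta> div p')) l (\<beta> mod p'))"
  define Q where "Q = star_mat Y * Y"
  define X where "X = Matrix.mat p (k * m) (\<lambda>(s, \<alpha>). if \<alpha> mod m = (\<alpha> div m) * p' + s then 1 else (0::complex))"
  have "psd_on ({..<k} \<times> UNIV) (\<lambda>(i, a) (j, b). Rep_eprime (P $$ (i, j)) $ a $ b)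
    \<longleftrightarrow> psd_on ({..<k} \<times> UNIV) (\<lambda>(j, a) (j', b). Rep_eprime (graph_matrix E \<sigma> j j') $ a $ b)"
    by (rule psd_on_reindex[OF bij_betw_id]) (auto simp: P_def)
  then have Pc: "P \<in> os_cone (eprime_opsys :: 'n eprime opsys) k"
    using psd_graph_matrix[OF E] by (simp add: eprime_opsys_def P_def)
  have Y: "Y \<in> carrier_mat m m" by (simp add: Y_def)
  then have Qc: "Q \<in> os_cone (cstar_opsys :: 'a opsys) m" by (auto simp: cstar_opsys_def Q_def)
  have dims: "dim_row P = k" "dim_col P = k" "dim_row Q = m" "dim_col Q = m"
    using Y by (auto simp: P_def Q_def star_mat_def)
  have lt: "j * p' + s < m" if "j < k" "s < p" for j s
  proof -
    have "j * p' + s < Suc j * p'" using that by (simp add: p'_def)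
    also have "\<dots> \<le> m" using that unfolding m_def by (intro mult_le_mono1) simp
    finally show ?thesis .
  qed
  have Qent: "Q $$ (j * p' + s, j' * p' + s') = ent (adj (q j) * q j') s s'"
    if "j < k" "j' < k" "s < p" "s' < p" for j j' s s'
  proof -
    have sp: "s < p'" "s' < p'" using that by (simp_all add: p'_def)
    have "Q $$ (j * p' + s, j' * p' + s') = (\<Sum>l<m. star (Y $$ (l, j * p' + s)) * Y $$ (l, j' * p' + s'))"
      unfolding Q_def by (rule star_mat_mult_self_index[OF Y]) (use lt that in auto)
    also have "\<dots> = (\<Sum>l<m. star (ent (q j) l s) * ent (q j') l s')"
      by (rule sum.cong) (use lt that sp in \<open>auto simp: Y_def\<close>)
    also have "\<dots> = ent (adj (q j) * q j') s s'"
      by (subst ent_mult[of m]) (use rows that in auto)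
    finally show ?thesis .
  qed
  have "compress X (kron (\<otimes>\<^sub>t) P Q) $$ (s, s') = U $$ (s, s')" if s: "s < p" "s' < p" for s s'
  proof -
    have "compress X (kron (\<otimes>\<^sub>t) P Q) $$ (s, s')
      = (\<Sum>j<k. \<Sum>j'<k. kron (\<otimes>\<^sub>t) P Q $$ (j * m + (j * p' + s), j' * m + (j' * p' + s')))"
      unfolding X_def by (rule compress_select) (use s in \<open>auto simp: m_def p'_def\<close>)
    also have "\<dots> = (\<Sum>j<k. \<Sum>j'<k. graph_matrix E \<sigma> j j' \<otimes>\<^sub>t ent (adj (q j) * q j') s s')"
    proof (intro sum.cong refl)
      fix j j' assume j: "j \<in> {..<k}" "j' \<in> {..<k}"
      have l: "j * p' + s < m" "j' * p' + s' < m" using lt j s by auto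
      have "j * m + (j * p' + s) < Suc j * m" using l by simp
      also have "\<dots> \<le> k * m" using j by (intro mult_le_mono1) simp
      finally have 1: "j * m + (j * p' + s) < k * m" .
      have "j' * m + (j' * p' + s') < Suc j' * m" using l by simp
      also have "\<dots> \<le> k * m" using j by (intro mult_le_mono1) simp
      finally have 2: "j' * m + (j' * p' + s') < k * m" .
      have d: "(j * m + (j * p' + s)) div m = j" "(j * m + (j * p' + s)) mod m = j * p' + s"
        "(j' * m + (j' * p' + s')) div m = j'" "(j' * m + (j' * p' + s')) mod m = j' * p' + s'"
        using l by simp_all
      have "kron (\<otimes>\<^sub>t) P Q $$ (j * m + (j * p' + s), j' * m + (j' * p' + s'))
        = P $$ (j, j') \<otimes>\<^sub>t Q $$ (j * p' + s, j' * p' + s')"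
        unfolding kron_def dims by (subst index_mat(1)[OF 1 2]) (simp only: case_prod_conv d)
      then show "kron (\<otimes>\<^sub>t) P Q $$ (j * m + (j * p' + s), j' * m + (j' * p' + s'))
        = graph_matrix E \<sigma> j j' \<otimes>\<^sub>t ent (adj (q j) * q j') s s'"
        using j s by (simp add: Qent P_def)
    qed
    also have "\<dots> = U $$ (s, s')"
      unfolding sum_graph_matrix[OF E(1,2)] dec[OF s] C
      by (simp only: A ent_sum adj_sum adj_mult adj_adj)
    finally show ?thesis .
  qed
  then have "U = compress X (kron (\<otimes>\<^sub>t) P Q)"
    using U by (intro eq_matI) (auto simp: compress_def X_def)
  moreover have "X \<in> carrier_mat p (k * m)" by (simp add: X_def)
  ultimately show ?thesis using Pc Qc by blast
qed

lemma min_cone_subset_max_cone: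
  fixes U :: "('n::finite eprime, 'a::unital_cstar_algebra) tensor mat"
  assumes U: "U \<in> os_cone (min_tensor (eprime_opsys :: 'n eprime opsys) (cstar_opsys :: 'a opsys)) p"
  shows "U \<in> os_cone (max_tensor (eprime_opsys :: 'n eprime opsys) (cstar_opsys :: 'a opsys)) p"
proof -
  have car: "U \<in> carrier_mat p p" using U by (simp add: min_tensor_def)
  obtain c a b where
    dec: "\<And>s s'. s < p \<Longrightarrow> s' < p \<Longrightarrow> U $$ (s, s') = arrow_tensor (c s s') (a s s') (b s s')" and
    blocks: "\<And>\<epsilon>::real. \<epsilon> > 0 \<Longrightarrow> \<exists>y. (\<forall>x. y x * corner p = y x) \<and> (\<forall>x x'. adj (y x) * y x' =
      block p (\<lambda>s s'. arrow_entry (c s s' + (if s = s' then of_real \<epsilon> else 0)) (a s s') (b s s') x x'))"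
    using min_cone_imp_blocks[OF U] by blast
  have "\<exists>k m. \<exists>P \<in> os_cone (eprime_opsys :: 'n eprime opsys) k. \<exists>Q \<in> os_cone (cstar_opsys :: 'a opsys) m.
    \<exists>X \<in> carrier_mat p (k * m).
      Matrix.mat p p (\<lambda>(i, j). if i = j then scaleC (complex_of_real \<epsilon>)
        (os_unit (eprime_opsys :: 'n eprime opsys) \<otimes>\<^sub>t os_unit (cstar_opsys :: 'a opsys)) else 0) + U
      = compress X (kron (\<otimes>\<^sub>t) P Q)" if \<epsilon>: "\<epsilon> > 0" for \<epsilon> :: real
  proof -
    \<comment> \<open>One half makes the arrow matrix a Gram matrix, the other is spent in
      \<open>graph_rep_arrow\<close>.\<close>
    have \<epsilon>2: "\<epsilon> / 2 > 0" using \<epsilon> by simp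
    obtain y where yc: "\<forall>x. y x * corner p = y x" and
      yy: "\<forall>x x'. adj (y x) * y x' =
        block p (\<lambda>s s'. arrow_entry (c s s' + (if s = s' then of_real (\<epsilon> / 2) else 0)) (a s s') (b s s') x x')"
      using blocks[OF \<epsilon>2] by blast
    define C where "C = block p (\<lambda>s s'. c s s' + (if s = s' then of_real (\<epsilon> / 2) else 0))"
    have diag: "adj (y x) * y x = C" for x
      unfolding yy[rule_format] C_def by (cases x) (simp_all add: arrow_entry_def)
    have off: "adj (y (Some i)) * y (Some j) = 0" if "i \<noteq> j" for i j
      unfolding yy[rule_format] by (rule rcf_eqI) (simp add: arrow_entry_def that)
    have A: "adj (y (Some i)) * y None = block p (\<lambda>s s'. a s s' i)" for i
      unfolding yy[rule_format] by (simp add: arrow_entry_def)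
    have B: "adj (adj (y (Some i)) * y None) = block p (\<lambda>s s'. b s s' i)" for i
    proof -
      have "adj (adj (y (Some i)) * y None) = adj (y None) * y (Some i)" by (simp only: adj_mult adj_adj)
      also have "\<dots> = block p (\<lambda>s s'. b s s' i)"
        unfolding yy[rule_format] by (simp add: arrow_entry_def)
      finally show ?thesis .
    qed
    have rep: "graph_rep (C + (\<epsilon> / 2) *\<^sub>R 1) (\<lambda>i. adj (y (Some i)) * y None)"
      by (rule graph_rep_arrow[where y = y, OF diag off yc[rule_format] \<epsilon>2])
    show ?thesis
    proof (rule graph_rep_imp_compress[OF rep])
      show "Matrix.mat p p (\<lambda>(i, j). if i = j then scaleC (complex_of_real \<epsilon>)
        (os_unit (eprime_opsys :: 'n eprime opsys) \<otimes>\<^sub>t os_unit (cstar_opsys :: 'a opsys)) else 0) + U \<in> carrier_mat p p"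
        using car by simp
      fix s s' assume s: "s < p" "s' < p"
      have unit: "scaleC (complex_of_real \<epsilon>) (one_eprime \<otimes>\<^sub>t (1::'a)) = arrow_tensor (of_real \<epsilon>) (\<lambda>i. 0) (\<lambda>i. 0)"
        by (simp add: arrow_tensor_def of_real_def scaleR_scaleC pure_tensor_scaleC_right)
      have zero: "(0 :: ('n eprime, 'a) tensor) = arrow_tensor 0 (\<lambda>i. 0) (\<lambda>i. 0)"
        by (simp add: arrow_tensor_def)
      have E: "ent (C + (\<epsilon> / 2) *\<^sub>R 1) s s' = (if s = s' then of_real \<epsilon> else 0) + c s s'"
        using s by (simp add: C_def of_real_def) (simp flip: scaleR_add_left)
      show "(Matrix.mat p p (\<lambda>(i, j). if i = j then scaleC (complex_of_real \<epsilon>)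
        (os_unit (eprime_opsys :: 'n eprime opsys) \<otimes>\<^sub>t os_unit (cstar_opsys :: 'a opsys)) else 0) + U) $$ (s, s')
        = arrow_tensor (ent (C + (\<epsilon> / 2) *\<^sub>R 1) s s') (\<lambda>i. ent (adj (y (Some i)) * y None) s s')
            (\<lambda>i. ent (adj (adj (y (Some i)) * y None)) s s')"
        unfolding B unfolding A E using s car
        by (simp add: dec eprime_opsys_def cstar_opsys_def unit zero arrow_tensor_add)
    qed
  qed
  then show ?thesis using car by (simp add: max_tensor_def)
qed

section \<open>The maximal cones are contained in the minimal cones\<close>

text \<open>Nonnegativity of a complex number includes reality: two values of \<open>d\<close> force
  the imaginary part to vanish, and small \<open>d\<close> settle the real part.\<close>

lemma nonneg_complex_limit:
  fixes z s :: complex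
  assumes "\<And>d::real. d > 0 \<Longrightarrow> 0 \<le> z + of_real d * s"
  shows "0 \<le> z"
proof -
  have re: "0 \<le> Re z + d * Re s" and im: "Im z + d * Im s = 0" if "d > 0" for d
    using assms[OF that] by (auto simp: less_eq_complex_def)
  have "Im z = 0" using im[of 1] im[of 2] by simp
  moreover have "0 \<le> Re z"
  proof (rule field_le_epsilon)
    fix e :: real assume e: "e > 0"
    define d where "d = e / (\<bar>Re s\<bar> + 1)"
    have d: "d > 0" using e by (simp add: d_def add_nonneg_pos)
    have "d * Re s \<le> d * (\<bar>Re s\<bar> + 1)" using d by (intro mult_left_mono) auto
    also have "\<dots> = e" using e by (simp add: d_def add_nonneg_eq_0_iff)
    finally show "0 \<le> Re z + e" using re[OF d] by linarith
  qed
  ultimately show ?thesis by (simp add: less_eq_complex_def)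
qed

section \<open>Tensor products of positive semidefinite forms\<close>

lemma psd_on_conj:
  assumes "psd_on J K"
  shows "psd_on I (\<lambda>z z'. sesq J K (W z) (W z'))"
  unfolding psd_on_sesq
proof
  fix x
  have "sesq I (\<lambda>z z'. sesq J K (W z) (W z')) x x
    = sesq J K (\<lambda>i. \<Sum>a\<in>I. x a * W a i) (\<lambda>i. \<Sum>a\<in>I. x a * W a i)"
    unfolding sum_sandwich[symmetric] by (simp add: sesq_def)
  then show "0 \<le> sesq I (\<lambda>z z'. sesq J K (W z) (W z')) x x"
    using assms by (simp add: psd_on_sesq)
qed

text \<open>Conjugation by the 0/1 matrix of \<open>f\<close>; indices may be repeated.\<close>

lemma psd_on_pullback:
  assumes "finite J" "psd_on J K" "\<And>z. z \<in> I \<Longrightarrow> f z \<in> J"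
    and "\<And>z z'. z \<in> I \<Longrightarrow> z' \<in> I \<Longrightarrow> T z z' = K (f z) (f z')"
  shows "psd_on I T"
proof -
  have "psd_on I T \<longleftrightarrow> psd_on I (\<lambda>z z'. sesq J K (\<lambda>k. if k = f z then 1 else 0) (\<lambda>k. if k = f z' then 1 else 0))"
    by (rule psd_on_reindex[OF bij_betw_id]) (use assms in \<open>simp add: sesq_delta\<close>)
  then show ?thesis using psd_on_conj[OF assms(2)] by simp
qed

text \<open>\<open>orthonormalize\<close> writes \<open>B\<close> as a Gram matrix with coordinates
  \<open>\<xi>\<close>, which splits the form of the tensor product into a sum of values of the form
  of \<open>A\<close>.\<close>

lemma psd_on_tensor_posdef:
  assumes L: "finite L" and A: "psd_on I A" and B: "posdef_on L B"
  shows "0 \<le> sesq (I \<times> L) (\<lambda>(i, l) (i', l'). A i i' * B l l') x x"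
proof -
  obtain S where S: "\<forall>a\<in>L. \<forall>b\<in>L. sesq L B (S a) (S b) = (if a = b then 1 else 0)"
    and span: "\<forall>x. \<exists>\<xi>. \<forall>i\<in>L. x i = (\<Sum>a\<in>L. \<xi> a * S a i)"
    using orthonormalize[OF L B] by (elim exE conjE) (rule that)
  have "\<forall>l. \<exists>\<xi>. \<forall>k\<in>L. (if k = l then 1 else 0) = (\<Sum>a\<in>L. \<xi> a * S a k)"
  proof
    fix l
    show "\<exists>\<xi>. \<forall>k\<in>L. (if k = l then 1 else 0) = (\<Sum>a\<in>L. \<xi> a * S a k)" using span by (rule spec)
  qed
  from choice[OF this] obtain \<xi> where \<xi>: "\<forall>l. \<forall>k\<in>L. (if k = l then 1 else 0) = (\<Sum>a\<in>L. \<xi> l a * S a k)"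
    by (elim exE) (rule that)
  have Bg: "B l l' = (\<Sum>a\<in>L. cnj (\<xi> l a) * \<xi> l' a)" if "l \<in> L" "l' \<in> L" for l l'
  proof -
    have "B l l' = sesq L B (\<lambda>k. if k = l then 1 else 0) (\<lambda>k. if k = l' then 1 else 0)"
      using L that by (simp add: sesq_delta)
    also have "\<dots> = sesq L B (\<lambda>k. \<Sum>a\<in>L. \<xi> l a * S a k) (\<lambda>k. \<Sum>a\<in>L. \<xi> l' a * S a k)"
      by (rule sesq_cong) (simp_all add: \<xi>)
    also have "\<dots> = (\<Sum>a\<in>L. \<Sum>b\<in>L. cnj (\<xi> l a) * (if a = b then 1 else 0) * \<xi> l' b)"
      unfolding sum_sandwich[symmetric] using S by (intro sum.cong refl) simp
    also have "\<dots> = (\<Sum>a\<in>L. \<Sum>b\<in>L. if a = b then cnj (\<xi> l a) * \<xi> l' a else 0)"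
      by (intro sum.cong refl) simp
    finally show ?thesis using L by simp
  qed
  define w where "w a i = (\<Sum>l\<in>L. \<xi> l a * x (i, l))" for a i
  have "sesq (I \<times> L) (\<lambda>(i, l) (i', l'). A i i' * B l l') x x
    = (\<Sum>i\<in>I. \<Sum>l\<in>L. \<Sum>i'\<in>I. \<Sum>l'\<in>L. \<Sum>a\<in>L. cnj (\<xi> l a * x (i, l)) * A i i' * (\<xi> l' a * x (i', l')))"
    unfolding sesq_Times
    by (intro sum.cong refl) (simp add: Bg sum_distrib_left sum_distrib_right mult_ac)
  also have "\<dots> = (\<Sum>a\<in>L. \<Sum>i\<in>I. \<Sum>i'\<in>I. \<Sum>l\<in>L. \<Sum>l'\<in>L. cnj (\<xi> l a * x (i, l)) * A i i' * (\<xi> l' a * x (i', l')))"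
  proof -
    define G where "G a i i' l l' = cnj (\<xi> l a * x (i, l)) * A i i' * (\<xi> l' a * x (i', l'))" for a i i' l l'
    have "(\<Sum>i\<in>I. \<Sum>l\<in>L. \<Sum>i'\<in>I. \<Sum>l'\<in>L. \<Sum>a\<in>L. G a i i' l l')
      = (\<Sum>i\<in>I. \<Sum>l\<in>L. \<Sum>i'\<in>I. \<Sum>a\<in>L. \<Sum>l'\<in>L. G a i i' l l')"
      by (rule sum.cong[OF refl], rule sum.cong[OF refl], rule sum.cong[OF refl], rule sum.swap)
    also have "\<dots> = (\<Sum>i\<in>I. \<Sum>l\<in>L. \<Sum>a\<in>L. \<Sum>i'\<in>I. \<Sum>l'\<in>L. G a i i' l l')"
      by (rule sum.cong[OF refl], rule sum.cong[OF refl], rule sum.swap)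
    also have "\<dots> = (\<Sum>i\<in>I. \<Sum>a\<in>L. \<Sum>l\<in>L. \<Sum>i'\<in>I. \<Sum>l'\<in>L. G a i i' l l')"
      by (rule sum.cong[OF refl], rule sum.swap)
    also have "\<dots> = (\<Sum>a\<in>L. \<Sum>i\<in>I. \<Sum>l\<in>L. \<Sum>i'\<in>I. \<Sum>l'\<in>L. G a i i' l l')"
      by (rule sum.swap)
    also have "\<dots> = (\<Sum>a\<in>L. \<Sum>i\<in>I. \<Sum>i'\<in>I. \<Sum>l\<in>L. \<Sum>l'\<in>L. G a i i' l l')"
      by (rule sum.cong[OF refl], rule sum.cong[OF refl], rule sum.swap)
    finally show ?thesis by (simp only: G_def)
  qed
  also have "\<dots> = (\<Sum>a\<in>L. sesq I A (w a) (w a))"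
    unfolding sesq_def w_def cnj_sum sum_distrib_left sum_distrib_right
    by (rule sum.cong[OF refl], rule sum.cong[OF refl], rule sum.cong[OF refl], rule sum.swap)
  also have "0 \<le> \<dots>" using A by (intro sum_nonneg) (simp add: psd_on_sesq)
  finally show ?thesis .
qed

text \<open>A small multiple of the identity makes \<open>B\<close> definite and is then sent to
  0.\<close>

lemma psd_on_tensor:
  fixes I :: "'i set" and L :: "'l set"
  assumes L: "finite L" and A: "psd_on I A" and B: "psd_on L B"
  shows "psd_on (I \<times> L) (\<lambda>(i, l) (i', l'). A i i' * B l l')"
  unfolding psd_on_sesq
proof
  fix x
  define D :: "'l \<Rightarrow> 'l \<Rightarrow> complex" where "D = (\<lambda>l l'. if l = l' then 1 else (0::complex))"
  show "0 \<le> sesq (I \<times> L) (\<lambda>(i, l) (i', l'). A i i' * B l l') x x"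
  proof (rule nonneg_complex_limit)
    fix d :: real assume d: "d > 0"
    have "posdef_on L (\<lambda>l l'. B l l' + of_real d * D l l')"
      unfolding posdef_on_def
    proof (intro allI impI)
      fix y :: "'l \<Rightarrow> complex" assume "\<exists>i\<in>L. y i \<noteq> 0"
      then obtain i where "i \<in> L" "y i \<noteq> 0" by blast
      then have "0 < (\<Sum>z\<in>L. (cmod (y z))\<^sup>2)" using L by (intro sum_pos2[of _ i]) auto
      then have "0 < complex_of_real (d * (\<Sum>z\<in>L. (cmod (y z))\<^sup>2))"
        using d by (simp only: less_complex_def Re_complex_of_real Im_complex_of_real) simp
      moreover have "sesq L (\<lambda>l l'. B l l' + of_real d * D l l') y y
        = sesq L B y y + complex_of_real (d * (\<Sum>z\<in>L. (cmod (y z))\<^sup>2))"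
        unfolding sesq_add_mid sesq_scale_mid D_def sesq_id_mid[OF L] by simp
      moreover have "0 \<le> sesq L B y y" using B by (simp add: psd_on_sesq)
      ultimately show "0 < sesq L (\<lambda>l l'. B l l' + of_real d * D l l') y y"
        by (simp only: add_nonneg_pos)
    qed
    from psd_on_tensor_posdef[OF L A this, of x]
    have "0 \<le> sesq (I \<times> L) (\<lambda>(i, l) (i', l'). A i i' * (B l l' + of_real d * D l l')) x x" .
    also have "\<dots> = sesq (I \<times> L) (\<lambda>(i, l) (i', l'). A i i' * B l l') x x
        + of_real d * sesq (I \<times> L) (\<lambda>(i, l) (i', l'). A i i' * D l l') x x"
      unfolding sesq_Times by (simp add: sum.distrib sum_distrib_left algebra_simps)
    finally show "0 \<le> sesq (I \<times> L) (\<lambda>(i, l) (i', l'). A i i' * B l l') x x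
        + of_real d * sesq (I \<times> L) (\<lambda>(i, l) (i', l'). A i i' * D l l') x x" .
  qed
qed

text \<open>The general direction: the images of \<open>P\<close> and \<open>Q\<close> have a
  positive tensor product, scalar compression preserves this, and the \<open>\<epsilon>\<close>
  disappears in the limit.\<close>

lemma max_cone_subset_min_cone:
  fixes S :: "'v::complex_vector opsys" and T :: "'w::complex_vector opsys"
  assumes U: "U \<in> os_cone (max_tensor S T) p"
  shows "U \<in> os_cone (min_tensor S T) p"
proof -
  have car: "U \<in> carrier_mat p p" using U by (simp add: max_tensor_def)
  have "map_mat (tensor_map k m \<phi> \<psi>) U \<in> matrix_cone (k * m) p" if \<phi>: "ucp S k \<phi>" and \<psi>: "ucp T m \<psi>" for k m \<phi> \<psi>
  proof -
    note u\<phi> = \<phi>[unfolded ucp_def] and u\<psi> = \<psi>[unfolded ucp_def]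
    define B where "B i j = (\<lambda>v w. kron (*) (\<phi> v) (\<psi> w) $$ (i, j))" for i j
    have Bb: "bilinear_form (B i j)"
      and Be: "B i j v w = \<phi> v $$ (i div m, j div m) * \<psi> w $$ (i mod m, j mod m)" if "i < k * m" "j < k * m" for i j v w
      unfolding B_def using bilinear_form_kron[of \<phi> \<psi> k m i j] u\<phi> u\<psi> that by blast+
    define LU where "LU = (\<lambda>(s, i) (s', j). tensor_lift (B i j) (U $$ (s, s')))"
    define Z where "Z = {..<p} \<times> {..<k * m}"
    have "psd_on Z LU"
      unfolding psd_on_sesq
    proof
      fix x
      show "0 \<le> sesq Z LU x x"
      proof (rule nonneg_complex_limit)
        fix \<epsilon> :: real assume "\<epsilon> > 0"
        then obtain k' m' P Q X where P: "P \<in> os_cone S k'" and Q: "Q \<in> os_cone T m'"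
          and X: "X \<in> carrier_mat p (k' * m')"
          and eq: "Matrix.mat p p (\<lambda>(i, j). if i = j then scaleC (complex_of_real \<epsilon>) (os_unit S \<otimes>\<^sub>t os_unit T) else 0) + U
            = compress X (kron (\<otimes>\<^sub>t) P Q)"
          using U unfolding max_tensor_def by auto
        have mP: "map_mat \<phi> P \<in> matrix_cone k k'" and mQ: "map_mat \<psi> Q \<in> matrix_cone m m'"
          using u\<phi> u\<psi> P Q by blast+
        have dimP: "dim_row P = k'" "dim_col P = k'" and dimQ: "dim_row Q = m'" "dim_col Q = m'"
          using mP mQ by (auto simp: matrix_cone_def)
        have psdP: "psd_on ({..<k'} \<times> {..<k}) (\<lambda>(j, a) (j', a'). map_mat \<phi> P $$ (j, j') $$ (a, a'))"
          and psdQ: "psd_on ({..<m'} \<times> {..<m}) (\<lambda>(l, b) (l', b'). map_mat \<psi> Q $$ (l, l') $$ (b, b'))"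
          using mP mQ by (auto simp: matrix_cone_def)
        \<comment> \<open>\<open>\<phi> \<otimes> \<psi>\<close> applied to
          \<open>P \<otimes> Q\<close>, with both Kronecker indices split; \<open>f\<close> regroups
          them so that \<open>psd_on_tensor\<close> applies.\<close>
        define K where "K = (\<lambda>(\<alpha>, i) (\<beta>, j). map_mat \<phi> P $$ (\<alpha> div m', \<beta> div m') $$ (i div m, j div m)
            * map_mat \<psi> Q $$ (\<alpha> mod m', \<beta> mod m') $$ (i mod m, j mod m))"
        define J where "J = {..<k' * m'} \<times> {..<k * m}"
        define f where "f = (\<lambda>(\<alpha>, i). ((\<alpha> div m', i div m), (\<alpha> mod m', i mod m)))"
        have pos: "m' > 0" "m > 0" if "(\<alpha>, i) \<in> J" for \<alpha> i
          using that unfolding J_def by (cases m'; cases m; auto)+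
        have psdK: "psd_on J K"
        proof (rule psd_on_pullback[OF _ psd_on_tensor[OF _ psdP psdQ], where f = f])
          fix z assume "z \<in> J"
          then obtain \<alpha> i where z: "z = (\<alpha>, i)" "\<alpha> < k' * m'" "i < k * m" "(\<alpha>, i) \<in> J" by (auto simp: J_def)
          then show "f z \<in> ({..<k'} \<times> {..<k}) \<times> {..<m'} \<times> {..<m}"
            using pos[OF z(4)] by (auto simp: f_def less_mult_imp_div_less)
        qed (auto simp: f_def K_def)
        \<comment> \<open>The rows of \<open>X\<close> tensored with the identity, conjugated
          because \<open>sesq\<close> conjugates its first argument.\<close>
        define W :: "nat \<times> nat \<Rightarrow> nat \<times> nat \<Rightarrow> complex"
          where "W = (\<lambda>(s, i) (\<alpha>, i'). if i' = i then cnj (X $$ (s, \<alpha>)) else 0)"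
        have entry: "sesq J K (W z) (W z') = LU z z' + of_real \<epsilon> * (if z = z' then 1 else 0)" if zz: "z \<in> Z" "z' \<in> Z" for z z'
        proof -
          obtain s i s' j where z: "z = (s, i)" "z' = (s', j)" "s < p" "s' < p" "i < k * m" "j < k * m"
            using zz by (auto simp: Z_def)
          have "sesq J K (W z) (W z') = (\<Sum>\<alpha><k' * m'. \<Sum>i'<k * m. \<Sum>\<beta><k' * m'. \<Sum>j'<k * m.
              if i' = i then if j' = j then X $$ (s, \<alpha>) * K (\<alpha>, i) (\<beta>, j) * cnj (X $$ (s', \<beta>)) else 0 else 0)"
          proof -
            have "K = (\<lambda>(\<alpha>, i) (\<beta>, j). K (\<alpha>, i) (\<beta>, j))" by auto
            then have "sesq J K (W z) (W z') = (\<Sum>\<alpha><k' * m'. \<Sum>i'<k * m. \<Sum>\<beta><k' * m'. \<Sum>j'<k * m.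
              cnj (W z (\<alpha>, i')) * K (\<alpha>, i') (\<beta>, j') * W z' (\<beta>, j'))"
              unfolding J_def using sesq_Times[where M = "\<lambda>\<alpha> \<beta> i j. K (\<alpha>, i) (\<beta>, j)"] by metis
            also have "\<dots> = (\<Sum>\<alpha><k' * m'. \<Sum>i'<k * m. \<Sum>\<beta><k' * m'. \<Sum>j'<k * m.
              if i' = i then if j' = j then X $$ (s, \<alpha>) * K (\<alpha>, i) (\<beta>, j) * cnj (X $$ (s', \<beta>)) else 0 else 0)"
              by (intro sum.cong refl) (simp add: W_def z)
            finally show ?thesis .
          qed
          also have "\<dots> = (\<Sum>\<alpha><k' * m'. \<Sum>i'<k * m. if i' = i then (\<Sum>\<beta><k' * m'. X $$ (s, \<alpha>) * K (\<alpha>, i) (\<beta>, j) * cnj (X $$ (s', \<beta>))) else 0)"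
            by (intro sum.cong refl) (use z in auto)
          also have "\<dots> = (\<Sum>\<alpha><k' * m'. \<Sum>\<beta><k' * m'. X $$ (s, \<alpha>) * K (\<alpha>, i) (\<beta>, j) * cnj (X $$ (s', \<beta>)))"
            using z by simp
          also have "\<dots> = (\<Sum>\<alpha><k' * m'. \<Sum>\<beta><k' * m'. X $$ (s, \<alpha>) * cnj (X $$ (s', \<beta>))
              * tensor_lift (B i j) (kron (\<otimes>\<^sub>t) P Q $$ (\<alpha>, \<beta>)))"
          proof (intro sum.cong refl)
            fix \<alpha> \<beta> assume "\<alpha> \<in> {..<k' * m'}" "\<beta> \<in> {..<k' * m'}"
            then have \<alpha>: "\<alpha> < k' * m'" "\<beta> < k' * m'" by auto
            then have "m' > 0" by (cases m') auto
            have "kron (\<otimes>\<^sub>t) P Q $$ (\<alpha>, \<beta>) = P $$ (\<alpha> div m', \<beta> div m') \<otimes>\<^sub>t Q $$ (\<alpha> mod m', \<beta> mod m')"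
              using \<alpha> by (simp add: kron_def dimP dimQ)
            then have "tensor_lift (B i j) (kron (\<otimes>\<^sub>t) P Q $$ (\<alpha>, \<beta>)) = K (\<alpha>, i) (\<beta>, j)"
              using z \<alpha> \<open>m' > 0\<close> by (simp add: tensor_lift_pure[OF Bb] Be K_def dimP dimQ less_mult_imp_div_less)
            then show "X $$ (s, \<alpha>) * K (\<alpha>, i) (\<beta>, j) * cnj (X $$ (s', \<beta>))
              = X $$ (s, \<alpha>) * cnj (X $$ (s', \<beta>)) * tensor_lift (B i j) (kron (\<otimes>\<^sub>t) P Q $$ (\<alpha>, \<beta>))"
              by simp
          qed
          also have "\<dots> = tensor_lift (B i j) (compress X (kron (\<otimes>\<^sub>t) P Q) $$ (s, s'))"
            using z X by (simp add: compress_def tensor_lift_sum[OF Bb] tensor_lift_scaleC[OF Bb])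
          also have "compress X (kron (\<otimes>\<^sub>t) P Q) $$ (s, s')
            = (if s = s' then scaleC (complex_of_real \<epsilon>) (os_unit S \<otimes>\<^sub>t os_unit T) else 0) + U $$ (s, s')"
            unfolding eq[symmetric] using z car by simp
          also have "tensor_lift (B i j) \<dots> = LU z z' + of_real \<epsilon> * (if z = z' then 1 else 0)"
          proof -
            have l0: "tensor_lift (B i j) 0 = 0" using tensor_lift_scaleC[OF Bb[OF z(5,6)], of 0 0] by simp
            have u: "\<phi> (os_unit S) = 1\<^sub>m k" "\<psi> (os_unit T) = 1\<^sub>m m" using u\<phi> u\<psi> by blast+
            have "m > 0" using z(5) by (cases m) auto
            then have "B i j (os_unit S) (os_unit T) = (if i = j then 1 else 0)"
              unfolding Be[OF z(5,6)] u using z(5,6)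
              by (auto simp: less_mult_imp_div_less) (metis div_mult_mod_eq)
            then show ?thesis
              using z by (auto simp: LU_def tensor_lift_add[OF Bb] tensor_lift_scaleC[OF Bb] tensor_lift_pure[OF Bb] l0)
          qed
          finally show ?thesis .
        qed
        have "0 \<le> sesq Z (\<lambda>z z'. sesq J K (W z) (W z')) x x"
          using psd_on_conj[OF psdK, of Z W] by (simp add: psd_on_sesq)
        also have "\<dots> = sesq Z (\<lambda>z z'. LU z z' + of_real \<epsilon> * (if z = z' then 1 else 0)) x x"
          unfolding sesq_def[of Z] by (intro sum.cong refl) (simp only: entry)
        also have "\<dots> = sesq Z LU x x + of_real \<epsilon> * sesq Z (\<lambda>z z'. if z = z' then 1 else 0) x x"
          unfolding sesq_add_mid sesq_scale_mid ..
        finally show "0 \<le> sesq Z LU x x + of_real \<epsilon> * sesq Z (\<lambda>z z'. if z = z' then 1 else 0) x x" .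
      qed
    qed
    moreover have "psd_on Z (\<lambda>(s, i) (s', j). map_mat (tensor_map k m \<phi> \<psi>) U $$ (s, s') $$ (i, j)) \<longleftrightarrow> psd_on Z LU"
      by (rule psd_on_reindex[OF bij_betw_id]) (use car in \<open>auto simp: Z_def LU_def B_def tensor_map_def\<close>)
    ultimately show ?thesis using car by (simp add: matrix_cone_def Z_def tensor_map_def)
  qed
  then show ?thesis using car by (simp add: min_tensor_def)
qed

theorem corollary5p9:
  assumes "CARD('n::finite) \<ge> 2"
  shows "complete_order_iso
    (min_tensor (eprime_opsys :: 'n eprime opsys) (cstar_opsys :: 'a::unital_cstar_algebra opsys))
    (max_tensor (eprime_opsys :: 'n eprime opsys) (cstar_opsys :: 'a opsys))
    id"
proof -
  have "U \<in> os_cone (min_tensor eprime_opsys cstar_opsys) p \<longleftrightarrow> map_mat id U \<in> os_cone (max_tensor eprime_opsys cstar_opsys) p"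
    for p and U :: "('n eprime, 'a) tensor mat"
  proof -
    have "map_mat id U = U" by (intro eq_matI) auto
    then show ?thesis using min_cone_subset_max_cone[of U p] max_cone_subset_min_cone[of U _ _ p] by auto
  qed
  then show ?thesis
    by (simp add: complete_order_iso_def min_tensor_def max_tensor_def)
qed

end
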